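(* There exist $\delta_0>0$, $h_0>0$ and a constant $C$, independent of $h$ and $\delta$, such that for all $0<\delta<\delta_0$ and all $0<h\le h_0$ the following holds. If $\psi^0=(\psi^0_j)_{j\in\mathbb{Z}}\in V_h$ satisfies $$\operatorname{dist}(i_h\psi^0,\Gamma)\le\delta,$$ then the solution $\psi(t)=(\psi_j(t))_{j\in\mathbb{Z}}$, with $\psi(0)=\psi^0$, of the discrete nonlinear Schr\"odinger equation $$i\dot\psi_\ell=-\frac{1}{h^2}(\psi_{\ell+1}+\psi_{\ell-1}-2\psi_\ell)-|\psi_\ell|^2\psi_\ell,\qquad \ell\in\mathbb{Z},$$ satisfies $$\forall\,t\ge0,\qquad \operatorname{dist}(i_h\psi(t),\Gamma)\le C(\delta+h).$$
   Context: Let $H(\psi)=\int_{\mathbb{R}}\big[|\psi_x|^2-\tfrac12|\psi|^4\big]dx$ and $N(\psi)=\int_{\mathbb{R}}|\psi|^2dx$ for $\psi\in H^1(\mathbb{R};\mathbb{C})$. Let $\eta$ be the positive even (i.e. symmetric, $\eta(-x)=\eta(x)$) minimizer of $H$ under the constraint $N=1$, explicitly $\eta(x)=\frac{1}{2\sqrt2}\,\mathrm{sech}(x/4)$, and let $\Gamma=\{e^{i\alpha}\eta:\alpha\in\mathbb{R}\}$. The distance $\operatorname{dist}(\varphi,\Gamma)=\inf_{\nu\in\Gamma}\|\varphi-\nu\|_{H^1}$ is measured in the norm $\|\varphi\|_{H^1}^2=\int_{\mathbb{R}}(|\varphi|^2+|\partial_x\varphi|^2)\,dx$. For $h>0$,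 $V_h$ is the space of complex sequences $(\psi_j)_{j\in\mathbb{Z}}$ with $\psi_j=\psi_{-j}$ for all $j$ and finite norm $\|\psi\|_h$, where $\|\psi\|_h^2=2h\sum_{j\in\mathbb{Z}}\frac{|\psi_{j+1}-\psi_j|^2}{h^2}+h\sum_{j\in\mathbb{Z}}|\psi_j|^2$. Let $s:\mathbb{R}\to\mathbb{R}$ be the hat function $s(x)=\max(0,1-|x|)$. The map $i_h:V_h\to H^1(\mathbb{R};\mathbb{C})$ is $(i_h\psi)(x)=\sum_{j\in\mathbb{Z}}\psi_j\,s\!\left(\frac{x}{h}-j\right)$ (piecewise linear interpolation). *)

theory Defs
  imports "HOL-Analysis.Analysis"
begin

text \<open>
  The Sobolev space \<open>H\<^sup>1(\<real>;\<complex>)\<close> is built from weak derivatives. As is usual in dimension one,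
  test functions are real-valued, \<open>C\<^sup>1\<close> and compactly supported (taking \<open>C\<^sup>\<infinity>\<close> test functions
  instead gives the same weak derivatives). Functions are used as representatives of their
  classes modulo equality almost everywhere.
\<close>

definition test_function :: "(real \<Rightarrow> real) \<Rightarrow> bool" where
  "test_function \<phi> \<longleftrightarrow> \<phi> C1_differentiable_on UNIV \<and> compact (closure {x. \<phi> x \<noteq> 0})"

definition L2 :: "(real \<Rightarrow> complex) set" where
  "L2 = {f. f \<in> borel_measurable lborel \<and> integrable lborel (\<lambda>x. (norm (f x))\<^sup>2)}"

definition has_weak_derivative ::
    "(real \<Rightarrow> complex) \<Rightarrow> (real \<Rightarrow> complex) \<Rightarrow> bool" where
  "has_weak_derivative f g \<longleftrightarrow>
     (\<forall>\<phi>. test_function \<phi> \<longrightarrow>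
        (LINT x|lborel. deriv \<phi> x *\<^sub>R f x) = - (LINT x|lborel. \<phi> x *\<^sub>R g x))"

definition H1 :: "(real \<Rightarrow> complex) set" where
  "H1 = {f \<in> L2. \<exists>g\<in>L2. has_weak_derivative f g}"

text \<open>
  For \<open>f \<in> H1\<close> the weak derivative in \<open>L2\<close> is unique up to null sets, so the choice below does
  not affect \<open>h1_norm\<close>. Outside \<open>H1\<close> the value of \<open>h1_norm\<close> is meaningless.
\<close>

definition weak_derivative :: "(real \<Rightarrow> complex) \<Rightarrow> real \<Rightarrow> complex" where
  "weak_derivative f = (SOME g. g \<in> L2 \<and> has_weak_derivative f g)"

definition h1_norm :: "(real \<Rightarrow> complex) \<Rightarrow> real" where
  "h1_norm f = sqrt (LINT x|lborel. (norm (f x))\<^sup>2 + (norm (weak_derivative f x))\<^sup>2)"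

definition h1_dist :: "(real \<Rightarrow> complex) \<Rightarrow> (real \<Rightarrow> complex) set \<Rightarrow> real" where
  "h1_dist f S = (INF \<nu>\<in>S. h1_norm (\<lambda>x. f x - \<nu> x))"

text \<open>
  The positive even minimizer of \<open>\<integral> |\<psi>\<^sub>x|\<^sup>2 - |\<psi>|\<^sup>4 / 2\<close> under the constraint \<open>\<integral> |\<psi>|\<^sup>2 = 1\<close>, given by its
  explicit formula, and its orbit under the phase rotations.
\<close>

definition ground_state :: "real \<Rightarrow> real" where
  "ground_state x = 1 / (2 * sqrt 2) * (1 / cosh (x / 4))"

definition Gamma_orbit :: "(real \<Rightarrow> complex) set" where
  "Gamma_orbit = {(\<lambda>x. exp (\<i> * complex_of_real \<alpha>) * complex_of_real (ground_state x)) | \<alpha>. True}"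

definition V_norm :: "real \<Rightarrow> (int \<Rightarrow> complex) \<Rightarrow> real" where
  "V_norm h \<psi> = sqrt (2 * h * (\<Sum>\<^sub>\<infinity>j\<in>UNIV. (norm (\<psi> (j + 1) - \<psi> j))\<^sup>2 / h\<^sup>2)
                      + h * (\<Sum>\<^sub>\<infinity>j\<in>UNIV. (norm (\<psi> j))\<^sup>2))"

text \<open>Finiteness of the norm is summability of both series, since \<open>infsum\<close> is \<open>0\<close> on a divergent one.\<close>

definition V :: "real \<Rightarrow> (int \<Rightarrow> complex) set" where
  "V h = {\<psi>. (\<forall>j. \<psi> j = \<psi> (- j))
           \<and> (\<lambda>j. (norm (\<psi> (j + 1) - \<psi> j))\<^sup>2 / h\<^sup>2) summable_on UNIV
           \<and> (\<lambda>j. (norm (\<psi> j))\<^sup>2) summable_on UNIV}"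

definition hat :: "real \<Rightarrow> real" where
  "hat x = max 0 (1 - \<bar>x\<bar>)"

definition interp :: "real \<Rightarrow> (int \<Rightarrow> complex) \<Rightarrow> real \<Rightarrow> complex" where
  "interp h \<psi> x = (\<Sum>\<^sub>\<infinity>j\<in>UNIV. \<psi> j * complex_of_real (hat (x / h - real_of_int j)))"

text \<open>
  Solutions on \<open>[0, \<infinity>)\<close> in the phase space \<open>V h\<close>: continuous in time for the norm of \<open>V h\<close>, and
  satisfying the equation at every lattice site (with a one-sided derivative at \<open>t = 0\<close>). Since the
  right-hand side is locally Lipschitz on \<open>V h\<close>, these are the \<open>C\<^sup>1\<close> solutions of the
  differential equation in \<open>V h\<close>. Values at negative times are irrelevant.
\<close>

definition dnls_solution ::
    "real \<Rightarrow> (int \<Rightarrow> complex) \<Rightarrow> (real \<Rightarrow> int \<Rightarrow> complex) \<Rightarrow> bool" where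
  "dnls_solution h \<psi>0 \<psi> \<longleftrightarrow>
     \<psi> 0 = \<psi>0
     \<and> (\<forall>t\<ge>0. \<psi> t \<in> V h)
     \<and> (\<forall>t\<ge>0. ((\<lambda>\<tau>. V_norm h (\<lambda>j. \<psi> \<tau> j - \<psi> t j)) \<longlongrightarrow> 0) (at t within {0..}))
     \<and> (\<forall>t\<ge>0. \<forall>l. \<exists>D. ((\<lambda>\<tau>. \<psi> \<tau> l) has_vector_derivative D) (at t within {0..})
          \<and> \<i> * D = - (1 / complex_of_real h ^ 2) * (\<psi> t (l + 1) + \<psi> t (l - 1) - 2 * \<psi> t l)
                    - complex_of_real ((norm (\<psi> t l))\<^sup>2) * \<psi> t l)"

end

(* For u in H^1(R) with mass m put M(x) = (integral of |u|^2 over (-oo, x]) - m / 2. Then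
     integral |u'|^2 - (1/2) integral |u|^4 + m^3 / 48 = integral |f|^2   with   f = u' + M u / 2,
   because the cross term M (|u|^2)' integrates to - |u|^4 and M^2 |u|^2 = (M^3 / 3)'. So the energy
   excess is the square of e = ||f||, without any spectral analysis. From (|u|^2 + M^2 / 2)' = 2 Re (conj u f)
   and M' = |u|^2 it follows that M solves the Riccati equation M' = 1 / 8 - M^2 / 2 of the soliton up to an
   error O(e + |m - 1|). If u is even then M(0) = 0, so M is uniformly close to tanh (x / 4) / 2, and then
   u' = - M u / 2 + f determines u up to a phase: dist (u, Gamma) <= C (e + |m - 1|), with no smallness
   assumption and hence no continuity argument in time.
   The lattice flow conserves its mass and energy, which differ from those of the interpolant by O(h^2).
   Hence e^2 stays below its initial value, which is O(delta^2), plus O(h^2). *)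

theory Submission
  imports Defs
begin

section \<open>Even square-summable sequences\<close>

text \<open>Evenness removes the translation mode: the mass function of an even \<open>u\<close> is
  odd, so only the phase is free, and it is chosen to match \<open>u\<close> at the origin. Two
  mismatches shape the rest. The flow conserves lattice quantities, whereas the factorisation
  concerns the interpolant: linear interpolation keeps the kinetic energy exactly, lowers the mass
  by h^2/6 times that energy and changes the quartic term by O(h^2) only as long as that energy
  stays bounded. The bound comes from the conserved energy, because at fixed mass the quartic term
  grows at most like the square root of the kinetic energy. Moreover interpolants have kinks and
  \<open>h1_norm\<close> uses a chosen weak derivative: the calculus is carried out for continuous
  functions differentiable off a locally finite set, and uniqueness of weak derivatives carries the
  result over. The claim also includes existence and uniqueness of the flow. At fixed h the field is
  locally Lipschitz on square-summable sequences, and conservation of the norm makes solutions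
  global. Time enters through the two conservation laws alone: the final estimate compares two
  states of equal lattice mass and energy.\<close>

lemma square_summable_lin:
  fixes f g :: "'i \<Rightarrow> complex"
  assumes f: "(\<lambda>j. (norm (f j))\<^sup>2) summable_on A" and g: "(\<lambda>j. (norm (g j))\<^sup>2) summable_on A"
    and h: "\<And>j. j \<in> A \<Longrightarrow> norm (h j) \<le> c * norm (f j) + d * norm (g j)"
  shows "(\<lambda>j. (norm (h j :: complex))\<^sup>2) summable_on A"
proof (rule summable_on_comparison_test)
  show "(\<lambda>j. (2 * c\<^sup>2) * (norm (f j))\<^sup>2 + (2 * d\<^sup>2) * (norm (g j))\<^sup>2) summable_on A"
    by (intro summable_on_add summable_on_cmult_right f g)
  fix j assume "j \<in> A"
  have "(norm (h j))\<^sup>2 \<le> (c * norm (f j) + d * norm (g j))\<^sup>2"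
    using h[OF \<open>j \<in> A\<close>] by (intro power_mono) auto
  also have "\<dots> \<le> (2 * c\<^sup>2) * (norm (f j))\<^sup>2 + (2 * d\<^sup>2) * (norm (g j))\<^sup>2"
    using sum_squares_bound[of "c * norm (f j)" "d * norm (g j)"]
    by (simp add: power2_sum power_mult_distrib)
  finally show "(norm (h j))\<^sup>2 \<le> (2 * c\<^sup>2) * (norm (f j))\<^sup>2 + (2 * d\<^sup>2) * (norm (g j))\<^sup>2" .
qed auto

lemma square_summable_add:
  assumes "(\<lambda>j. (norm (f j))\<^sup>2) summable_on A" "(\<lambda>j. (norm (g j :: complex))\<^sup>2) summable_on A"
  shows "(\<lambda>j. (norm (f j + g j))\<^sup>2) summable_on A"
  by (rule square_summable_lin[OF assms, of _ 1 1]) (simp add: norm_triangle_ineq)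

lemma square_summable_diff:
  assumes "(\<lambda>j. (norm (f j))\<^sup>2) summable_on A" "(\<lambda>j. (norm (g j :: complex))\<^sup>2) summable_on A"
  shows "(\<lambda>j. (norm (f j - g j))\<^sup>2) summable_on A"
  by (rule square_summable_lin[OF assms, of _ 1 1]) (simp add: norm_triangle_ineq4)

lemma summable_inner:
  assumes "(\<lambda>j. (norm (f j))\<^sup>2) summable_on A" "(\<lambda>j. (norm (g j :: complex))\<^sup>2) summable_on A"
  shows "(\<lambda>j. inner (f j) (g j)) summable_on A"
proof (rule abs_summable_summable, rule summable_on_comparison_test)
  show "(\<lambda>j. (norm (f j))\<^sup>2 + (norm (g j))\<^sup>2) summable_on A"
    by (intro summable_on_add assms)
  fix j
  have "norm (inner (f j) (g j)) \<le> norm (f j) * norm (g j)"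
    by (simp add: Cauchy_Schwarz_ineq2)
  also have "\<dots> \<le> (norm (f j))\<^sup>2 + (norm (g j))\<^sup>2"
    using sum_squares_bound[of "norm (f j)" "norm (g j)"]
      mult_nonneg_nonneg[OF norm_ge_zero norm_ge_zero, of "f j" "g j"] by linarith
  finally show "norm (inner (f j) (g j)) \<le> (norm (f j))\<^sup>2 + (norm (g j))\<^sup>2" .
qed auto

text \<open>Evenness is part of the type, so that the symmetry of the solutions needs no separate argument.\<close>

typedef even_l2 = "{f :: int \<Rightarrow> complex. (\<forall>j. f (- j) = f j) \<and> (\<lambda>j. (norm (f j))\<^sup>2) summable_on UNIV}"
  morphisms site mk_even_l2
  by (rule exI[of _ "\<lambda>_. 0"]) simp

setup_lifting type_definition_even_l2

lemma site_even [simp]: "site x (- j) = site x j"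
  and summable_site: "(\<lambda>j. (norm (site x j))\<^sup>2) summable_on UNIV"
  using site[of x] by auto

lemma even_l2_eqI: "(\<And>j. site x j = site y j) \<Longrightarrow> x = y"
  by (metis ext site_inject)

lemma summable_inner_site: "(\<lambda>j. inner (site x j) (site y j)) summable_on UNIV"
  by (intro summable_inner summable_site)

instantiation even_l2 :: real_inner
begin

lift_definition zero_even_l2 :: even_l2 is "\<lambda>_. 0" by simp
lift_definition plus_even_l2 :: "even_l2 \<Rightarrow> even_l2 \<Rightarrow> even_l2" is "\<lambda>f g j. f j + g j"
  by (simp add: square_summable_add)
lift_definition minus_even_l2 :: "even_l2 \<Rightarrow> even_l2 \<Rightarrow> even_l2" is "\<lambda>f g j. f j - g j"
  by (simp add: square_summable_diff)
lift_definition uminus_even_l2 :: "even_l2 \<Rightarrow> even_l2" is "\<lambda>f j. - f j" by simp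
lift_definition scaleR_even_l2 :: "real \<Rightarrow> even_l2 \<Rightarrow> even_l2" is "\<lambda>r f j. r *\<^sub>R f j"
  by (simp add: power_mult_distrib summable_on_cmult_right)

text \<open>On complex numbers \<open>inner\<close> is the real part of the Hermitian product;
  multiplication by the imaginary unit enters separately as \<open>rot\<close>. This real structure
  is the one in which the equation is Hamiltonian.\<close>

definition inner_even_l2 :: "even_l2 \<Rightarrow> even_l2 \<Rightarrow> real" where
  "inner_even_l2 x y = (\<Sum>\<^sub>\<infinity>j. inner (site x j) (site y j))"
definition norm_even_l2 :: "even_l2 \<Rightarrow> real" where
  "norm_even_l2 x = sqrt (inner x x)"
definition sgn_even_l2 :: "even_l2 \<Rightarrow> even_l2" where
  "sgn_even_l2 x = inverse (norm x) *\<^sub>R x"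
definition dist_even_l2 :: "even_l2 \<Rightarrow> even_l2 \<Rightarrow> real" where
  "dist_even_l2 x y = norm (x - y)"
definition uniformity_even_l2 :: "(even_l2 \<times> even_l2) filter" where
  "uniformity_even_l2 = (INF e\<in>{0 <..}. principal {(x, y). dist x y < e})"
definition open_even_l2 :: "even_l2 set \<Rightarrow> bool" where
  "open_even_l2 U = (\<forall>x\<in>U. eventually (\<lambda>(x', y). x' = x \<longrightarrow> y \<in> U) uniformity)"

lemmas site_simps [simp] = zero_even_l2.rep_eq plus_even_l2.rep_eq minus_even_l2.rep_eq
  uminus_even_l2.rep_eq scaleR_even_l2.rep_eq

instance
proof
  fix x y z :: even_l2 and r s :: real
  show "x + y + z = x + (y + z)" "x + y = y + x" "0 + x = x" "- x + x = 0" "x - y = x + - y"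
    "r *\<^sub>R (x + y) = r *\<^sub>R x + r *\<^sub>R y" "(r + s) *\<^sub>R x = r *\<^sub>R x + s *\<^sub>R x"
    "r *\<^sub>R s *\<^sub>R x = (r * s) *\<^sub>R x" "1 *\<^sub>R x = x"
    by (auto intro!: even_l2_eqI simp: algebra_simps)
  show "inner x y = inner y x"
    by (simp add: inner_even_l2_def inner_commute)
  show "inner (x + y) z = inner x z + inner y z"
    unfolding inner_even_l2_def
    by (subst infsum_add[symmetric]) (auto intro: summable_inner_site simp: inner_add_left)
  show "inner (r *\<^sub>R x) y = r * inner x y"
    unfolding inner_even_l2_def by (simp add: infsum_cmult_right')
  show "0 \<le> inner x x"
    unfolding inner_even_l2_def by (intro infsum_nonneg) simp
  show "inner x x = 0 \<longleftrightarrow> x = 0"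
  proof
    assume *: "inner x x = 0"
    show "x = 0"
    proof (rule even_l2_eqI)
      fix j
      have "inner (site x j) (site x j) = 0"
        by (rule nonneg_infsum_le_0D[of "\<lambda>j. inner (site x j) (site x j)" UNIV])
           (use * in \<open>auto simp: inner_even_l2_def intro: summable_inner_site\<close>)
      then show "site x j = site 0 j" by simp
    qed
  qed (simp add: inner_even_l2_def)
qed (rule norm_even_l2_def sgn_even_l2_def dist_even_l2_def uniformity_even_l2_def open_even_l2_def)+

end

lemma norm_even_l2_power2: "(norm (x :: even_l2))\<^sup>2 = (\<Sum>\<^sub>\<infinity>j. (norm (site x j))\<^sup>2)"
  by (simp add: power2_norm_eq_inner inner_even_l2_def)

lemma sum_site_le: "finite A \<Longrightarrow> (\<Sum>j\<in>A. (norm (site x j))\<^sup>2) \<le> (norm x)\<^sup>2"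
  unfolding norm_even_l2_power2 by (rule finite_sum_le_infsum) (auto intro: summable_site)

lemma norm_site_le: "norm (site x j) \<le> norm x"
  using sum_site_le[of "{j}" x] by (simp add: abs_le_square_iff[symmetric])

lemma bounded_linear_site: "bounded_linear (\<lambda>x. site x j)"
  by (rule bounded_linear_intro[of _ 1]) (auto simp: norm_site_le)

lemma summable_sitesI:
  assumes "\<And>A. finite A \<Longrightarrow> (\<Sum>j\<in>A. (norm (f j))\<^sup>2) \<le> b"
  shows "(\<lambda>j. (norm (f j :: complex))\<^sup>2) summable_on UNIV"
  by (rule nonneg_bdd_above_summable_on) (auto simp: bdd_above_def intro!: exI[of _ b] assms)

lemma norm_even_l2_leI:
  assumes "\<And>A. finite A \<Longrightarrow> (\<Sum>j\<in>A. (norm (site x j))\<^sup>2) \<le> b\<^sup>2" "0 \<le> b"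
  shows "norm x \<le> b"
proof -
  have "(norm x)\<^sup>2 \<le> b\<^sup>2"
    unfolding norm_even_l2_power2 using assms(1)
    by (intro infsum_le_finite_sums summable_site) auto
  then show ?thesis using assms(2) by (rule power2_le_imp_le)
qed

instance even_l2 :: banach
proof
  fix X :: "nat \<Rightarrow> even_l2" assume X: "Cauchy X"
  have "\<exists>l. (\<lambda>n. site (X n) j) \<longlonglongrightarrow> l" for j
    using bounded_linear.Cauchy[OF bounded_linear_site X] by (simp add: convergent_eq_Cauchy)
  then obtain f where f: "\<And>j. (\<lambda>n. site (X n) j) \<longlonglongrightarrow> f j" by metis
  have even: "f (- j) = f j" for j
    using f[of "- j"] f[of j] by (simp add: LIMSEQ_unique)
  \<comment> \<open>Bounds on finite partial sums survive the pointwise limit. This replaces an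
    exchange of limit and infinite sum, and it yields both square-summability of the limit and
    convergence in norm.\<close>
  have close: "(\<Sum>j\<in>A. (norm (f j - site (X n) j))\<^sup>2) \<le> e\<^sup>2"
    if "finite A" and e: "\<And>m. m \<ge> n \<Longrightarrow> norm (X m - X n) \<le> e" for A n e
  proof (rule tendsto_upperbound)
    show "(\<lambda>m. \<Sum>j\<in>A. (norm (site (X m) j - site (X n) j))\<^sup>2) \<longlonglongrightarrow> (\<Sum>j\<in>A. (norm (f j - site (X n) j))\<^sup>2)"
      by (intro tendsto_intros f)
    show "\<forall>\<^sub>F m in sequentially. (\<Sum>j\<in>A. (norm (site (X m) j - site (X n) j))\<^sup>2) \<le> e\<^sup>2"
      using eventually_ge_at_top[of n]
    proof eventually_elim
      case (elim m)
      have "(\<Sum>j\<in>A. (norm (site (X m - X n) j))\<^sup>2) \<le> (norm (X m - X n))\<^sup>2"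
        using that(1) by (rule sum_site_le)
      also have "\<dots> \<le> e\<^sup>2" using e[OF elim] by (intro power_mono) auto
      finally show ?case by simp
    qed
  qed simp
  have cau: "\<exists>N. \<forall>n\<ge>N. \<forall>m\<ge>n. norm (X m - X n) \<le> e" if "e > 0" for e
    using X[unfolded Cauchy_def, rule_format, OF that] 
    by (metis dist_norm less_imp_le order_trans)
  obtain N where N: "\<And>m. m \<ge> N \<Longrightarrow> norm (X m - X N) \<le> 1" using cau[of 1] by auto
  have "(\<lambda>j. (norm (f j - site (X N) j))\<^sup>2) summable_on UNIV"
    by (rule summable_sitesI[of _ "1\<^sup>2"]) (rule close, use N in auto)
  from square_summable_add[OF this summable_site[of "X N"]]
  have "(\<lambda>j. (norm (f j))\<^sup>2) summable_on UNIV" by simp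
  then obtain l where l: "site l = f"
    using even mk_even_l2_inverse[of f] by auto
  have "X \<longlonglongrightarrow> l"
  proof (rule metric_LIMSEQ_I)
    fix r :: real assume "r > 0"
    with cau[of "r/2"] obtain N where N: "\<And>n m. n \<ge> N \<Longrightarrow> m \<ge> n \<Longrightarrow> norm (X m - X n) \<le> r / 2" by auto
    have "dist (X n) l < r" if "n \<ge> N" for n
    proof -
      have "norm (l - X n) \<le> r / 2"
        by (rule norm_even_l2_leI) (use close[of _ n "r/2"] N[OF that] l \<open>r > 0\<close> in auto)
      then show ?thesis using \<open>r > 0\<close> by (simp add: dist_norm norm_minus_commute)
    qed
    then show "\<exists>N. \<forall>n\<ge>N. dist (X n) l < r" by blast
  qed
  then show "convergent X" by (auto simp: convergent_def)
qed

section \<open>Lipschitz vector fields\<close>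

lemma has_vector_derivative_indefinite_integral:
  fixes k :: "real \<Rightarrow> 'a::banach"
  assumes "continuous_on {0..} k" "0 \<le> t"
  shows "((\<lambda>u. integral {0..u} k) has_vector_derivative k t) (at t within {0..})"
proof -
  have "((\<lambda>u. integral {0..u} k) has_vector_derivative k t) (at t within {0..t+1})"
    using assms by (intro integral_has_vector_derivative) (auto elim: continuous_on_subset)
  moreover have "at t within {0..t+1} = at t within {0..}"
    by (rule at_within_nhd[of _ "{..<t+1}"]) auto
  ultimately show ?thesis by simp
qed

text \<open>The weight \<open>exp (- 2 L t)\<close> makes the Picard map a contraction on the whole half line at once.\<close>

lemma global_lipschitz_ode:
  fixes F :: "'a::banach \<Rightarrow> 'a"
  assumes L: "L > 0" and lip: "\<And>x y. norm (F x - F y) \<le> L * norm (x - y)" and F0: "F 0 = 0"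
  shows "\<exists>y. y 0 = x0 \<and> (\<forall>t\<ge>0. (y has_vector_derivative F (y t)) (at t within {0..}))"
proof -
  have contF: "continuous_on UNIV F"
    by (rule lipschitz_on_continuous_on[of L])
       (use lip L in \<open>auto simp: lipschitz_on_def dist_norm\<close>)
  \<comment> \<open>The unknown \<open>z\<close> is the solution times
    \<open>exp (- 2 * L * s)\<close>, so \<open>k z\<close> is the field along the unweighted
    curve.\<close>
  define k where "k z s = F (exp (2 * L * s) *\<^sub>R (apply_bcontfun z s))" for z s
  have contk: "continuous_on A (k z)" for A z
    unfolding k_def by (intro continuous_on_compose2[OF contF] continuous_intros) auto
  have int_k: "k z integrable_on {0..t}" for z t
    by (intro integrable_continuous_interval contk)
  have exp_int: "((\<lambda>s. L * exp (2 * L * s) * B) has_integral (exp (2 * L * t) - 1) / 2 * B) {0..t}"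
    if "0 \<le> t" for B t
  proof -
    have "((\<lambda>s. L * exp (2 * L * s) * B) has_integral exp (2 * L * t) / 2 * B - exp (2 * L * 0) / 2 * B) {0..t}"
      by (rule fundamental_theorem_of_calculus[OF that])
         (auto intro!: derivative_eq_intros simp: has_real_derivative_iff_has_vector_derivative[symmetric])
    then show ?thesis by (simp add: diff_divide_distrib left_diff_distrib)
  qed
  \<comment> \<open>\<open>max 0 t\<close> extends the Picard map by a constant to negative times,
    since the bounded continuous functions used here live on the whole line.\<close>
  define G where "G z t = exp (- 2 * L * max 0 t) *\<^sub>R (x0 + integral {0..max 0 t} (k z))" for z t
  \<comment> \<open>Source of the contraction factor 1/2: an integrand of size
    \<open>L * exp (2 * L * s) * B\<close> integrates to at most
    \<open>exp (2 * L * t) * B / 2\<close>.\<close>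
  have est: "norm (exp (- 2 * L * t) *\<^sub>R integral {0..t} f) \<le> B / 2"
    if t: "0 \<le> t" and f: "f integrable_on {0..t}" and B: "0 \<le> B" "\<And>s. norm (f s) \<le> L * exp (2 * L * s) * B" for f :: "real \<Rightarrow> 'a" and t B
  proof -
    have "norm (integral {0..t} f) \<le> integral {0..t} (\<lambda>s. L * exp (2 * L * s) * B)"
      using exp_int[OF t] B f by (intro integral_norm_bound_integral) auto
    also have "\<dots> = (exp (2 * L * t) - 1) / 2 * B"
      using exp_int[OF t] by (rule integral_unique)
    also have "\<dots> \<le> exp (2 * L * t) * (B / 2)"
      using B by (simp add: field_simps)
    finally have "exp (- 2 * L * t) * norm (integral {0..t} f) \<le> exp (- 2 * L * t) * (exp (2 * L * t) * (B / 2))"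
      by (intro mult_left_mono) auto
    then show ?thesis by (simp add: exp_minus field_simps)
  qed
  have F_le: "norm (F x) \<le> L * norm x" for x
    using lip[of x 0] F0 by simp
  have contI: "continuous_on {0..} (\<lambda>t. integral {0..t} (k z))" for z
    unfolding continuous_on_eq_continuous_within
    using has_vector_derivative_continuous[OF has_vector_derivative_indefinite_integral[OF contk]] by simp
  have G_bcont: "G z \<in> bcontfun" for z
  proof (rule bcontfun_normI)
    show "continuous_on UNIV (G z)"
      unfolding G_def
      by (intro continuous_intros continuous_on_compose2[OF contI]) auto
    fix t
    have "norm (G z t) \<le> norm (exp (- 2 * L * max 0 t) *\<^sub>R x0) + norm (exp (- 2 * L * max 0 t) *\<^sub>R integral {0..max 0 t} (k z))"
      unfolding G_def scaleR_add_right by (rule norm_triangle_ineq)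
    also have "\<dots> \<le> norm x0 + norm z / 2"
    proof (rule add_mono)
      show "norm (exp (- 2 * L * max 0 t) *\<^sub>R x0) \<le> norm x0"
        using L by (auto intro!: mult_left_le_one_le)
      show "norm (exp (- 2 * L * max 0 t) *\<^sub>R integral {0..max 0 t} (k z)) \<le> norm z / 2"
      proof (rule est)
        fix s
        have "norm (k z s) \<le> L * (exp (2 * L * s) * norm (apply_bcontfun z s))"
          unfolding k_def using F_le[of "exp (2 * L * s) *\<^sub>R apply_bcontfun z s"] by simp
        also have "\<dots> \<le> L * (exp (2 * L * s) * norm z)"
          using L by (intro mult_left_mono norm_bounded) auto
        finally show "norm (k z s) \<le> L * exp (2 * L * s) * norm z" by simp
      qed (auto intro: int_k)
    qed
    finally show "norm (G z t) \<le> norm x0 + norm z / 2" .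
  qed
  have "\<exists>!z. Bcontfun (G z) = z"
  proof (rule banach_fix_type[of "1/2"], safe)
    fix z w :: "real \<Rightarrow>\<^sub>C 'a"
    show "dist (Bcontfun (G z)) (Bcontfun (G w)) \<le> 1 / 2 * dist z w"
    proof (rule dist_bound)
      fix t
      have "G z t - G w t = exp (- 2 * L * max 0 t) *\<^sub>R integral {0..max 0 t} (\<lambda>s. k z s - k w s)"
        unfolding G_def by (subst integral_diff) (auto intro: int_k simp: algebra_simps)
      also have "norm \<dots> \<le> dist z w / 2"
      proof (rule est)
        fix s
        have "norm (k z s - k w s) \<le> L * (exp (2 * L * s) * dist (apply_bcontfun z s) (apply_bcontfun w s))"
          unfolding k_def using lip[of "exp (2 * L * s) *\<^sub>R apply_bcontfun z s" "exp (2 * L * s) *\<^sub>R apply_bcontfun w s"]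
          by (simp add: scaleR_diff_right[symmetric] dist_norm)
        also have "\<dots> \<le> L * (exp (2 * L * s) * dist z w)"
          using L by (intro mult_left_mono dist_bounded) auto
        finally show "norm (k z s - k w s) \<le> L * exp (2 * L * s) * dist z w" by simp
      qed (auto intro: int_k integrable_diff)
      finally show "dist (apply_bcontfun (Bcontfun (G z)) t) (apply_bcontfun (Bcontfun (G w)) t) \<le> 1 / 2 * dist z w"
        by (simp add: Bcontfun_inverse G_bcont dist_norm)
    qed
  qed auto
  then obtain z where "Bcontfun (G z) = z" by blast
  then have z: "apply_bcontfun z t = G z t" for t
    using Bcontfun_inverse[OF G_bcont[of z]] by simp
  define y where "y t = x0 + integral {0..t} (k z)" for t
  have kz: "k z t = F (y t)" if "t \<ge> 0" for t
    using that by (simp add: k_def z G_def y_def exp_minus)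
  show ?thesis
  proof (intro exI[of _ y] conjI allI impI)
    fix t :: real assume t: "0 \<le> t"
    show "(y has_vector_derivative F (y t)) (at t within {0..})"
      unfolding y_def[abs_def] kz[OF t, symmetric, unfolded y_def]
      using has_vector_derivative_add[OF has_vector_derivative_const has_vector_derivative_indefinite_integral[OF contk t]]
      by simp
  qed (simp add: y_def)
qed

text \<open>Gronwall in differential form: the squared distance of two solutions grows at relative
  rate at most 2 L, so its product with exp (- 2 L s) is nonincreasing and starts at 0. The inner
  product makes the squared norm differentiable.\<close>

lemma global_lipschitz_ode_unique:
  fixes F :: "'a::real_inner \<Rightarrow> 'a"
  assumes lip: "\<And>x y. norm (F x - F y) \<le> L * norm (x - y)"
    and y: "\<And>t. t \<ge> 0 \<Longrightarrow> (y has_vector_derivative F (y t)) (at t within {0..})"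
    and w: "\<And>t. t \<ge> 0 \<Longrightarrow> (w has_vector_derivative F (w t)) (at t within {0..})"
    and init: "y 0 = w 0" and t: "t \<ge> 0"
  shows "y t = w t"
proof -
  define d where "d s = y s - w s" for s
  define r where "r s = exp (- 2 * L * s) * inner (d s) (d s)" for s
  have d: "(d has_vector_derivative (F (y s) - F (w s))) (at s within {0..})" if "s \<ge> 0" for s
    unfolding d_def by (intro has_vector_derivative_diff y w that)
  have r: "(r has_vector_derivative (exp (- 2 * L * s) * (2 * inner (d s) (F (y s) - F (w s))) 
      + (- 2 * L * exp (- 2 * L * s)) * inner (d s) (d s))) (at s within {0..})" if "s \<ge> 0" for s
  proof -
    have "((\<lambda>s. inner (d s) (d s)) has_vector_derivative (2 * inner (d s) (F (y s) - F (w s)))) (at s within {0..})"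
      using bounded_bilinear.has_vector_derivative[OF bounded_bilinear_inner d[OF that] d[OF that]]
      by (simp add: inner_commute)
    note dd = this
    have "((\<lambda>s. exp (- 2 * L * s)) has_vector_derivative (- 2 * L * exp (- 2 * L * s))) (at s within {0..})"
      by (auto intro!: derivative_eq_intros simp: has_real_derivative_iff_has_vector_derivative[symmetric])
    from bounded_bilinear.has_vector_derivative[OF bounded_bilinear_mult this dd]
    show ?thesis unfolding r_def .
  qed
  have "r t \<le> r 0"
  proof (rule DERIV_nonpos_imp_decreasing_open[OF t])
    have "continuous_on {0..} r"
      unfolding continuous_on_eq_continuous_within using has_vector_derivative_continuous[OF r] by simp
    then show "continuous_on {0..t} r" by (rule continuous_on_subset) auto
    fix s assume s: "0 < s" "s < t"
    let ?D = "exp (- 2 * L * s) * (2 * inner (d s) (F (y s) - F (w s))) + (- 2 * L * exp (- 2 * L * s)) * inner (d s) (d s)"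
    have "at s within {0..} = at s" using s by (intro at_within_interior) auto
    then have "DERIV r s :> ?D"
      using r[OF less_imp_le[OF s(1)]] by (simp only: has_real_derivative_iff_has_vector_derivative)
    moreover have "?D \<le> 0"
    proof -
      have "inner (d s) (F (y s) - F (w s)) \<le> norm (d s) * norm (F (y s) - F (w s))"
        by (rule norm_cauchy_schwarz)
      also have "\<dots> \<le> norm (d s) * (L * norm (d s))"
        unfolding d_def by (intro mult_left_mono lip) auto
      finally have "inner (d s) (F (y s) - F (w s)) \<le> L * inner (d s) (d s)"
        by (simp add: power2_norm_eq_inner[symmetric] power2_eq_square mult.left_commute)
      then have "exp (- 2 * L * s) * (2 * (inner (d s) (F (y s) - F (w s)) - L * inner (d s) (d s))) \<le> 0"
        by (intro mult_nonneg_nonpos) auto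
      then show ?thesis by (simp add: algebra_simps)
    qed
    ultimately show "\<exists>D. DERIV r s :> D \<and> D \<le> 0" by blast
  qed
  moreover have "r 0 = 0" by (simp add: r_def d_def init)
  ultimately have "inner (d t) (d t) \<le> 0" by (simp add: r_def mult_le_0_iff)
  then have "d t = 0" using inner_ge_zero[of "d t"] inner_eq_zero_iff[of "d t"] by linarith
  then show ?thesis by (simp add: d_def)
qed

text \<open>The constant 2 holds in every normed space: scaling both points by the same factor costs
  one distance, and correcting the factor of the larger point costs at most another.\<close>

lemma lipschitz_radial_truncation:
  fixes x y :: "'a::real_normed_vector"
  assumes R: "R > 0"
  defines "P \<equiv> \<lambda>x :: 'a. if norm x \<le> R then x else (R / norm x) *\<^sub>R x"
  shows "norm (P x) \<le> R" and "norm (P x - P y) \<le> 2 * norm (x - y)"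
proof -
  show "norm (P x) \<le> R" using R by (auto simp: P_def)
  have one: "norm (P x - P y) \<le> 2 * norm (x - y)" if "norm x \<le> norm y" for x y
  proof (cases "norm y \<le> R")
    case True
    then show ?thesis using that by (simp add: P_def)
  next
    case False
    \<comment> \<open>\<open>c\<close> merges two cases: \<open>P x\<close> is \<open>x\<close>
      scaled by \<open>R / c\<close>, whether \<open>x\<close> lies inside or outside the
      ball.\<close>
    define c where "c = max R (norm x)"
    have c: "0 < c" "R \<le> c" "c \<le> norm y" using False that R by (auto simp: c_def)
    have "P x = (R / c) *\<^sub>R x" using R by (auto simp: P_def c_def max_def)
    moreover have "P y = (R / norm y) *\<^sub>R y" using False by (simp add: P_def)
    ultimately have "P x - P y = (R / c) *\<^sub>R (x - y) + (R / c - R / norm y) *\<^sub>R y"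
      by (simp add: algebra_simps)
    then have "norm (P x - P y) \<le> norm ((R / c) *\<^sub>R (x - y)) + norm ((R / c - R / norm y) *\<^sub>R y)"
      by (metis norm_triangle_ineq)
    also have "\<dots> = R / c * norm (x - y) + \<bar>R / c - R / norm y\<bar> * norm y"
      using R c by simp
    also have "\<bar>R / c - R / norm y\<bar> * norm y = R / c * (norm y - c)"
    proof -
      have "R / norm y \<le> R / c" using c R by (intro frac_le) auto
      moreover have "norm y > 0" "c > 0" using c by linarith+
      ultimately show ?thesis by (simp add: left_diff_distrib right_diff_distrib)
    qed
    also have "R / c * norm (x - y) + R / c * (norm y - c) \<le> 1 * norm (x - y) + 1 * norm (x - y)"
    proof (intro add_mono mult_mono)
      show "norm y - c \<le> norm (x - y)"
        using norm_triangle_ineq3[of y x] by (auto simp: c_def norm_minus_commute)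
    qed (use c R in auto)
    finally show ?thesis by simp
  qed
  show "norm (P x - P y) \<le> 2 * norm (x - y)"
    using one[of x y] one[of y x] by (cases "norm x \<le> norm y") (auto simp: norm_minus_commute)
qed

section \<open>The lattice flow\<close>

lift_definition rot :: "even_l2 \<Rightarrow> even_l2" is "\<lambda>f j. \<i> * f j"
  by (simp add: norm_mult)

lift_definition conjugate :: "even_l2 \<Rightarrow> even_l2" is "\<lambda>f j. cnj (f j)"
  by simp

lemma summable_shift:
  assumes "(\<lambda>j. (norm (f j))\<^sup>2) summable_on (UNIV :: int set)"
  shows "(\<lambda>j. (norm (f (j + a) :: complex))\<^sup>2) summable_on UNIV"
proof -
  have "bij_betw (\<lambda>j. j + a) UNIV UNIV"
    by (rule bij_betw_byWitness[where f' = "\<lambda>j. j - a"]) auto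
  from summable_on_reindex_bij_betw[OF this, of "\<lambda>j. (norm (f j))\<^sup>2"] assms show ?thesis by simp
qed

lemma infsum_shift: "(\<Sum>\<^sub>\<infinity>j\<in>UNIV. f (j + a)) = (\<Sum>\<^sub>\<infinity>j\<in>UNIV. f (j :: int))"
proof -
  have "bij_betw (\<lambda>j. j + a) UNIV UNIV"
    by (rule bij_betw_byWitness[where f' = "\<lambda>j. j - a"]) auto
  from infsum_reindex_bij_betw[OF this, of f] show ?thesis by simp
qed

lift_definition lap :: "even_l2 \<Rightarrow> even_l2" is "\<lambda>f j. f (j + 1) + f (j - 1) - 2 * f j"
proof -
  fix f :: "int \<Rightarrow> complex"
  assume f: "(\<forall>j. f (- j) = f j) \<and> (\<lambda>j. (norm (f j))\<^sup>2) summable_on UNIV"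
  \<comment> \<open>Reflection swaps the two neighbours of a site, so the Laplacian preserves
    evenness.\<close>
  have "f (- j + 1) = f (j - 1)" "f (- j - 1) = f (j + 1)" for j
    using f[THEN conjunct1, rule_format, of "j - 1"] f[THEN conjunct1, rule_format, of "j + 1"] by simp_all
  moreover have "(\<lambda>j. (norm (f (j + 1) + f (j + - 1) - (f j + f j)))\<^sup>2) summable_on UNIV"
    using f by (intro square_summable_diff square_summable_add summable_shift) auto
  then have "(\<lambda>j. (norm (f (j + 1) + f (j - 1) - 2 * f j))\<^sup>2) summable_on UNIV" by simp
  ultimately show "(\<forall>j. f (- j + 1) + f (- j - 1) - 2 * f (- j) = f (j + 1) + f (j - 1) - 2 * f j) \<and>
    (\<lambda>j. (norm (f (j + 1) + f (j - 1) - 2 * f j))\<^sup>2) summable_on UNIV"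
    using f by (simp add: add.commute)
qed

lift_definition pmul :: "even_l2 \<Rightarrow> even_l2 \<Rightarrow> even_l2" is "\<lambda>f g j. f j * g j"
proof -
  fix f g :: "int \<Rightarrow> complex"
  assume f: "(\<forall>j. f (- j) = f j) \<and> (\<lambda>j. (norm (f j))\<^sup>2) summable_on UNIV"
    and g: "(\<forall>j. g (- j) = g j) \<and> (\<lambda>j. (norm (g j))\<^sup>2) summable_on UNIV"
  define c where "c = sqrt (\<Sum>\<^sub>\<infinity>j. (norm (g j))\<^sup>2)"
  have "norm (g j) \<le> c" for j
    unfolding c_def using g finite_sum_le_infsum[of "\<lambda>j. (norm (g j))\<^sup>2" UNIV "{j}"]
    by (auto intro: real_le_rsqrt)
  then have "norm (f j * g j) \<le> c * norm (f j) + 0 * norm (f j)" for j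
    by (simp add: norm_mult mult.commute[of c] mult_left_mono)
  then show "(\<forall>j. f (- j) * g (- j) = f j * g j) \<and> (\<lambda>j. (norm (f j * g j))\<^sup>2) summable_on UNIV"
    using f g square_summable_lin[of f UNIV f "\<lambda>j. f j * g j" c 0] by auto
qed

lemmas site_op_simps [simp] = rot.rep_eq conjugate.rep_eq lap.rep_eq pmul.rep_eq

lemma norm_eqI_site: "(\<And>j. norm (site x j) = norm (site y j)) \<Longrightarrow> norm x = norm y"
  by (rule power2_eq_imp_eq) (auto simp: norm_even_l2_power2)

lemma norm_rot [simp]: "norm (rot x) = norm x"
  by (rule norm_eqI_site) (simp add: norm_mult)

lemma norm_conjugate [simp]: "norm (conjugate x) = norm x"
  by (rule norm_eqI_site) simp

text \<open>The sequences form an algebra: every single site is bounded by the norm, so one factor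
  is taken out in the sup norm. Hence the cubic term is locally Lipschitz without any control of
  differences.\<close>

lemma norm_pmul_le: "norm (pmul x y) \<le> norm x * norm y"
proof (rule norm_even_l2_leI)
  fix A :: "int set" assume A: "finite A"
  have "(\<Sum>j\<in>A. (norm (site (pmul x y) j))\<^sup>2) = (\<Sum>j\<in>A. (norm (site x j))\<^sup>2 * (norm (site y j))\<^sup>2)"
    by (simp add: norm_mult power_mult_distrib)
  also have "\<dots> \<le> (\<Sum>j\<in>A. (norm (site x j))\<^sup>2 * (norm y)\<^sup>2)"
    by (intro sum_mono mult_left_mono power_mono norm_site_le) auto
  also have "\<dots> = (\<Sum>j\<in>A. (norm (site x j))\<^sup>2) * (norm y)\<^sup>2"
    by (simp add: sum_distrib_right)
  also have "\<dots> \<le> (norm x)\<^sup>2 * (norm y)\<^sup>2"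
    by (intro mult_right_mono sum_site_le A) auto
  finally show "(\<Sum>j\<in>A. (norm (site (pmul x y) j))\<^sup>2) \<le> (norm x * norm y)\<^sup>2"
    by (simp add: power_mult_distrib)
qed simp

lemma bounded_bilinear_pmul: "bounded_bilinear pmul"
  by (rule bounded_bilinear.intro)
     (auto intro!: even_l2_eqI exI[of _ 1] norm_pmul_le simp: algebra_simps)

lemma bounded_linear_rot: "bounded_linear rot"
  by (rule bounded_linear_intro[of _ 1]) (auto intro!: even_l2_eqI simp: algebra_simps)

lemma bounded_linear_conjugate: "bounded_linear conjugate"
  by (rule bounded_linear_intro[of _ 1]) (auto intro!: even_l2_eqI)

lemma inner_rot_self: "inner x (rot x) = 0"
  unfolding inner_even_l2_def by (simp add: inner_complex_def)

lemma inner_rot_swap: "inner (rot x) y = - inner x (rot y)"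
  unfolding inner_even_l2_def infsum_uminus[symmetric]
  by (rule infsum_cong) (simp add: inner_complex_def)

definition dirichlet :: "even_l2 \<Rightarrow> real" where
  "dirichlet x = (\<Sum>\<^sub>\<infinity>j. (norm (site x (j + 1) - site x j))\<^sup>2)"

text \<open>Summation by parts on the lattice; it makes \<open>lap\<close> symmetric and
  nonpositive.\<close>

lemma inner_lap: "inner (lap x) y = - (\<Sum>\<^sub>\<infinity>j. inner (site x (j + 1) - site x j) (site y (j + 1) - site y j))"
proof -
  \<comment> \<open>One summability fact serves all shifts; below, \<open>j\<close> is written as
    \<open>j + 0\<close> and \<open>j - 1\<close> as \<open>j + - 1\<close> to match it.\<close>
  have S: "(\<lambda>j. inner (site x (j + a)) (site y (j + b))) summable_on UNIV" for a b
    by (intro summable_inner summable_shift summable_site)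
  have eq: "(\<Sum>\<^sub>\<infinity>j. inner (site x (j - 1)) (site y j)) = (\<Sum>\<^sub>\<infinity>j. inner (site x j) (site y (j + 1)))"
    "(\<Sum>\<^sub>\<infinity>j. inner (site x (j + 1)) (site y (j + 1))) = (\<Sum>\<^sub>\<infinity>j. inner (site x j) (site y j))"
    using infsum_shift[of "\<lambda>j. inner (site x (j - 1)) (site y j)" 1]
      infsum_shift[of "\<lambda>j. inner (site x j) (site y j)" 1] by simp_all
  have hs: "((\<lambda>j. inner (site x (j + a)) (site y (j + b))) has_sum (\<Sum>\<^sub>\<infinity>j. inner (site x (j + a)) (site y (j + b)))) UNIV" for a b
    using S by simp
  have "inner (lap x) y = (\<Sum>\<^sub>\<infinity>j. inner (site x (j + 1)) (site y (j + 0)) + inner (site x (j + - 1)) (site y (j + 0))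
      + (- 2) * inner (site x (j + 0)) (site y (j + 0)))"
    unfolding inner_even_l2_def by (rule infsum_cong) (simp add: inner_complex_def algebra_simps)
  also have "\<dots> = (\<Sum>\<^sub>\<infinity>j. inner (site x (j + 1)) (site y (j + 0))) + (\<Sum>\<^sub>\<infinity>j. inner (site x (j + - 1)) (site y (j + 0)))
      + (- 2) * (\<Sum>\<^sub>\<infinity>j. inner (site x (j + 0)) (site y (j + 0)))"
    by (intro infsumI has_sum_add has_sum_cmult_right hs)
  finally have 1: "inner (lap x) y = (\<Sum>\<^sub>\<infinity>j. inner (site x (j + 1)) (site y j)) + (\<Sum>\<^sub>\<infinity>j. inner (site x j) (site y (j + 1)))
      - 2 * (\<Sum>\<^sub>\<infinity>j. inner (site x j) (site y j))" by (simp add: eq)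
  have "(\<Sum>\<^sub>\<infinity>j. inner (site x (j + 1) - site x j) (site y (j + 1) - site y j))
     = (\<Sum>\<^sub>\<infinity>j. inner (site x (j + 1)) (site y (j + 1)) + inner (site x (j + 0)) (site y (j + 0))
      + (- 1) * inner (site x (j + 1)) (site y (j + 0)) + (- 1) * inner (site x (j + 0)) (site y (j + 1)))"
    by (rule infsum_cong) (simp add: inner_diff_left inner_diff_right)
  also have "\<dots> = (\<Sum>\<^sub>\<infinity>j. inner (site x (j + 1)) (site y (j + 1))) + (\<Sum>\<^sub>\<infinity>j. inner (site x (j + 0)) (site y (j + 0)))
      + (- 1) * (\<Sum>\<^sub>\<infinity>j. inner (site x (j + 1)) (site y (j + 0))) + (- 1) * (\<Sum>\<^sub>\<infinity>j. inner (site x (j + 0)) (site y (j + 1)))"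
    by (intro infsumI has_sum_add has_sum_cmult_right hs)
  finally show ?thesis using 1 eq by simp
qed

lemma inner_lap_self: "inner (lap x) x = - dirichlet x"
  by (simp add: inner_lap dirichlet_def power2_norm_eq_inner)

lemma inner_lap_commute: "inner (lap x) y = inner x (lap y)"
  by (simp add: inner_lap inner_commute[of x "lap y"]) (simp add: inner_commute)

lemma summable_dirichlet: "(\<lambda>j. (norm (site x (j + 1) - site x j))\<^sup>2) summable_on UNIV"
  by (intro square_summable_diff summable_shift summable_site)

lemma dirichlet_nonneg: "0 \<le> dirichlet x"
  unfolding dirichlet_def by (rule infsum_nonneg) simp

lemma dirichlet_le: "dirichlet x \<le> 4 * (norm x)\<^sup>2"
proof -
  have "dirichlet x \<le> (\<Sum>\<^sub>\<infinity>j. 2 * (norm (site x (j + 1)))\<^sup>2 + 2 * (norm (site x j))\<^sup>2)"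
    unfolding dirichlet_def
  proof (intro infsum_mono summable_dirichlet summable_on_add summable_on_cmult_right summable_site)
    show "(\<lambda>j. (norm (site x (j + 1)))\<^sup>2) summable_on UNIV" by (rule summable_shift[OF summable_site])
    fix j
    have "(norm (site x (j + 1) - site x j))\<^sup>2 \<le> (norm (site x (j + 1)) + norm (site x j))\<^sup>2"
      by (intro power_mono norm_triangle_ineq4) auto
    also have "\<dots> \<le> 2 * (norm (site x (j + 1)))\<^sup>2 + 2 * (norm (site x j))\<^sup>2"
      using sum_squares_bound[of "norm (site x (j + 1))" "norm (site x j)"] by (simp add: power2_sum)
    finally show "(norm (site x (j + 1) - site x j))\<^sup>2 \<le> 2 * (norm (site x (j + 1)))\<^sup>2 + 2 * (norm (site x j))\<^sup>2" .
  qed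
  also have "\<dots> = 4 * (norm x)\<^sup>2"
    using infsum_shift[of "\<lambda>j. (norm (site x j))\<^sup>2" 1] 
    by (subst infsum_add) (auto simp: infsum_cmult_right' norm_even_l2_power2 intro!: summable_on_cmult_right summable_site summable_shift)
  finally show ?thesis .
qed

text \<open>The bound on \<^term>\<open>lap\<close> follows from \<open>0 \<le> dirichlet (x + lap x / 4)\<close>.\<close>

lemma bounded_linear_lap: "bounded_linear lap"
proof (rule bounded_linear_intro[of _ 4])
  show add: "lap (x + y) = lap x + lap y" and scale: "lap (r *\<^sub>R x) = r *\<^sub>R lap x" for x y r
    by (auto intro!: even_l2_eqI simp: algebra_simps)
  fix x
  \<comment> \<open>With c in place of 1/4 and \<open>dirichlet_le\<close> applied to both terms,
    the right-hand side is at most 4 |x|^2 + (4 c^2 - 2 c) |lap x|^2. The choice c = 1/4 minimises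
    the bracket, at -1/4, and gives the bound 4.\<close>
  have "dirichlet (x + (1 / 4) *\<^sub>R lap x) = dirichlet x + dirichlet (lap x) / 16 - (norm (lap x))\<^sup>2 / 2"
    using inner_lap_self[of "x + (1 / 4) *\<^sub>R lap x"] inner_lap_self[of x] inner_lap_self[of "lap x"] inner_lap_commute[of "lap x" x]
    by (simp add: add scale inner_add_left inner_add_right power2_norm_eq_inner field_simps)
  then have "(norm (lap x))\<^sup>2 \<le> (norm x * 4)\<^sup>2"
    using dirichlet_nonneg[of "x + (1 / 4) *\<^sub>R lap x"] dirichlet_le[of x] dirichlet_le[of "lap x"]
    by (simp add: power_mult_distrib)
  then show "norm (lap x) \<le> norm x * 4" by (rule power2_le_imp_le) simp
qed

text \<open>Built from \<open>pmul\<close> and \<open>conjugate\<close> rather than sitewise, so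
  that continuity and derivatives in norm follow from the rules for bounded bilinear maps.\<close>

definition sqabs :: "even_l2 \<Rightarrow> even_l2" where "sqabs x = pmul x (conjugate x)"
definition cubic :: "even_l2 \<Rightarrow> even_l2" where "cubic x = pmul (sqabs x) x"

lemma site_sqabs [simp]: "site (sqabs x) j = of_real ((norm (site x j))\<^sup>2)"
  by (simp only: sqabs_def pmul.rep_eq conjugate.rep_eq complex_norm_square)

lemma site_cubic [simp]: "site (cubic x) j = of_real ((norm (site x j))\<^sup>2) * site x j"
  by (simp add: cubic_def)

lemma norm_sqabs_le: "norm (sqabs x) \<le> (norm x)\<^sup>2"
  using norm_pmul_le[of x "conjugate x"] by (simp add: sqabs_def power2_eq_square)

lemma cubic_scaleR: "cubic (c *\<^sub>R x) = c ^ 3 *\<^sub>R cubic x"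
proof (rule even_l2_eqI)
  fix j
  have "site (cubic (c *\<^sub>R x)) j = of_real (c\<^sup>2 * (norm (site x j))\<^sup>2) * (of_real c * site x j)"
    by (simp only: site_cubic scaleR_even_l2.rep_eq norm_mult norm_of_real power_mult_distrib power2_abs scaleR_conv_of_real)
  also have "\<dots> = site (c ^ 3 *\<^sub>R cubic x) j"
    by (simp add: scaleR_conv_of_real power2_eq_square power3_eq_cube)
  finally show "site (cubic (c *\<^sub>R x)) j = site (c ^ 3 *\<^sub>R cubic x) j" .
qed

lemma inner_rot_cubic: "inner x (rot (cubic x)) = 0"
  unfolding inner_even_l2_def by (simp add: inner_complex_def)

lemma lipschitz_cubic:
  assumes "norm x \<le> R" "norm y \<le> R"
  shows "norm (cubic x - cubic y) \<le> 3 * R\<^sup>2 * norm (x - y)"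
proof -
  \<comment> \<open>One factor of the product of \<open>x\<close>, \<open>conjugate x\<close> and
    \<open>x\<close> is changed at a time.\<close>
  have "cubic x - cubic y = pmul (sqabs x) (x - y) + (pmul (pmul x (conjugate (x - y))) y + pmul (pmul (x - y) (conjugate y)) y)"
    by (rule even_l2_eqI) (simp add: cubic_def sqabs_def algebra_simps)
  also have "norm \<dots> \<le> norm (pmul (sqabs x) (x - y)) + (norm (pmul (pmul x (conjugate (x - y))) y) + norm (pmul (pmul (x - y) (conjugate y)) y))"
    by (intro order_trans[OF norm_triangle_ineq] add_mono order_refl norm_triangle_ineq)
  also have "\<dots> \<le> R\<^sup>2 * norm (x - y) + (R * norm (x - y) * R + norm (x - y) * R * R)"
  proof (intro add_mono)
    have R: "0 \<le> R" using assms(1) norm_ge_zero order_trans by blast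
    have "norm (pmul (sqabs x) (x - y)) \<le> norm (sqabs x) * norm (x - y)" by (rule norm_pmul_le)
    also have "\<dots> \<le> R\<^sup>2 * norm (x - y)"
      using assms by (intro mult_right_mono order_trans[OF norm_sqabs_le] power_mono) auto
    finally show "norm (pmul (sqabs x) (x - y)) \<le> R\<^sup>2 * norm (x - y)" .
    show "norm (pmul (pmul x (conjugate (x - y))) y) \<le> R * norm (x - y) * R"
      using assms R by (intro order_trans[OF norm_pmul_le] mult_mono) auto
    show "norm (pmul (pmul (x - y) (conjugate y)) y) \<le> norm (x - y) * R * R"
      using assms R by (intro order_trans[OF norm_pmul_le] mult_mono) auto
  qed
  finally show ?thesis by (simp add: power2_eq_square algebra_simps)
qed

text \<open>Minus one half of the gradient of \<open>nls_energy\<close>. The parameter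
  \<open>\<kappa>\<close> is 1/h^2 in the application, which leaves \<open>lap\<close> and
  \<open>dirichlet\<close> free of h.\<close>

definition nls_grad :: "real \<Rightarrow> even_l2 \<Rightarrow> even_l2" where
  "nls_grad \<kappa> x = \<kappa> *\<^sub>R lap x + cubic x"

definition nls_field :: "real \<Rightarrow> even_l2 \<Rightarrow> even_l2" where
  "nls_field \<kappa> x = rot (nls_grad \<kappa> x)"

definition nls_energy :: "real \<Rightarrow> even_l2 \<Rightarrow> real" where
  "nls_energy \<kappa> x = \<kappa> * dirichlet x - (norm (sqabs x))\<^sup>2 / 2"

section \<open>Conservation laws and global well-posedness of the lattice flow\<close>

definition flow_line :: "real \<Rightarrow> (real \<Rightarrow> even_l2) \<Rightarrow> bool" where
  "flow_line \<kappa> y \<longleftrightarrow> (\<forall>t\<ge>0. (y has_vector_derivative nls_field \<kappa> (y t)) (at t within {0..}))"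

text \<open>\<open>rot\<close> is skew and commutes with the symmetric \<open>lap\<close>, so the
  expression equals its own negative.\<close>

lemma inner_rot_lap: "inner x (rot (lap x)) = 0"
proof -
  have "inner x (rot (lap x)) = - inner (rot x) (lap x)" by (simp add: inner_rot_swap)
  also have "inner (rot x) (lap x) = inner (rot (lap x)) x"
  proof -
    have "lap (rot x) = rot (lap x)" by (rule even_l2_eqI) (simp add: algebra_simps)
    then show ?thesis by (metis inner_lap_commute)
  qed
  finally show ?thesis by (simp add: inner_commute)
qed

lemma rot_linear: "rot (x + y) = rot x + rot y" "rot (c *\<^sub>R x) = c *\<^sub>R rot x" "rot (x - y) = rot x - rot y"
  using bounded_linear_rot by (auto simp: bounded_linear.linear linear_add linear_scale linear_diff)

lemma constant_of_zero_derivative: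
  fixes f :: "real \<Rightarrow> real"
  assumes "\<And>t. t \<ge> 0 \<Longrightarrow> (f has_vector_derivative 0) (at t within {0..})" "t \<ge> 0"
  shows "f t = f 0"
proof -
  have "\<exists>c. \<forall>x\<in>{0..}. f x = c"
    by (rule has_derivative_zero_constant) (use assms(1) in \<open>auto simp: has_vector_derivative_def\<close>)
  then show ?thesis using assms(2) by auto
qed

text \<open>Kept general in the field because it serves both the lattice field and its
  truncation.\<close>

lemma norm_conserved:
  assumes y: "\<And>t. t \<ge> 0 \<Longrightarrow> (y has_vector_derivative F (y t)) (at t within {0..})"
    and F: "\<And>x. inner x (F x) = 0" and "t \<ge> 0"
  shows "norm (y t) = norm (y 0 :: 'a::real_inner)"
proof -
  have "inner (y t) (y t) = inner (y 0) (y 0)"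
  proof (rule constant_of_zero_derivative[OF _ \<open>t \<ge> 0\<close>])
    fix s :: real assume "s \<ge> 0"
    from bounded_bilinear.has_vector_derivative[OF bounded_bilinear_inner y[OF this] y[OF this]]
    show "((\<lambda>s. inner (y s) (y s)) has_vector_derivative 0) (at s within {0..})"
      by (simp add: F inner_commute[of "F x" x for x])
  qed
  then show ?thesis by (simp add: norm_eq_sqrt_inner)
qed

lemma nls_field_orthogonal: "inner x (nls_field \<kappa> x) = 0"
  by (simp add: nls_field_def nls_grad_def rot_linear inner_add_right inner_rot_lap inner_rot_cubic)

lemma flow_line_norm: "flow_line \<kappa> y \<Longrightarrow> t \<ge> 0 \<Longrightarrow> norm (y t) = norm (y 0)"
  using norm_conserved[of y "nls_field \<kappa>" t] by (simp add: flow_line_def nls_field_orthogonal)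

text \<open>The derivative along the flow is -2 times the inner product of \<open>nls_grad\<close>
  with its own rotation, which vanishes. The energy may be differentiated in norm because
  \<open>lap\<close> is a bounded operator.\<close>

lemma flow_line_energy:
  assumes y: "flow_line \<kappa> y" and t: "t \<ge> 0"
  shows "nls_energy \<kappa> (y t) = nls_energy \<kappa> (y 0)"
proof -
  define E where "E x = - \<kappa> * inner (lap x) x - inner (sqabs x) (sqabs x) / 2" for x
  have E: "nls_energy \<kappa> x = E x" for x
    by (simp add: nls_energy_def E_def inner_lap_self power2_norm_eq_inner)
  have "E (y t) = E (y 0)"
  proof (rule constant_of_zero_derivative[OF _ t])
    fix s :: real assume s: "s \<ge> 0"
    define v where "v = nls_field \<kappa> (y s)"
    have d: "(y has_vector_derivative v) (at s within {0..})"
      using y s by (simp add: flow_line_def v_def)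
    have dl: "((\<lambda>s. lap (y s)) has_vector_derivative lap v) (at s within {0..})"
      by (rule bounded_linear.has_vector_derivative[OF bounded_linear_lap d])
    have dc: "((\<lambda>s. conjugate (y s)) has_vector_derivative conjugate v) (at s within {0..})"
      by (rule bounded_linear.has_vector_derivative[OF bounded_linear_conjugate d])
    have dq: "((\<lambda>s. sqabs (y s)) has_vector_derivative (pmul (y s) (conjugate v) + pmul v (conjugate (y s)))) (at s within {0..})"
      unfolding sqabs_def by (rule bounded_bilinear.has_vector_derivative[OF bounded_bilinear_pmul d dc])
    let ?q = "pmul (y s) (conjugate v) + pmul v (conjugate (y s))"
    have "((\<lambda>s. (- \<kappa>) * inner (lap (y s)) (y s) - inner (sqabs (y s)) (sqabs (y s)) / 2) has_vector_derivative
       ((- \<kappa>) * (inner (lap (y s)) v + inner (lap v) (y s)) - (inner (sqabs (y s)) ?q + inner ?q (sqabs (y s))) / 2)) (at s within {0..})"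
      by (intro has_vector_derivative_diff has_vector_derivative_divide has_vector_derivative_mult_right
          bounded_bilinear.has_vector_derivative[OF bounded_bilinear_inner] d dl dq)
    moreover have q: "inner (sqabs (y s)) ?q = 2 * inner (cubic (y s)) v"
      unfolding inner_even_l2_def
      by (subst infsum_cmult_right'[symmetric], rule infsum_cong)
         (simp add: inner_complex_def algebra_simps del: of_real_power)
    moreover have "inner ?q (sqabs (y s)) = 2 * inner (cubic (y s)) v"
      using q by (simp only: inner_commute[of ?q])
    moreover have "inner (lap v) (y s) = inner (lap (y s)) v"
      by (metis inner_lap_commute inner_commute)
    moreover have "(- \<kappa>) * (a + a) - (2 * b + 2 * b) / 2 = - 2 * (\<kappa> * a + b)" for a b :: real
      by (simp add: algebra_simps)
    ultimately have "((\<lambda>s. E (y s)) has_vector_derivative (- 2 * inner (nls_grad \<kappa> (y s)) v)) (at s within {0..})"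
      unfolding E_def nls_grad_def inner_add_left inner_scaleR_left by metis
    then show "((\<lambda>s. E (y s)) has_vector_derivative 0) (at s within {0..})"
      by (simp add: v_def nls_field_def inner_rot_self)
  qed
  then show ?thesis by (simp add: E)
qed

text \<open>Truncating the cubic term radially makes the field Lipschitz and keeps it orthogonal to its argument,
  hence the flow of the truncated field never leaves the sphere it starts on.\<close>

lemma nls_truncated_lipschitz:
  assumes R: "R > 0"
  obtains F L where "L > 0" "\<And>x y. norm (F x - F y) \<le> L * norm (x - y)" "F 0 = 0"
    "\<And>x. norm x \<le> R \<Longrightarrow> F x = nls_field \<kappa> x" "\<And>x. inner x (F x) = 0"
proof -
  define P where "P x = (if norm x \<le> R then x else (R / norm x) *\<^sub>R x)" for x :: even_l2
  have P: "norm (P x) \<le> R" "norm (P x - P y) \<le> 2 * norm (x - y)" for x y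
    unfolding P_def by (rule lipschitz_radial_truncation[OF R])+
  define F where "F x = rot (\<kappa> *\<^sub>R lap x + cubic (P x))" for x
  obtain K where K: "K > 0" "\<And>x. norm (lap x) \<le> norm x * K"
    using bounded_linear.pos_bounded[OF bounded_linear_lap] by blast
  define L where "L = \<bar>\<kappa>\<bar> * K + 6 * R\<^sup>2"
  show ?thesis
  proof
    show "L > 0" unfolding L_def using R K by (intro add_nonneg_pos) auto
    show "norm (F x - F y) \<le> L * norm (x - y)" for x y
    proof -
      have "F x - F y = rot (\<kappa> *\<^sub>R lap (x - y) + (cubic (P x) - cubic (P y)))"
        using bounded_linear_lap by (simp add: F_def rot_linear bounded_linear.linear linear_diff scaleR_diff_right)
      then have "norm (F x - F y) \<le> norm (\<kappa> *\<^sub>R lap (x - y)) + norm (cubic (P x) - cubic (P y))"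
        by (simp only: norm_rot norm_triangle_ineq)
      also have "norm (cubic (P x) - cubic (P y)) \<le> 3 * R\<^sup>2 * norm (P x - P y)"
        by (intro lipschitz_cubic P)
      also have "\<dots> \<le> 3 * R\<^sup>2 * (2 * norm (x - y))"
        by (intro mult_left_mono P) auto
      also have "norm (\<kappa> *\<^sub>R lap (x - y)) \<le> \<bar>\<kappa>\<bar> * (norm (x - y) * K)"
        using K(2) by (simp add: mult_left_mono)
      finally show ?thesis by (simp add: L_def algebra_simps)
    qed
    show "F 0 = 0" by (rule even_l2_eqI) (use R in \<open>simp add: F_def P_def\<close>)
    show "F x = nls_field \<kappa> x" if "norm x \<le> R" for x
      using that by (simp add: F_def P_def nls_field_def nls_grad_def)
    show "inner x (F x) = 0" for x
    proof -
      obtain c where "P x = c *\<^sub>R x" by (metis P_def scaleR_one)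
      then show ?thesis by (simp add: F_def rot_linear inner_add_right cubic_scaleR inner_rot_lap inner_rot_cubic)
    qed
  qed
qed

lemma flow_line_exists: "\<exists>y. flow_line \<kappa> y \<and> y 0 = x0"
proof -
  \<comment> \<open>Radius \<open>norm x0 + 1\<close> instead of \<open>norm x0\<close> keeps it
    positive when \<open>x0 = 0\<close>.\<close>
  obtain F L where F: "L > 0" "\<And>x y. norm (F x - F y) \<le> L * norm (x - y)" "F 0 = 0"
    "\<And>x. norm x \<le> norm x0 + 1 \<Longrightarrow> F x = nls_field \<kappa> x" "\<And>x. inner x (F x) = 0"
    using nls_truncated_lipschitz[of "norm x0 + 1" \<kappa>] by (smt (verit) norm_ge_zero)
  obtain y where y: "y 0 = x0" "\<And>t. t \<ge> 0 \<Longrightarrow> (y has_vector_derivative F (y t)) (at t within {0..})"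
    using global_lipschitz_ode[OF F(1-3)] by blast
  have "norm (y t) = norm x0" if "t \<ge> 0" for t
    using norm_conserved[of y F t, OF y(2) F(5) that] y(1) by simp
  then have "F (y t) = nls_field \<kappa> (y t)" if "t \<ge> 0" for t
    using that by (intro F(4)) simp
  then show ?thesis
    using y unfolding flow_line_def by (intro exI[of _ y]) simp
qed

text \<open>Both curves stay on the sphere through their common initial value, where the field
  agrees with a globally Lipschitz one; uniqueness is inherited from there.\<close>

lemma flow_line_unique:
  assumes "flow_line \<kappa> y" "flow_line \<kappa> w" "y 0 = w 0" "t \<ge> 0"
  shows "y t = w t"
proof -
  obtain F L where F: "L > 0" "\<And>x y. norm (F x - F y) \<le> L * norm (x - y)" "F 0 = 0"
    "\<And>x. norm x \<le> norm (y 0) + 1 \<Longrightarrow> F x = nls_field \<kappa> x" "\<And>x. inner x (F x) = 0"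
    using nls_truncated_lipschitz[of "norm (y 0) + 1" \<kappa>] by (smt (verit) norm_ge_zero)
  have F': "(z has_vector_derivative F (z s)) (at s within {0..})" if "flow_line \<kappa> z" "z 0 = y 0" "s \<ge> 0" for z s
    using that flow_line_norm[OF that(1,3)] F(4)[of "z s"] by (simp add: flow_line_def)
  show ?thesis
    by (rule global_lipschitz_ode_unique[of F L y w, OF F(2) F' F' assms(3,4)]) (use assms in auto)
qed

lemma continuous_nls_field: "continuous_on UNIV (nls_field \<kappa>)"
  unfolding nls_field_def nls_grad_def cubic_def sqabs_def
  by (intro bounded_linear.continuous_on[OF bounded_linear_rot] continuous_intros
      bounded_linear.continuous_on[OF bounded_linear_lap] bounded_linear.continuous_on[OF bounded_linear_conjugate]
      bounded_bilinear.continuous_on[OF bounded_bilinear_pmul])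

text \<open>Sitewise derivatives alone give no derivative in norm. Norm continuity of the curve
  makes the field along it continuous, hence integrable with values in the Banach space; the
  integral has the same derivative at every site and the same initial value, so it is the curve.
  This is needed because \<open>dnls_solution\<close> only differentiates site by site.\<close>

lemma flow_line_sitewise:
  assumes cont: "continuous_on {0..} y"
    and der: "\<And>t j. t \<ge> 0 \<Longrightarrow> ((\<lambda>t. site (y t) j) has_vector_derivative site (nls_field \<kappa> (y t)) j) (at t within {0..})"
  shows "flow_line \<kappa> y"
proof -
  define k where "k t = nls_field \<kappa> (y t)" for t
  have contk: "continuous_on {0..} k"
    unfolding k_def by (rule continuous_on_compose2[OF continuous_nls_field cont]) auto
  define w where "w t = y 0 + integral {0..t} k" for t
  have w: "(w has_vector_derivative k t) (at t within {0..})" if "t \<ge> 0" for t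
    unfolding w_def[abs_def]
    using has_vector_derivative_add[OF has_vector_derivative_const has_vector_derivative_indefinite_integral[OF contk that]]
    by simp
  have "y t = w t" if t: "t \<ge> 0" for t
  proof (rule even_l2_eqI)
    fix j
    have "\<exists>c. \<forall>x\<in>{0..}. site (y x) j - site (w x) j = c"
    proof (rule has_derivative_zero_constant)
      fix s :: real assume "s \<in> {0..}"
      then have "((\<lambda>x. site (y x) j - site (w x) j) has_vector_derivative site (k s) j - site (k s) j) (at s within {0..})"
        unfolding k_def
        by (intro has_vector_derivative_diff der bounded_linear.has_vector_derivative[OF bounded_linear_site] w[unfolded k_def]) auto
      then show "((\<lambda>x. site (y x) j - site (w x) j) has_derivative (\<lambda>h. 0)) (at s within {0..})"
        by (simp add: has_vector_derivative_def)
    qed auto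
    then obtain c where "\<And>x. x \<ge> 0 \<Longrightarrow> site (y x) j - site (w x) j = c" by auto
    from this[of 0] this[OF t] show "site (y t) j = site (w t) j" by (simp add: w_def)
  qed
  then show ?thesis
    unfolding flow_line_def k_def[symmetric]
    using has_vector_derivative_transform[of _ "{0..}" y w, OF _ _ w] by simp
qed

section \<open>Piecewise differentiable functions and weak derivatives\<close>

definition l2sq :: "(real \<Rightarrow> complex) \<Rightarrow> real" where
  "l2sq f = (LINT x|lborel. (norm (f x))\<^sup>2)"

lemma l2sq_nonneg [simp]: "0 \<le> l2sq f"
  unfolding l2sq_def by (rule Bochner_Integration.integral_nonneg) simp

lemma L2_measurable [measurable_dest]: "f \<in> L2 \<Longrightarrow> f \<in> borel_measurable borel"
  by (simp add: L2_def)

lemma L2_integrable: "f \<in> L2 \<Longrightarrow> integrable lborel (\<lambda>x. (norm (f x))\<^sup>2)"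
  by (simp add: L2_def)

lemma L2I:
  assumes "f \<in> borel_measurable borel" "integrable lborel g" "\<And>x. (norm (f x))\<^sup>2 \<le> g x"
  shows "f \<in> L2"
proof -
  have [measurable]: "f \<in> borel_measurable lborel" using assms(1) by simp
  have "integrable lborel (\<lambda>x. (norm (f x))\<^sup>2)"
    by (rule Bochner_Integration.integrable_bound[OF assms(2)])
       (auto intro!: AE_I2 order_trans[OF assms(3) abs_ge_self])
  then show ?thesis by (simp add: L2_def)
qed

lemma power2_norm_add_le: "(norm (a + b))\<^sup>2 \<le> 2 * (norm a)\<^sup>2 + 2 * (norm (b :: 'a::real_normed_vector))\<^sup>2"
proof -
  have "(norm (a + b))\<^sup>2 \<le> (norm a + norm b)\<^sup>2"
    by (intro power_mono norm_triangle_ineq) auto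
  also have "\<dots> \<le> 2 * (norm a)\<^sup>2 + 2 * (norm b)\<^sup>2"
    using sum_squares_bound[of "norm a" "norm b"] by (simp add: power2_sum)
  finally show ?thesis .
qed

lemma L2_add [intro]:
  assumes [measurable]: "f \<in> L2" "g \<in> L2" shows "(\<lambda>x. f x + g x) \<in> L2"
  by (rule L2I[of _ "\<lambda>x. 2 * (norm (f x))\<^sup>2 + 2 * (norm (g x))\<^sup>2"])
     (auto intro!: L2_integrable assms power2_norm_add_le)

lemma l2sq_add_le:
  assumes "f \<in> L2" "g \<in> L2" shows "l2sq (\<lambda>x. f x + g x) \<le> 2 * l2sq f + 2 * l2sq g"
proof -
  have "l2sq (\<lambda>x. f x + g x) \<le> (LINT x|lborel. 2 * (norm (f x))\<^sup>2 + 2 * (norm (g x))\<^sup>2)"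
    unfolding l2sq_def using L2_integrable[OF L2_add[OF assms]] assms[THEN L2_integrable]
    by (intro integral_mono power2_norm_add_le) auto
  also have "\<dots> = 2 * l2sq f + 2 * l2sq g"
    unfolding l2sq_def using assms[THEN L2_integrable] by simp
  finally show ?thesis .
qed

lemma L2_mult_bounded:
  assumes [measurable]: "f \<in> L2" "k \<in> borel_measurable borel" and "\<And>x. norm (k x) \<le> c"
  shows "(\<lambda>x. k x * f x) \<in> L2" and "l2sq (\<lambda>x. k x * f x) \<le> c\<^sup>2 * l2sq f"
proof -
  have *: "(norm (k x * f x))\<^sup>2 \<le> c\<^sup>2 * (norm (f x))\<^sup>2" for x
    using assms(3)[of x] by (simp add: norm_mult power_mult_distrib mult_right_mono power_mono)
  show L: "(\<lambda>x. k x * f x) \<in> L2"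
    by (rule L2I[OF _ _ *]) (auto intro!: L2_integrable assms)
  have "l2sq (\<lambda>x. k x * f x) \<le> (LINT x|lborel. c\<^sup>2 * (norm (f x))\<^sup>2)"
    unfolding l2sq_def using L2_integrable[OF L] L2_integrable[OF assms(1)]
    by (intro integral_mono * ) auto
  then show "l2sq (\<lambda>x. k x * f x) \<le> c\<^sup>2 * l2sq f" by (simp add: l2sq_def)
qed

lemma L2_cmult [intro]: "f \<in> L2 \<Longrightarrow> (\<lambda>x. c * f x) \<in> L2"
  by (rule L2_mult_bounded) auto

lemma L2_diff [intro]: "f \<in> L2 \<Longrightarrow> g \<in> L2 \<Longrightarrow> (\<lambda>x. f x - g x) \<in> L2"
  using L2_add[of f "\<lambda>x. (-1) * g x"] L2_cmult[of g "-1"] by simp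

lemma integrable_L2_mult:
  fixes k :: "real \<Rightarrow> 'b::{banach, second_countable_topology}"
  assumes [measurable]: "f \<in> L2" "g \<in> L2" "k \<in> borel_measurable borel"
    and "\<And>x. norm (k x) \<le> c * (norm (f x) * norm (g x))"
  shows "integrable lborel k"
proof (rule Bochner_Integration.integrable_bound)
  show "integrable lborel (\<lambda>x. \<bar>c\<bar> * ((norm (f x))\<^sup>2 + (norm (g x))\<^sup>2))"
    using assms(1,2)[THEN L2_integrable] by simp
  have "norm (k x) \<le> norm (\<bar>c\<bar> * ((norm (f x))\<^sup>2 + (norm (g x))\<^sup>2))" for x
  proof -
    have "norm (k x) \<le> \<bar>c\<bar> * (norm (f x) * norm (g x))"
      by (rule order_trans[OF assms(4)]) (auto intro!: mult_right_mono)
    also have "norm (f x) * norm (g x) \<le> (norm (f x))\<^sup>2 + (norm (g x))\<^sup>2"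
      using sum_squares_bound[of "norm (f x)" "norm (g x)"]
        mult_nonneg_nonneg[OF norm_ge_zero norm_ge_zero, of "f x" "g x"] by linarith
    finally show ?thesis by (simp add: mult_left_mono)
  qed
  then show "AE x in lborel. norm (k x) \<le> norm (\<bar>c\<bar> * ((norm (f x))\<^sup>2 + (norm (g x))\<^sup>2))" by simp
qed simp

text \<open>Integrates a weighted arithmetic-geometric mean inequality whose weights are ratios of
  the two norms. Both norms are enlarged by \<open>e > 0\<close> so that they may be divided by, and
  \<open>e\<close> tends to 0 at the end.\<close>

lemma L2_cauchy_schwarz:
  assumes [measurable]: "f \<in> L2" "g \<in> L2"
  shows "(LINT x|lborel. norm (f x) * norm (g x)) \<le> sqrt (l2sq f) * sqrt (l2sq g)"
proof (rule tendsto_lowerbound)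
  show "((\<lambda>e. (sqrt (l2sq f) + e) * (sqrt (l2sq g) + e)) \<longlongrightarrow> sqrt (l2sq f) * sqrt (l2sq g)) (at_right 0)"
    by (auto intro!: tendsto_eq_intros)
  show "\<forall>\<^sub>F e in at_right 0. (LINT x|lborel. norm (f x) * norm (g x)) \<le> (sqrt (l2sq f) + e) * (sqrt (l2sq g) + e)"
    using eventually_at_right_less[of 0]
  proof eventually_elim
    case (elim e)
    define a where "a = sqrt (l2sq f) + e"
    define b where "b = sqrt (l2sq g) + e"
    have pos: "a > 0" "b > 0" using elim by (auto simp: a_def b_def add_nonneg_pos)
    have fa: "l2sq f \<le> a\<^sup>2"
      using elim real_sqrt_le_iff[of "l2sq f" "a\<^sup>2"] pos by (simp add: a_def)
    have gb: "l2sq g \<le> b\<^sup>2"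
      using elim real_sqrt_le_iff[of "l2sq g" "b\<^sup>2"] pos by (simp add: b_def)
    have pt: "norm (f x) * norm (g x) \<le> (b / a) / 2 * (norm (f x))\<^sup>2 + (a / b) / 2 * (norm (g x))\<^sup>2" for x
    proof -
      have "0 \<le> (b * norm (f x) - a * norm (g x))\<^sup>2 / (2 * a * b)" using pos by simp
      also have "\<dots> = (b / a) / 2 * (norm (f x))\<^sup>2 + (a / b) / 2 * (norm (g x))\<^sup>2 - norm (f x) * norm (g x)"
        using pos by (simp add: field_simps power2_eq_square)
      finally show ?thesis by simp
    qed
    have "(LINT x|lborel. norm (f x) * norm (g x)) \<le> (LINT x|lborel. (b / a) / 2 * (norm (f x))\<^sup>2 + (a / b) / 2 * (norm (g x))\<^sup>2)"
      using assms[THEN L2_integrable] integrable_L2_mult[OF assms, of "\<lambda>x. norm (f x) * norm (g x)" 1]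
      by (intro integral_mono pt) auto
    also have "\<dots> = (b / a) / 2 * l2sq f + (a / b) / 2 * l2sq g"
      unfolding l2sq_def using assms[THEN L2_integrable] by simp
    also have "\<dots> \<le> (b / a) / 2 * a\<^sup>2 + (a / b) / 2 * b\<^sup>2"
      using pos fa gb by (intro add_mono mult_left_mono) auto
    also have "\<dots> = a * b" using pos by (simp add: power2_eq_square)
    finally show ?case by (simp add: a_def b_def)
  qed
qed simp

text \<open>The class contains smooth solitons as well as interpolants with kinks at the nodes, is
  closed under sums and products, and still obeys the fundamental theorem of calculus. The values of
  \<open>F'\<close> on the exceptional set are arbitrary.\<close>

definition pw_deriv :: "(real \<Rightarrow> 'a::real_normed_vector) \<Rightarrow> (real \<Rightarrow> 'a) \<Rightarrow> bool" where
  "pw_deriv F F' \<longleftrightarrow> continuous_on UNIV F \<and>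
     (\<exists>S. (\<forall>a b. finite (S \<inter> {a..b})) \<and> (\<forall>x. x \<notin> S \<longrightarrow> (F has_vector_derivative F' x) (at x)))"

lemma pw_derivI: "(\<And>x. (F has_vector_derivative F' x) (at x)) \<Longrightarrow> pw_deriv F F'"
  unfolding pw_deriv_def
  by (intro conjI exI[of _ "{}"]) (auto intro!: has_vector_derivative_continuous continuous_at_imp_continuous_on)

lemma pw_derivI_real: "(\<And>x. (F has_real_derivative F' x) (at x)) \<Longrightarrow> pw_deriv F F'"
  by (rule pw_derivI) (simp add: has_real_derivative_iff_has_vector_derivative)

text \<open>A union of two locally finite sets is locally finite, so each differentiation rule for
  two functions carries over to \<open>pw_deriv\<close> once continuity is known.\<close>

lemma pw_deriv_combine:
  assumes F: "pw_deriv F F'" and G: "pw_deriv G G'" and c: "continuous_on UNIV H"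
    and H: "\<And>x. (F has_vector_derivative F' x) (at x) \<Longrightarrow> (G has_vector_derivative G' x) (at x)
          \<Longrightarrow> (H has_vector_derivative H' x) (at x)"
  shows "pw_deriv H H'"
proof -
  obtain S where S: "\<And>a b. finite (S \<inter> {a..b})" "\<And>x. x \<notin> S \<Longrightarrow> (F has_vector_derivative F' x) (at x)"
    using F unfolding pw_deriv_def by blast
  obtain T where T: "\<And>a b. finite (T \<inter> {a..b})" "\<And>x. x \<notin> T \<Longrightarrow> (G has_vector_derivative G' x) (at x)"
    using G unfolding pw_deriv_def by blast
  show ?thesis unfolding pw_deriv_def
    using S T H c by (intro conjI exI[of _ "S \<union> T"]) (auto simp: Int_Un_distrib2)
qed

lemma pw_deriv_continuous: "pw_deriv F F' \<Longrightarrow> continuous_on A F"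
  unfolding pw_deriv_def using continuous_on_subset by blast

lemma pw_deriv_bilinear:
  assumes "bounded_bilinear p" "pw_deriv F F'" "pw_deriv G G'"
  shows "pw_deriv (\<lambda>x. p (F x) (G x)) (\<lambda>x. p (F x) (G' x) + p (F' x) (G x))"
  by (rule pw_deriv_combine[OF assms(2,3)])
     (auto intro: bounded_bilinear.continuous_on[OF assms(1)] assms pw_deriv_continuous
        bounded_bilinear.has_vector_derivative[OF assms(1)])

lemma pw_deriv_add:
  assumes "pw_deriv F F'" "pw_deriv G G'"
  shows "pw_deriv (\<lambda>x. F x + G x) (\<lambda>x. F' x + G' x)"
  by (rule pw_deriv_combine[OF assms]) (auto intro: continuous_intros assms pw_deriv_continuous has_vector_derivative_add)

lemma pw_deriv_diff:
  assumes "pw_deriv F F'" "pw_deriv G G'"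
  shows "pw_deriv (\<lambda>x. F x - G x) (\<lambda>x. F' x - G' x)"
  by (rule pw_deriv_combine[OF assms]) (auto intro: continuous_intros assms pw_deriv_continuous has_vector_derivative_diff)

lemma pw_deriv_ftc:
  fixes F :: "real \<Rightarrow> 'a::banach"
  assumes "pw_deriv F F'" "a \<le> b"
  shows "(F' has_integral F b - F a) {a..b}"
proof -
  obtain S where S: "\<And>a b. finite (S \<inter> {a..b})" "\<And>x. x \<notin> S \<Longrightarrow> (F has_vector_derivative F' x) (at x)"
    using assms(1) unfolding pw_deriv_def by blast
  show ?thesis
    by (rule fundamental_theorem_of_calculus_strong[OF S(1)[of a b] assms(2)])
       (auto intro: S pw_deriv_continuous[OF assms(1)])
qed

lemma set_integrable_lborel:
  fixes f :: "real \<Rightarrow> 'a::{banach, second_countable_topology}"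
  shows "integrable lborel f \<Longrightarrow> S \<in> sets borel \<Longrightarrow> set_integrable lborel S f"
  unfolding set_integrable_def by (intro integrable_mult_indicator) auto

lemma pw_deriv_set_integral:
  fixes F :: "real \<Rightarrow> 'a::euclidean_space"
  assumes "pw_deriv F F'" "a \<le> b" "integrable lborel F'"
  shows "(LINT x:{a..b}|lborel. F' x) = F b - F a"
proof -
  have "set_integrable lborel {a..b} F'" by (rule set_integrable_lborel[OF assms(3)]) simp
  from set_borel_integral_eq_integral(2)[OF this] pw_deriv_ftc[OF assms(1,2)] show ?thesis
    by (simp add: integral_unique)
qed

lemma tendsto_set_integral_whole:
  fixes f :: "real \<Rightarrow> 'a::euclidean_space"
  assumes "integrable lborel f"
  shows "(\<lambda>n. LINT x:{- real n..real n}|lborel. f x) \<longlonglongrightarrow> integral\<^sup>L lborel f"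
  unfolding set_lebesgue_integral_def
proof (rule integral_dominated_convergence[where w = "\<lambda>x. norm (f x)"])
  have [measurable]: "f \<in> borel_measurable borel" using assms by auto
  show "f \<in> borel_measurable lborel" "(\<lambda>x. indicat_real {- real n..real n} x *\<^sub>R f x) \<in> borel_measurable lborel" for n
    by simp_all
  show "AE x in lborel. (\<lambda>n. indicat_real {- real n..real n} x *\<^sub>R f x) \<longlonglongrightarrow> f x"
  proof (rule AE_I2)
    fix x
    obtain N where N: "\<bar>x\<bar> \<le> real N" using real_arch_simple by blast
    have "\<forall>\<^sub>F n in sequentially. indicat_real {- real n..real n} x *\<^sub>R f x = f x"
      using eventually_ge_at_top[of N] by eventually_elim (use N in \<open>auto simp: indicator_def\<close>)
    then show "(\<lambda>n. indicat_real {- real n..real n} x *\<^sub>R f x) \<longlonglongrightarrow> f x"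
      by (rule tendsto_eventually)
  qed
qed (use assms in \<open>auto split: split_indicator\<close>)

lemma pw_deriv_integral_whole:
  fixes F :: "real \<Rightarrow> 'a::euclidean_space"
  assumes "pw_deriv F F'" "integrable lborel F'" "(F \<longlongrightarrow> B) at_top" "(F \<longlongrightarrow> A) at_bot"
  shows "integral\<^sup>L lborel F' = B - A"
proof (rule LIMSEQ_unique[OF tendsto_set_integral_whole[OF assms(2)]])
  have "(\<lambda>n. F (real n) - F (- real n)) \<longlonglongrightarrow> B - A"
  proof (rule tendsto_diff)
    show "(\<lambda>n. F (real n)) \<longlonglongrightarrow> B" by (rule filterlim_compose[OF assms(3) filterlim_real_sequentially])
    have "filterlim (\<lambda>n. - real n) at_bot sequentially"
      using filterlim_real_sequentially by (simp add: filterlim_uminus_at_bot)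
    then show "(\<lambda>n. F (- real n)) \<longlonglongrightarrow> A" by (rule filterlim_compose[OF assms(4)])
  qed
  then show "(\<lambda>n. LINT x:{- real n..real n}|lborel. F' x) \<longlonglongrightarrow> B - A"
    by (simp add: pw_deriv_set_integral[OF assms(1) _ assms(2)])
qed

lemma pw_deriv_increment_le:
  fixes F :: "real \<Rightarrow> 'a::euclidean_space"
  assumes "pw_deriv F F'" "integrable lborel F'" "A \<in> sets borel" "{min a b..max a b} \<subseteq> A"
  shows "norm (F b - F a) \<le> (LINT x:A|lborel. norm (F' x))"
proof -
  note I = set_integrable_lborel[OF integrable_norm[OF assms(2)]]
  have "norm (F b - F a) = norm (F (max a b) - F (min a b))"
    by (auto simp: max_def min_def norm_minus_commute)
  also have "F (max a b) - F (min a b) = (LINT x:{min a b..max a b}|lborel. F' x)"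
    by (rule pw_deriv_set_integral[symmetric, OF assms(1) _ assms(2)]) auto
  also have "norm \<dots> \<le> (LINT x:{min a b..max a b}|lborel. norm (F' x))"
    using I[of "{min a b..max a b}"] unfolding set_lebesgue_integral_def
    by (intro order_trans[OF integral_norm_bound]) simp
  also have "\<dots> \<le> (LINT x:A|lborel. norm (F' x))"
    using I assms(3,4) unfolding set_lebesgue_integral_def set_integrable_def
    by (intro integral_mono) (auto split: split_indicator)
  finally show ?thesis .
qed

lemma pw_deriv_reflect:
  assumes "pw_deriv F F'" shows "pw_deriv (\<lambda>x. F (- x)) (\<lambda>x. - F' (- x))"
proof -
  obtain S where S: "\<And>a b. finite (S \<inter> {a..b})" "\<And>x. x \<notin> S \<Longrightarrow> (F has_vector_derivative F' x) (at x)"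
    using assms(1) unfolding pw_deriv_def by blast
  show ?thesis unfolding pw_deriv_def
  proof (intro conjI exI[of _ "uminus ` S"] allI impI)
    show "continuous_on UNIV (\<lambda>x. F (- x))"
      by (rule continuous_on_compose2[OF pw_deriv_continuous[OF assms]]) (auto intro: continuous_intros)
    fix a b :: real
    have "uminus ` S \<inter> {a..b} = uminus ` (S \<inter> {-b..-a})" by force
    then show "finite (uminus ` S \<inter> {a..b})" using S(1) by simp
  next
    fix x assume "x \<notin> uminus ` S"
    then have "- x \<notin> S" by force
    from S(2)[OF this] have "((F \<circ> uminus) has_vector_derivative (- 1) *\<^sub>R F' (- x)) (at x)"
      by (intro vector_diff_chain_at) (auto intro!: derivative_eq_intros)
    then show "((\<lambda>x. F (- x)) has_vector_derivative - F' (- x)) (at x)" by (simp add: o_def)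
  qed
qed

lemma tendsto_set_integral_tail:
  fixes f :: "real \<Rightarrow> real"
  assumes "integrable lborel f"
  shows "((\<lambda>y. LINT x:{y..}|lborel. f x) \<longlongrightarrow> 0) at_top"
proof (rule tendsto_at_topI_sequentially)
  fix X :: "nat \<Rightarrow> real" assume X: "filterlim X at_top sequentially"
  have [measurable]: "f \<in> borel_measurable borel" using assms by auto
  have "(\<lambda>n. LINT x|lborel. indicat_real {X n..} x *\<^sub>R f x) \<longlonglongrightarrow> (LINT x::real|lborel. (0::real))"
  proof (rule integral_dominated_convergence[where w = "\<lambda>x. norm (f x)"])
    show "AE x in lborel. (\<lambda>n. indicat_real {X n..} x *\<^sub>R f x) \<longlonglongrightarrow> 0"
    proof (rule AE_I2, rule tendsto_eventually)
      fix x
      have "\<forall>\<^sub>F n in sequentially. x < X n" using X by (simp add: filterlim_at_top_dense)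
      then show "\<forall>\<^sub>F n in sequentially. indicat_real {X n..} x *\<^sub>R f x = 0"
        by eventually_elim (auto simp: indicator_def)
    qed
  qed (use assms in \<open>auto split: split_indicator\<close>)
  then show "(\<lambda>n. LINT x:{X n..}|lborel. f x) \<longlonglongrightarrow> 0" by (simp add: set_lebesgue_integral_def)
qed

text \<open>On \<open>{y..y+1}\<close> the norm of \<open>F\<close> stays above its value at
  \<open>y\<close> minus the variation on \<open>{y..}\<close>. Averaging over this unit interval
  bounds \<open>norm (F y)\<close> by the tails of two convergent integrals.\<close>

lemma pw_deriv_vanish_at_top:
  fixes F :: "real \<Rightarrow> 'a::euclidean_space"
  assumes F: "pw_deriv F F'" "integrable lborel F'" "integrable lborel F"
  shows "(F \<longlongrightarrow> 0) at_top"
proof (rule Lim_null_comparison)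
  have I: "integrable lborel (\<lambda>x. norm (F x) + norm (F' x))"
    using F by auto
  show "((\<lambda>y. LINT x:{y..}|lborel. norm (F x) + norm (F' x)) \<longlongrightarrow> 0) at_top"
    by (rule tendsto_set_integral_tail[OF I])
  have "norm (F y) \<le> (LINT x:{y..}|lborel. norm (F x) + norm (F' x))" for y
  proof -
    define T where "T = (LINT x:{y..}|lborel. norm (F' x))"
    note SI = set_integrable_lborel[OF integrable_norm[OF F(3)]]
    note SI' = set_integrable_lborel[OF integrable_norm[OF F(2)]]
    have pt: "norm (F y) - T \<le> norm (F x)" if "x \<in> {y..y+1}" for x
    proof -
      have "norm (F x - F y) \<le> T"
        unfolding T_def by (rule pw_deriv_increment_le[OF F(1,2)]) (use that in auto)
      then show ?thesis using norm_triangle_ineq3[of "F x" "F y"] by linarith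
    qed
    have "norm (F y) - T = (LINT x:{y..y+1}|lborel. norm (F y) - T)"
      by (simp add: set_lebesgue_integral_def)
    also have "\<dots> \<le> (LINT x:{y..y+1}|lborel. norm (F x))"
      by (rule set_integral_mono[OF _ SI pt]) (auto simp: set_integrable_def)
    also have "\<dots> \<le> (LINT x:{y..}|lborel. norm (F x))"
      using SI[of "{y..y+1}"] SI[of "{y..}"] unfolding set_lebesgue_integral_def set_integrable_def
      by (intro integral_mono) (auto split: split_indicator)
    finally have "norm (F y) \<le> (LINT x:{y..}|lborel. norm (F x)) + T" by simp
    also have "\<dots> = (LINT x:{y..}|lborel. norm (F x) + norm (F' x))"
      unfolding T_def by (rule set_integral_add(2)[symmetric]) (auto intro: SI SI')
    finally show ?thesis .
  qed
  then show "\<forall>\<^sub>F y in at_top. norm (F y) \<le> (LINT x:{y..}|lborel. norm (F x) + norm (F' x))" by simp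
qed

lemma integrable_reflect:
  fixes f :: "real \<Rightarrow> 'a::{banach, second_countable_topology}"
  assumes "integrable lborel f" shows "integrable lborel (\<lambda>x. f (- x))"
  using lborel_integrable_real_affine[OF assms, of "-1" 0] by simp

lemma integral_reflect_lborel:
  fixes f :: "real \<Rightarrow> 'a::{banach, second_countable_topology}"
  shows "(LINT x|lborel. f (- x)) = (LINT x|lborel. f x)"
  using lborel_integral_real_affine[of "-1" f 0] by simp

lemma pw_deriv_vanish_at_bot:
  fixes F :: "real \<Rightarrow> 'a::euclidean_space"
  assumes F: "pw_deriv F F'" "integrable lborel F'" "integrable lborel F"
  shows "(F \<longlongrightarrow> 0) at_bot"
proof -
  have "((\<lambda>x. F (- x)) \<longlongrightarrow> 0) at_top"
    by (rule pw_deriv_vanish_at_top[OF pw_deriv_reflect[OF F(1)]])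
       (use integrable_reflect[OF F(2)] integrable_reflect[OF F(3)] in auto)
  then show ?thesis by (simp add: filterlim_at_bot_mirror)
qed

section \<open>Test functions, weak derivatives and their uniqueness\<close>

lemma L2_compact_support:
  fixes \<phi> :: "real \<Rightarrow> real"
  assumes [measurable]: "\<phi> \<in> borel_measurable borel" and "\<And>x. \<bar>\<phi> x\<bar> \<le> B" "\<And>x. \<bar>x\<bar> > R \<Longrightarrow> \<phi> x = 0"
  shows "(\<lambda>x. complex_of_real (\<phi> x)) \<in> L2"
proof (rule L2I)
  show "integrable lborel (\<lambda>x. B\<^sup>2 * indicator {-R..R} x :: real)"
    by (intro integrable_mult_right integrable_real_indicator) (auto simp: emeasure_lborel_Icc_eq)
  fix x
  have "\<bar>\<phi> x\<bar>\<^sup>2 \<le> B\<^sup>2" by (intro power_mono assms) auto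
  then show "(norm (complex_of_real (\<phi> x)))\<^sup>2 \<le> B\<^sup>2 * indicator {-R..R} x"
    using assms(3)[of x] by (cases "\<bar>x\<bar> > R") (auto simp: abs_le_iff indicator_def)
qed measurable

lemma test_functionE:
  assumes "test_function \<phi>"
  obtains R where "pw_deriv \<phi> (deriv \<phi>)" "\<phi> \<in> borel_measurable borel" "deriv \<phi> \<in> borel_measurable borel"
    "(\<lambda>x. complex_of_real (\<phi> x)) \<in> L2" "(\<lambda>x. complex_of_real (deriv \<phi> x)) \<in> L2" "\<And>x. \<bar>x\<bar> > R \<Longrightarrow> \<phi> x = 0"
proof -
  obtain D where D: "\<And>x. (\<phi> has_vector_derivative D x) (at x)" "continuous_on UNIV D"
    using assms unfolding test_function_def C1_differentiable_on_def by auto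
  have d: "(\<phi> has_real_derivative D x) (at x)" for x
    using D(1) by (simp add: has_real_derivative_iff_has_vector_derivative)
  then have D_eq: "deriv \<phi> = D" using DERIV_imp_deriv by blast
  have cont: "continuous_on UNIV \<phi>"
    using DERIV_isCont[OF d] by (simp add: continuous_at_imp_continuous_on)
  obtain R where R: "\<And>x. x \<in> closure {x. \<phi> x \<noteq> 0} \<Longrightarrow> norm x \<le> R"
    using assms unfolding test_function_def by (meson bounded_iff compact_imp_bounded)
  have z: "\<phi> x = 0" if "\<bar>x\<bar> > R" for x
    using R[of x] that closure_subset[of "{x. \<phi> x \<noteq> 0}"] by force
  have z': "D x = 0" if "\<bar>x\<bar> > R" for x
  proof -
    have "((\<lambda>_. 0) has_real_derivative D x) (at x)"
    proof (rule has_field_derivative_transform_within_open[OF d, where S = "{x. \<bar>x\<bar> > R}"])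
      show "open {x::real. R < \<bar>x\<bar>}" by (intro open_Collect_less continuous_intros)
    qed (use z that in auto)
    then show ?thesis using DERIV_unique[OF _ DERIV_const] by blast
  qed
  have L: "(\<lambda>x. complex_of_real (f x)) \<in> L2"
    if f: "continuous_on UNIV f" "\<And>x. \<bar>x\<bar> > R \<Longrightarrow> f x = 0" for f :: "real \<Rightarrow> real"
  proof -
    have "compact (f ` {-R..R})"
      by (rule compact_continuous_image) (auto intro: continuous_on_subset f)
    then obtain B where "\<forall>y\<in>f ` {-R..R}. norm y \<le> B"
      using compact_imp_bounded[of "f ` {-R..R}"] unfolding bounded_iff by blast
    then have B: "\<bar>f x\<bar> \<le> B" if "x \<in> {-R..R}" for x using that by simp
    have "\<bar>f x\<bar> \<le> \<bar>B\<bar>" for x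
    proof (cases "\<bar>x\<bar> > R")
      case False
      then have "x \<in> {-R..R}" by (auto simp: abs_le_iff)
      then show ?thesis using order_trans[OF B abs_ge_self] by blast
    qed (simp add: f(2))
    from L2_compact_support[OF borel_measurable_continuous_onI[OF f(1)] this f(2)] show ?thesis .
  qed
  show ?thesis
    using that[unfolded D_eq, OF pw_derivI[OF D(1)] _ _ L[OF cont z] L[OF D(2) z'] z]
      borel_measurable_continuous_onI[OF cont] borel_measurable_continuous_onI[OF D(2)] by blast
qed

lemma integrable_scaleR_L2:
  fixes \<phi> :: "real \<Rightarrow> real"
  assumes "(\<lambda>x. complex_of_real (\<phi> x)) \<in> L2" "f \<in> L2" and [measurable]: "\<phi> \<in> borel_measurable borel"
  shows "integrable lborel (\<lambda>x. \<phi> x *\<^sub>R f x)"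
  using assms(2) by (intro integrable_L2_mult[OF assms(1,2), of _ 1]) auto

text \<open>A concrete element of H1: a continuous representative together with an explicit
  derivative. Solitons, interpolants and their differences are all of this kind.\<close>

definition sobolev_pair :: "(real \<Rightarrow> complex) \<Rightarrow> (real \<Rightarrow> complex) \<Rightarrow> bool" where
  "sobolev_pair u v \<longleftrightarrow> pw_deriv u v \<and> u \<in> L2 \<and> v \<in> L2"

lemma sobolev_pair_weak_derivative:
  assumes "sobolev_pair u v"
  shows "has_weak_derivative u v"
  unfolding has_weak_derivative_def
proof (intro allI impI)
  fix \<phi> assume "test_function \<phi>"
  then obtain R where \<phi>: "pw_deriv \<phi> (deriv \<phi>)" "\<phi> \<in> borel_measurable borel" "deriv \<phi> \<in> borel_measurable borel"
    "(\<lambda>x. complex_of_real (\<phi> x)) \<in> L2" "(\<lambda>x. complex_of_real (deriv \<phi> x)) \<in> L2" "\<And>x. \<bar>x\<bar> > R \<Longrightarrow> \<phi> x = 0"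
    using test_functionE by blast
  have u: "pw_deriv u v" "u \<in> L2" "v \<in> L2" using assms by (auto simp: sobolev_pair_def)
  from pw_deriv_bilinear[OF bounded_bilinear_scaleR \<phi>(1) u(1)]
  have pw: "pw_deriv (\<lambda>x. \<phi> x *\<^sub>R u x) (\<lambda>x. \<phi> x *\<^sub>R v x + deriv \<phi> x *\<^sub>R u x)" .
  have I: "integrable lborel (\<lambda>x. \<phi> x *\<^sub>R v x)" "integrable lborel (\<lambda>x. deriv \<phi> x *\<^sub>R u x)"
    by (rule integrable_scaleR_L2 \<phi> u)+
  have "integral\<^sup>L lborel (\<lambda>x. \<phi> x *\<^sub>R v x + deriv \<phi> x *\<^sub>R u x) = 0 - 0"
  proof (rule pw_deriv_integral_whole[OF pw])
    show "((\<lambda>x. \<phi> x *\<^sub>R u x) \<longlongrightarrow> 0) at_top"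
      using eventually_gt_at_top[of "\<bar>R\<bar>"] by (intro tendsto_eventually, elim eventually_mono) (simp add: \<phi>(6))
    show "((\<lambda>x. \<phi> x *\<^sub>R u x) \<longlongrightarrow> 0) at_bot"
      using eventually_gt_at_bot[of "- \<bar>R\<bar>"] by (intro tendsto_eventually, elim eventually_mono) (simp add: \<phi>(6))
  qed (use I in auto)
  then have "(LINT x|lborel. \<phi> x *\<^sub>R v x) + (LINT x|lborel. deriv \<phi> x *\<^sub>R u x) = 0"
    by (simp add: I)
  then show "(LINT x|lborel. deriv \<phi> x *\<^sub>R u x) = - (LINT x|lborel. \<phi> x *\<^sub>R v x)"
    by (simp add: eq_neg_iff_add_eq_0 add.commute)
qed

lemma DERIV_max0_power2: "((\<lambda>y::real. (max 0 y)\<^sup>2) has_real_derivative 2 * max 0 y) (at y)"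
proof (cases y "0::real" rule: linorder_cases)
  case less
  have "((\<lambda>_. 0) has_real_derivative 0) (at y)" by simp
  from has_field_derivative_transform_within_open[OF this, of "{..<0}" "\<lambda>y. (max 0 y)\<^sup>2"] less
  show ?thesis by (simp add: max_def)
next
  case greater
  have "((\<lambda>y. y\<^sup>2) has_real_derivative 2 * y) (at y)" by (auto intro!: derivative_eq_intros)
  from has_field_derivative_transform_within_open[OF this, of "{0<..}" "\<lambda>y. (max 0 y)\<^sup>2"] greater
  show ?thesis by (simp add: max_def)
next
  case equal
  have "(\<lambda>h::real. ((max 0 (0 + h))\<^sup>2 - (max 0 0)\<^sup>2) / h) \<midarrow>0\<rightarrow> 0"
  proof (rule Lim_null_comparison)
    show "\<forall>\<^sub>F h in at (0::real). norm (((max 0 (0 + h))\<^sup>2 - (max 0 0)\<^sup>2) / h) \<le> \<bar>h\<bar>"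
      by (intro always_eventually) (auto simp: max_def power2_eq_square)
    show "(\<lambda>h::real. \<bar>h\<bar>) \<midarrow>0\<rightarrow> 0" by (auto intro!: tendsto_eq_intros)
  qed
  then show ?thesis using equal by (simp add: DERIV_def)
qed

text \<open>A test function approximating the indicator of the open interval from \<open>a\<close>
  to \<open>b\<close>: the square of a positive part is continuously differentiable, and p / (1 + p)
  tends to 1 where p grows with \<open>k\<close> and stays 0 where p does.\<close>

definition bump :: "real \<Rightarrow> real \<Rightarrow> real \<Rightarrow> real \<Rightarrow> real" where
  "bump a b k x = (let p = (max 0 (k * ((x - a) * (b - x))))\<^sup>2 in p / (1 + p))"

lemma bump_bounds: "0 \<le> bump a b k x" "bump a b k x \<le> 1"
  by (simp_all add: bump_def Let_def divide_le_eq_1 add_pos_nonneg)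

lemma bump_outside: "0 \<le> k \<Longrightarrow> a < b \<Longrightarrow> x \<notin> {a<..<b} \<Longrightarrow> bump a b k x = 0"
proof -
  assume "0 \<le> k" "a < b" "x \<notin> {a<..<b}"
  then have "(x - a) * (b - x) \<le> 0" by (cases "x \<le> a") (auto simp: mult_le_0_iff)
  then have "k * ((x - a) * (b - x)) \<le> 0" using \<open>0 \<le> k\<close> by (rule mult_nonneg_nonpos[rotated])
  then show ?thesis by (simp add: bump_def max_def)
qed

lemma bump_test_function:
  assumes "0 \<le> k" "a < b" shows "test_function (bump a b k)"
  unfolding test_function_def
proof
  let ?q = "\<lambda>x. k * ((x - a) * (b - x))"
  let ?D = "\<lambda>x. (2 * max 0 (?q x) * (k * ((b - x) - (x - a)))) / (1 + (max 0 (?q x))\<^sup>2)\<^sup>2"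
  have "(bump a b k has_real_derivative ?D x) (at x)" for x
  proof -
    have "(?q has_real_derivative k * ((b - x) - (x - a))) (at x)"
      by (auto intro!: derivative_eq_intros simp: algebra_simps)
    from DERIV_chain2[OF DERIV_max0_power2 this]
    have p: "((\<lambda>x. (max 0 (?q x))\<^sup>2) has_real_derivative 2 * max 0 (?q x) * (k * ((b - x) - (x - a)))) (at x)" .
    have pos: "1 + (max 0 (?q x))\<^sup>2 \<noteq> 0" by (simp add: add_nonneg_eq_0_iff)
    show ?thesis
      unfolding bump_def[abs_def] Let_def
      by (rule derivative_eq_intros p refl pos)+ (use pos in \<open>simp add: field_simps power2_eq_square\<close>)
  qed
  moreover have "continuous_on UNIV ?D"
  proof (intro continuous_intros ballI)
    show "(1 + (max 0 (?q x))\<^sup>2)\<^sup>2 \<noteq> 0" for x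
      using zero_le_power2[of "max 0 (?q x)"] by (simp add: add_nonneg_eq_0_iff)
  qed
  ultimately show "bump a b k C1_differentiable_on UNIV"
    unfolding C1_differentiable_on_def
    by (intro exI[of _ ?D]) (simp add: has_real_derivative_iff_has_vector_derivative)
  have "{x. bump a b k x \<noteq> 0} \<subseteq> {a<..<b}" using bump_outside[OF assms] by blast
  then have "bounded {x. bump a b k x \<noteq> 0}" by (rule bounded_subset[rotated]) (rule bounded_Ioo)
  then show "compact (closure {x. bump a b k x \<noteq> 0})" by (simp add: compact_closure)
qed

lemma bump_tendsto: "a < b \<Longrightarrow> (\<lambda>n. bump a b (real n) x) \<longlonglongrightarrow> indicator {a<..<b} x"
proof (cases "x \<in> {a<..<b}")
  case True
  define y where "y = (x - a) * (b - x)"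
  have y: "y > 0" using True by (simp add: y_def)
  have "bump a b (real n) x = 1 - 1 / (1 + (real n * y)\<^sup>2)" for n
  proof -
    have *: "1 + (real n * y)\<^sup>2 > 0" by (simp add: add_pos_nonneg)
    have "max 0 (real n * y) = real n * y" using y by simp
    then show ?thesis using *
      unfolding bump_def y_def[symmetric] Let_def by (simp only:) (simp add: field_simps)
  qed
  moreover have "filterlim (\<lambda>n. 1 + (real n * y)\<^sup>2) at_infinity sequentially"
  proof (rule filterlim_at_top_imp_at_infinity, rule filterlim_tendsto_add_at_top[OF tendsto_const])
    have "filterlim (\<lambda>n. real n * y) at_top sequentially"
      by (rule filterlim_at_top_mult_tendsto_pos[OF tendsto_const y filterlim_real_sequentially])
    then show "filterlim (\<lambda>n. (real n * y)\<^sup>2) at_top sequentially"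
      by (rule filterlim_pow_at_top[rotated]) simp
  qed
  then have "(\<lambda>n. 1 - 1 / (1 + (real n * y)\<^sup>2)) \<longlonglongrightarrow> 1 - 0"
    by (intro tendsto_diff tendsto_const tendsto_divide_0[OF tendsto_const])
  ultimately show ?thesis using True by simp
qed (simp add: bump_outside)

lemma L2_indicator: "(\<lambda>x. complex_of_real (indicator {a..b} x)) \<in> L2"
  by (rule L2_compact_support[of _ 1 "max \<bar>a\<bar> \<bar>b\<bar>"]) (auto split: split_indicator)

lemma L2_set_integrable:
  assumes "g \<in> L2" shows "set_integrable lborel {a..b} g"
  unfolding set_integrable_def by (rule integrable_scaleR_L2[OF L2_indicator assms]) simp

text \<open>On each window from -n to n, the Borel sets over which \<open>g\<close> integrates to 0
  form a Dynkin system containing the half lines, which are stable under intersection; hence they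
  are all Borel sets, and \<open>g\<close> vanishes almost everywhere on the window. Countably many
  windows cover the line.\<close>

lemma vanishing_on_intervals:
  fixes g :: "real \<Rightarrow> complex"
  assumes int: "\<And>a b. set_integrable lborel {a..b} g" and zero: "\<And>a b. a < b \<Longrightarrow> (LINT x:{a..b}|lborel. g x) = 0"
  shows "AE x in lborel. g x = 0"
proof -
  have "AE x in lborel. indicator {- real n..real n} x *\<^sub>R g x = 0" for n
  proof (rule sigma_finite_measure.density_zero[OF sigma_finite_lborel])
    let ?h = "\<lambda>x. indicator {- real n..real n} x *\<^sub>R g x"
    show I: "integrable lborel ?h"
      using int unfolding set_integrable_def .
    have IA: "integrable lborel (\<lambda>x. indicator A x *\<^sub>R ?h x)" if "A \<in> sets borel" for A
      using that by (intro integrable_mult_indicator[OF _ I]) simp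
    have whole: "integral\<^sup>L lborel ?h = 0"
    proof (cases "n = 0")
      case True
      have "AE x in lborel. ?h x = 0"
        using AE_lborel_singleton[of 0] by eventually_elim (simp add: True)
      then show ?thesis by (rule integral_eq_zero_AE)
    next
      case False
      then show ?thesis using zero[of "- real n" "real n"] by (simp add: set_lebesgue_integral_def)
    qed
    have borel: "sets (borel :: real measure) = sigma_sets UNIV (range atMost)"
      by (subst borel_eq_atMost) simp
    fix A :: "real set" assume "A \<in> sets lborel"
    then have "A \<in> sigma_sets UNIV (range atMost :: real set set)"
      by (simp add: borel)
    have "Int_stable (range atMost :: real set set)" by (auto simp: Int_stable_def)
    from this subset_UNIV[of "range atMost", folded Pow_UNIV] \<open>A \<in> sigma_sets UNIV (range atMost)\<close>
    have "(LINT x|lborel. indicator A x *\<^sub>R ?h x) = 0"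
    proof (induction rule: sigma_sets_induct_disjoint)
      case (basic A)
      then obtain c where A: "A = {..c}" by auto
      show ?case
      proof (cases "- real n < min c (real n)")
        case True
        have "(\<lambda>x. indicator A x *\<^sub>R ?h x) = (\<lambda>x. indicator {- real n..min c (real n)} x *\<^sub>R g x)"
          by (auto simp: A indicator_def)
        then show ?thesis using zero[OF True] by (simp add: set_lebesgue_integral_def)
      next
        \<comment> \<open>Here the half line meets the window at most in its left endpoint, a null
          set; this includes the degenerate window \<open>n = 0\<close>.\<close>
        case False
        then have "(\<lambda>x. indicator A x *\<^sub>R ?h x) = (\<lambda>x. if x = - real n then indicator A x *\<^sub>R ?h x else 0)"
          by (auto simp: A indicator_def)
        moreover have "AE x in lborel. (if x = - real n then indicator A x *\<^sub>R ?h x else 0) = 0"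
          using AE_lborel_singleton[of "- real n"] by eventually_elim auto
        ultimately show ?thesis by (simp only: integral_eq_zero_AE)
      qed
    next
      case (compl A)
      have A: "A \<in> sets borel" using compl(1) by (simp add: borel)
      have "(LINT x|lborel. indicator (UNIV - A) x *\<^sub>R ?h x) = (LINT x|lborel. ?h x - indicator A x *\<^sub>R ?h x)"
        by (rule Bochner_Integration.integral_cong) (auto split: split_indicator)
      also have "\<dots> = 0" using I IA[OF A] compl(2) whole by simp
      finally show ?case .
    next
      case (union A)
      have A: "A i \<in> sets borel" for i using union(2) by (auto simp: borel)
      have "(LINT x:(\<Union>i. A i)|lborel. ?h x) = (\<Sum>i. (LINT x:A i|lborel. ?h x))"
      proof (rule lebesgue_integral_countable_add)
        show "set_integrable lborel (\<Union>i. A i) ?h"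
          unfolding set_integrable_def by (rule IA) (use A in auto)
      qed (use A union(1) in \<open>auto simp: disjoint_family_on_def\<close>)
      then show ?case using union(3) by (simp add: set_lebesgue_integral_def)
    qed auto
    then show "(LINT x:A|lborel. ?h x) = 0" by (simp add: set_lebesgue_integral_def)
  qed
  then have "AE x in lborel. \<forall>n. indicator {- real n..real n} x *\<^sub>R g x = 0"
    unfolding AE_all_countable by blast
  then show ?thesis
  proof eventually_elim
    case (elim x)
    obtain n where "\<bar>x\<bar> \<le> real n" using real_arch_simple by blast
    then show ?case using elim[rule_format, of n] by (auto simp: indicator_def abs_le_iff split: if_splits)
  qed
qed

text \<open>The functions \<open>bump\<close> converge boundedly to indicators of intervals. Testing
  with them shows that the difference of the two weak derivatives integrates to 0 over every bounded
  interval.\<close>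

lemma weak_derivative_unique:
  assumes "has_weak_derivative f g1" "has_weak_derivative f g2" "g1 \<in> L2" "g2 \<in> L2"
  shows "AE x in lborel. g1 x = g2 x"
proof -
  define g where "g x = g1 x - g2 x" for x
  have g: "g \<in> L2" unfolding g_def[abs_def] using assms(3,4) by auto
  then have [measurable]: "g \<in> borel_measurable borel" by measurable
  have bump_m [measurable]: "bump a b (real n) \<in> borel_measurable borel" for a b n
    unfolding bump_def Let_def by measurable
  have "(LINT x:{a..b}|lborel. g x) = 0" if "a < b" for a b
  proof -
    have L: "(\<lambda>x. complex_of_real (bump a b (real n) x)) \<in> L2" for n
    proof (rule L2_compact_support[of _ 1 "max \<bar>a\<bar> \<bar>b\<bar>"])
      fix x assume "max \<bar>a\<bar> \<bar>b\<bar> < \<bar>x\<bar>"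
      then have "x \<notin> {a<..<b}" by auto
      then show "bump a b (real n) x = 0" by (intro bump_outside that) auto
    qed (use bump_bounds in auto)
    have z: "(LINT x|lborel. bump a b (real n) x *\<^sub>R g x) = 0" for n
    proof -
      have "(LINT x|lborel. bump a b (real n) x *\<^sub>R g1 x) = (LINT x|lborel. bump a b (real n) x *\<^sub>R g2 x)"
        using assms(1)[unfolded has_weak_derivative_def, rule_format, OF bump_test_function[OF of_nat_0_le_iff that]]
          assms(2)[unfolded has_weak_derivative_def, rule_format, OF bump_test_function[OF of_nat_0_le_iff that]]
        by (metis (mono_tags) minus_equation_iff)
      then show ?thesis
        unfolding g_def scaleR_diff_right
        using integrable_scaleR_L2[OF L assms(3) bump_m] integrable_scaleR_L2[OF L assms(4) bump_m] by simp
    qed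
    have l: "(\<lambda>n. LINT x|lborel. bump a b (real n) x *\<^sub>R g x) \<longlonglongrightarrow> (LINT x|lborel. indicator {a<..<b} x *\<^sub>R g x)"
    proof (rule integral_dominated_convergence[where w = "\<lambda>x. norm (indicator {a..b} x *\<^sub>R g x)"])
      show "integrable lborel (\<lambda>x. norm (indicator {a..b} x *\<^sub>R g x))"
        using L2_set_integrable[OF g] unfolding set_integrable_def by (intro integrable_norm)
      show "AE x in lborel. (\<lambda>n. bump a b (real n) x *\<^sub>R g x) \<longlonglongrightarrow> indicator {a<..<b} x *\<^sub>R g x"
        by (intro AE_I2 tendsto_intros bump_tendsto that)
      show "AE x in lborel. norm (bump a b (real n) x *\<^sub>R g x) \<le> norm (indicator {a..b} x *\<^sub>R g x)" for n
        using bump_bounds[of a b "real n"] bump_outside[of "real n" a b] that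
        by (intro AE_I2) (auto simp: indicator_def intro!: mult_left_le_one_le)
    qed simp_all
    have "(LINT x|lborel. indicator {a<..<b} x *\<^sub>R g x) = 0"
      using LIMSEQ_unique[OF l[unfolded z] tendsto_const] .
    moreover have "(LINT x|lborel. indicator {a..b} x *\<^sub>R g x) = (LINT x|lborel. indicator {a<..<b} x *\<^sub>R g x)"
    proof (rule integral_cong_AE)
      show "AE x in lborel. indicator {a..b} x *\<^sub>R g x = indicator {a<..<b} x *\<^sub>R g x"
        using AE_lborel_singleton[of a] AE_lborel_singleton[of b]
        by eventually_elim (auto simp: indicator_def)
    qed simp_all
    ultimately show ?thesis by (simp add: set_lebesgue_integral_def)
  qed
  from vanishing_on_intervals[OF L2_set_integrable[OF g] this]
  show ?thesis by (simp add: g_def)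
qed

text \<open>The weak derivative inside \<open>h1_norm\<close> is a Hilbert choice; uniqueness up to
  null sets lets the explicit derivative replace it.\<close>

lemma h1_norm_sobolev_pair:
  assumes "sobolev_pair u v"
  shows "h1_norm u = sqrt (l2sq u + l2sq v)"
proof -
  have uv: "u \<in> L2" "v \<in> L2" "has_weak_derivative u v"
    using assms sobolev_pair_weak_derivative by (auto simp: sobolev_pair_def)
  have "weak_derivative u \<in> L2 \<and> has_weak_derivative u (weak_derivative u)"
    unfolding weak_derivative_def by (rule someI[of _ v]) (use uv in auto)
  then have w: "weak_derivative u \<in> L2" and "AE x in lborel. weak_derivative u x = v x"
    using weak_derivative_unique uv by blast+
  then have "l2sq (weak_derivative u) = l2sq v"
    unfolding l2sq_def using uv(2)
    by (intro integral_cong_AE) (auto elim!: eventually_mono)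
  moreover have "(LINT x|lborel. (norm (u x))\<^sup>2 + (norm (weak_derivative u x))\<^sup>2) = l2sq u + l2sq (weak_derivative u)"
    unfolding l2sq_def using L2_integrable[OF uv(1)] L2_integrable[OF w] by simp
  ultimately show ?thesis by (simp add: h1_norm_def)
qed

section \<open>The factorised energy\<close>

lemma has_vector_derivative_set_integral_Iic:
  fixes f :: "real \<Rightarrow> real"
  assumes c: "continuous_on UNIV f" and I: "integrable lborel f"
  shows "((\<lambda>x. LINT y:{..x}|lborel. f y) has_vector_derivative f x) (at x)"
proof -
  note SI = set_integrable_lborel[OF I]
  have eq: "(LINT y:{..z}|lborel. f y) = (LINT y:{..<x - 1}|lborel. f y) + integral {x - 1..z} f" if "x - 1 < z" for z
  proof -
    have "{..z} = {..<x - 1} \<union> {x - 1..z}" using that by auto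
    then have "(LINT y:{..z}|lborel. f y) = (LINT y:{..<x - 1}|lborel. f y) + (LINT y:{x - 1..z}|lborel. f y)"
      by (simp only:) (rule set_integral_Un, auto intro: SI)
    then show ?thesis using set_borel_integral_eq_integral(2)[OF SI[of "{x - 1..z}"]] by simp
  qed
  have "((\<lambda>z. integral {x - 1..z} f) has_vector_derivative f x) (at x within {x - 1..x + 1})"
    by (rule integral_has_vector_derivative) (auto intro: continuous_on_subset[OF c])
  moreover have "at x within {x - 1..x + 1} = at x" by (rule at_within_interior) simp
  ultimately have "((\<lambda>z. (LINT y:{..<x - 1}|lborel. f y) + integral {x - 1..z} f) has_vector_derivative 0 + f x) (at x)"
    by (intro has_vector_derivative_add has_vector_derivative_const) simp
  then have A: "((\<lambda>z. (LINT y:{..<x - 1}|lborel. f y) + integral {x - 1..z} f) has_vector_derivative f x) (at x)"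
    by simp
  show ?thesis
    by (rule has_vector_derivative_transform_within_open[OF A, where S = "{x - 1<..}"]) (auto simp: eq)
qed

lemma tendsto_set_integral_Iic:
  fixes f :: "real \<Rightarrow> real"
  assumes "integrable lborel f"
  shows "((\<lambda>x. LINT y:{..x}|lborel. f y) \<longlongrightarrow> integral\<^sup>L lborel f) at_top"
    and "((\<lambda>x. LINT y:{..x}|lborel. f y) \<longlongrightarrow> 0) at_bot"
proof -
  show "((\<lambda>x. LINT y:{..x}|lborel. f y) \<longlongrightarrow> integral\<^sup>L lborel f) at_top"
    unfolding set_lebesgue_integral_def by (rule tendsto_integral_at_top[OF _ assms]) simp
  have "(LINT y:{..- x}|lborel. f y) = (LINT y:{x..}|lborel. f (- y))" for x
    unfolding set_lebesgue_integral_def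
    by (subst integral_reflect_lborel[symmetric], rule Bochner_Integration.integral_cong) (auto simp: indicator_def)
  then show "((\<lambda>x. LINT y:{..x}|lborel. f y) \<longlongrightarrow> 0) at_bot"
    using tendsto_set_integral_tail[OF integrable_reflect[OF assms]] by (simp add: filterlim_at_bot_mirror)
qed

text \<open>Subtracting half the mass makes the limits at the two ends opposite. For even
  \<open>u\<close> the function is then odd, so its value at the origin is known.\<close>

definition mass_fn :: "(real \<Rightarrow> complex) \<Rightarrow> real \<Rightarrow> real" where
  "mass_fn u x = (LINT y:{..x}|lborel. (norm (u y))\<^sup>2) - l2sq u / 2"

text \<open>The energy of a function exceeds that of the soliton of the same mass by the squared norm of its defect,
  see \<open>l2sq_defect\<close>; solitons have defect \<open>0\<close>.\<close>

definition defect :: "(real \<Rightarrow> complex) \<Rightarrow> (real \<Rightarrow> complex) \<Rightarrow> real \<Rightarrow> complex" where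
  "defect u v x = v x + complex_of_real (mass_fn u x / 2) * u x"

context
  fixes u v assumes uv: "sobolev_pair u v"
begin

lemma sobolev_pairD: "pw_deriv u v" "u \<in> L2" "v \<in> L2" "continuous_on A u"
  using uv by (auto simp: sobolev_pair_def intro: pw_deriv_continuous)

lemma pw_deriv_density: "pw_deriv (\<lambda>x. (norm (u x))\<^sup>2) (\<lambda>x. 2 * inner (u x) (v x))"
  using pw_deriv_bilinear[OF bounded_bilinear_inner sobolev_pairD(1,1)]
  by (simp add: power2_norm_eq_inner inner_commute)

lemma integrable_inner_L2:
  assumes "f \<in> L2" "g \<in> L2" shows "integrable lborel (\<lambda>x. inner (f x) (g x))"
proof -
  have [measurable]: "f \<in> borel_measurable borel" "g \<in> borel_measurable borel" using assms by measurable
  show ?thesis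
    by (rule integrable_L2_mult[OF assms, of _ 1]) (auto intro: Cauchy_Schwarz_ineq2)
qed

lemma integrable_density: "integrable lborel (\<lambda>x. (norm (u x))\<^sup>2)"
  and integrable_density': "integrable lborel (\<lambda>x. 2 * inner (u x) (v x))"
  using L2_integrable sobolev_pairD integrable_inner_L2 by auto

lemma density_tendsto: "((\<lambda>x. (norm (u x))\<^sup>2) \<longlongrightarrow> 0) at_top" "((\<lambda>x. (norm (u x))\<^sup>2) \<longlongrightarrow> 0) at_bot"
  by (rule pw_deriv_vanish_at_top[OF pw_deriv_density integrable_density' integrable_density]
      pw_deriv_vanish_at_bot[OF pw_deriv_density integrable_density' integrable_density])+

lemma integral_inner_le:
  assumes "f \<in> L2" "g \<in> L2"
  shows "(LINT x|lborel. norm (2 * inner (f x) (g x))) \<le> 2 * (sqrt (l2sq f) * sqrt (l2sq g))"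
proof -
  have [measurable]: "f \<in> borel_measurable borel" "g \<in> borel_measurable borel" using assms by measurable
  have "(LINT x|lborel. norm (2 * inner (f x) (g x))) \<le> (LINT x|lborel. 2 * (norm (f x) * norm (g x)))"
  proof (rule integral_mono)
    show "integrable lborel (\<lambda>x. norm (2 * inner (f x) (g x)))"
      using integrable_inner_L2[OF assms] by (intro integrable_norm) simp
    show "integrable lborel (\<lambda>x. 2 * (norm (f x) * norm (g x)))"
      by (rule integrable_L2_mult[OF assms, of _ 2]) auto
    show "norm (2 * inner (f x) (g x)) \<le> 2 * (norm (f x) * norm (g x))" for x
      using Cauchy_Schwarz_ineq2[of "f x" "g x"] by (simp add: abs_mult)
  qed
  also have "\<dots> \<le> 2 * (sqrt (l2sq f) * sqrt (l2sq g))"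
    using L2_cauchy_schwarz[OF assms] by simp
  finally show ?thesis .
qed

text \<open>Agmon's inequality up to a constant: the density vanishes at infinity, and its
  derivative has integral norm at most the right-hand side by Cauchy-Schwarz.\<close>

lemma density_le: "(norm (u x))\<^sup>2 \<le> 2 * (sqrt (l2sq u) * sqrt (l2sq v))"
proof -
  have "((\<lambda>y. norm ((norm (u x))\<^sup>2 - (norm (u y))\<^sup>2)) \<longlongrightarrow> norm ((norm (u x))\<^sup>2 - 0)) at_top"
    by (intro tendsto_intros density_tendsto)
  moreover have "norm ((norm (u x))\<^sup>2 - (norm (u y))\<^sup>2) \<le> 2 * (sqrt (l2sq u) * sqrt (l2sq v))" for y
    using pw_deriv_increment_le[OF pw_deriv_density integrable_density', of UNIV y x]
      integral_inner_le[OF sobolev_pairD(2,3)] by (simp add: set_lebesgue_integral_def)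
  ultimately have "norm ((norm (u x))\<^sup>2 - 0) \<le> 2 * (sqrt (l2sq u) * sqrt (l2sq v))"
    by (intro tendsto_upperbound[OF _ always_eventually]) auto
  then show ?thesis by simp
qed

lemma mass_fn_deriv: "(mass_fn u has_vector_derivative (norm (u x))\<^sup>2) (at x)"
proof -
  have "continuous_on UNIV (\<lambda>x. (norm (u x))\<^sup>2)" by (intro continuous_intros sobolev_pairD)
  from has_vector_derivative_diff[OF has_vector_derivative_set_integral_Iic[OF this integrable_density] has_vector_derivative_const]
  show ?thesis unfolding mass_fn_def[abs_def] by simp
qed

lemma mass_fn_pw: "pw_deriv (mass_fn u) (\<lambda>x. (norm (u x))\<^sup>2)"
  by (rule pw_derivI[OF mass_fn_deriv])

lemma mass_fn_measurable [measurable]: "mass_fn u \<in> borel_measurable borel"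
  by (rule borel_measurable_continuous_onI[OF pw_deriv_continuous[OF mass_fn_pw]])

lemma mass_fn_tendsto: "(mass_fn u \<longlongrightarrow> l2sq u / 2) at_top" "(mass_fn u \<longlongrightarrow> - (l2sq u / 2)) at_bot"
proof -
  note lim = tendsto_set_integral_Iic[OF integrable_density]
  have "((\<lambda>x. (LINT y:{..x}|lborel. (norm (u y))\<^sup>2) - l2sq u / 2) \<longlongrightarrow> l2sq u - l2sq u / 2) at_top"
    using lim(1) by (intro tendsto_diff tendsto_const) (simp add: l2sq_def)
  then show "(mass_fn u \<longlongrightarrow> l2sq u / 2) at_top" by (simp add: mass_fn_def[abs_def])
  have "((\<lambda>x. (LINT y:{..x}|lborel. (norm (u y))\<^sup>2) - l2sq u / 2) \<longlongrightarrow> 0 - l2sq u / 2) at_bot"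
    by (intro tendsto_diff tendsto_const lim)
  then show "(mass_fn u \<longlongrightarrow> - (l2sq u / 2)) at_bot" by (simp add: mass_fn_def[abs_def])
qed

lemma mass_fn_mono: "x \<le> y \<Longrightarrow> mass_fn u x \<le> mass_fn u y"
  by (rule DERIV_nonneg_imp_nondecreasing)
     (use mass_fn_deriv in \<open>auto simp: has_real_derivative_iff_has_vector_derivative intro!: exI\<close>)

lemma mass_fn_bound: "\<bar>mass_fn u x\<bar> \<le> l2sq u / 2"
proof -
  have "mass_fn u x \<le> l2sq u / 2"
    by (rule tendsto_lowerbound[OF mass_fn_tendsto(1)])
       (auto intro!: eventually_mono[OF eventually_ge_at_top[of x]] mass_fn_mono)
  moreover have "- (l2sq u / 2) \<le> mass_fn u x"
    by (rule tendsto_upperbound[OF mass_fn_tendsto(2)])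
       (auto intro!: eventually_mono[OF eventually_le_at_bot[of x]] mass_fn_mono)
  ultimately show ?thesis by (simp add: abs_le_iff)
qed

lemma defect_L2: "defect u v \<in> L2"
proof -
  have "(\<lambda>x. complex_of_real (mass_fn u x / 2) * u x) \<in> L2"
    by (rule L2_mult_bounded(1)[OF sobolev_pairD(2), of _ "l2sq u / 4"]) (use mass_fn_bound in \<open>auto simp: mult.commute\<close>)
  then show ?thesis unfolding defect_def[abs_def] using sobolev_pairD(3) by (intro L2_add)
qed

lemma integrable_bounded_mult:
  assumes "integrable lborel f" "k \<in> borel_measurable borel" "\<And>x. \<bar>k x\<bar> \<le> c"
  shows "integrable lborel (\<lambda>x. k x * f x :: real)"
proof (rule Bochner_Integration.integrable_bound)
  show "integrable lborel (\<lambda>x. c * f x)" using assms by simp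
  show "(\<lambda>x. k x * f x) \<in> borel_measurable lborel" using assms by measurable
  show "AE x in lborel. norm (k x * f x) \<le> norm (c * f x)"
    using order_trans[OF assms(3) abs_ge_self] by (auto simp: abs_mult intro!: mult_right_mono)
qed

theorem l2sq_defect: "l2sq (defect u v) = l2sq v - (LINT x|lborel. (norm (u x)) ^ 4) / 2 + (l2sq u) ^ 3 / 48"
proof -
  define M where "M = mass_fn u"
  define r where "r x = (norm (u x))\<^sup>2" for x
  have [measurable]: "u \<in> borel_measurable borel" "v \<in> borel_measurable borel" "M \<in> borel_measurable borel"
    using sobolev_pairD mass_fn_measurable unfolding M_def by measurable
  have M: "pw_deriv M r" unfolding M_def r_def[abs_def] by (rule mass_fn_pw)
  have rd: "pw_deriv r (\<lambda>x. 2 * inner (u x) (v x))" unfolding r_def[abs_def] by (rule pw_deriv_density)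
  have Ir: "integrable lborel r" and Ir': "integrable lborel (\<lambda>x. 2 * inner (u x) (v x))"
    unfolding r_def[abs_def] by (rule integrable_density integrable_density')+
  have Mb: "\<bar>M x\<bar> \<le> l2sq u / 2" for x unfolding M_def by (rule mass_fn_bound)
  have [measurable]: "r \<in> borel_measurable borel" using Ir by auto
  have I4: "integrable lborel (\<lambda>x. r x * r x)"
    by (rule integrable_bounded_mult[OF Ir, of _ "2 * (sqrt (l2sq u) * sqrt (l2sq v))"])
       (use density_le in \<open>auto simp: r_def\<close>)
  have r4: "r x * r x = (norm (u x)) ^ 4" for x by (simp add: r_def power_mult[symmetric] flip: power_add)
  have IM: "integrable lborel (\<lambda>x. M x * (2 * inner (u x) (v x)))"
    by (rule integrable_bounded_mult[OF Ir' _ Mb]) simp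
  have IMM: "integrable lborel (\<lambda>x. (M x)\<^sup>2 * r x)"
    by (rule integrable_bounded_mult[OF Ir, of _ "(l2sq u / 2)\<^sup>2"])
       (use power_mono[OF Mb abs_ge_zero, where n = 2] in auto)
  have rlim: "(r \<longlongrightarrow> 0) at_top" "(r \<longlongrightarrow> 0) at_bot" unfolding r_def[abs_def] by (rule density_tendsto)+
  have Mlim: "(M \<longlongrightarrow> l2sq u / 2) at_top" "(M \<longlongrightarrow> - (l2sq u / 2)) at_bot"
    unfolding M_def by (rule mass_fn_tendsto)+
  \<comment> \<open>The product of \<open>M\<close> and \<open>r\<close> vanishes at both ends,
    since \<open>r\<close> tends to 0 and \<open>M\<close> stays bounded.\<close>
  have "integral\<^sup>L lborel (\<lambda>x. M x * (2 * inner (u x) (v x)) + r x * r x) = l2sq u / 2 * 0 - (- (l2sq u / 2)) * 0"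
    by (rule pw_deriv_integral_whole[OF pw_deriv_bilinear[OF bounded_bilinear_mult M rd] _
          tendsto_mult[OF Mlim(1) rlim(1)] tendsto_mult[OF Mlim(2) rlim(2)]]) (use IM I4 in auto)
  then have 1: "(LINT x|lborel. M x * (2 * inner (u x) (v x))) = - (LINT x|lborel. r x * r x)"
    using IM I4 by simp
  have "pw_deriv (\<lambda>x. (M x) ^ 3 / 3) (\<lambda>x. (M x)\<^sup>2 * r x)"
  proof (rule pw_derivI_real)
    fix x
    have "(M has_real_derivative r x) (at x)"
      using mass_fn_deriv[of x] by (simp add: M_def r_def has_real_derivative_iff_has_vector_derivative)
    then show "((\<lambda>x. (M x) ^ 3 / 3) has_real_derivative (M x)\<^sup>2 * r x) (at x)"
      by (auto intro!: derivative_eq_intros simp: power2_eq_square)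
  qed
  \<comment> \<open>Each end contributes (m / 2)^3 / 3. The sum m^3 / 12, times the factor 1/4 from
    the square of half the mass function, is the m^3 / 48 of the statement.\<close>
  from pw_deriv_integral_whole[OF this IMM tendsto_divide[OF tendsto_power[OF Mlim(1)] tendsto_const]
      tendsto_divide[OF tendsto_power[OF Mlim(2)] tendsto_const]]
  have 2: "(LINT x|lborel. (M x)\<^sup>2 * r x) = (l2sq u) ^ 3 / 12"
    by (simp add: power_divide field_simps)
  have "l2sq (defect u v) = (LINT x|lborel. (norm (v x))\<^sup>2 + (1/2) * (M x * (2 * inner (u x) (v x))) + (1/4) * ((M x)\<^sup>2 * r x))"
    unfolding l2sq_def
  proof (rule Bochner_Integration.integral_cong)
    fix x
    have "complex_of_real (mass_fn u x / 2) * u x = (M x / 2) *\<^sub>R u x"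
      by (simp add: scaleR_conv_of_real M_def)
    then have "(norm (defect u v x))\<^sup>2 = (norm (v x))\<^sup>2 + 2 * inner (v x) ((M x / 2) *\<^sub>R u x) + (norm ((M x / 2) *\<^sub>R u x))\<^sup>2"
      unfolding defect_def by (simp only: power2_norm_eq_inner inner_add_left inner_add_right inner_commute)
    also have "\<dots> = (norm (v x))\<^sup>2 + (1/2) * (M x * (2 * inner (u x) (v x))) + (1/4) * ((M x)\<^sup>2 * r x)"
      by (simp add: inner_commute r_def power_mult_distrib power_divide)
    finally show "(norm (defect u v x))\<^sup>2 = (norm (v x))\<^sup>2 + (1/2) * (M x * (2 * inner (u x) (v x))) + (1/4) * ((M x)\<^sup>2 * r x)" .
  qed simp
  also have "\<dots> = l2sq v + (1/2) * (LINT x|lborel. M x * (2 * inner (u x) (v x))) + (1/4) * (LINT x|lborel. (M x)\<^sup>2 * r x)"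
    by (simp only: Bochner_Integration.integral_add Bochner_Integration.integrable_add integrable_mult_right
        integral_mult_right_zero l2sq_def L2_integrable[OF sobolev_pairD(3)] IM IMM)
  finally show "l2sq (defect u v) = l2sq v - (LINT x|lborel. (norm (u x)) ^ 4) / 2 + (l2sq u) ^ 3 / 48"
    unfolding 1 2 r4 by simp
qed

text \<open>The derivative of the sum of the first two terms is
  \<open>2 * inner (u x) (defect u v x)\<close>, whose integral norm Cauchy-Schwarz controls. The
  reference value is the limit at infinity, where the density is 0 and the mass function is half the
  mass.\<close>

lemma density_mass_bound:
  "\<bar>(norm (u x))\<^sup>2 + (mass_fn u x)\<^sup>2 / 2 - (l2sq u)\<^sup>2 / 8\<bar> \<le> 2 * (sqrt (l2sq u) * sqrt (l2sq (defect u v)))"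
proof -
  define G where "G x = (norm (u x))\<^sup>2 + (mass_fn u x)\<^sup>2 / 2" for x
  have M2: "pw_deriv (\<lambda>x. (mass_fn u x)\<^sup>2 / 2) (\<lambda>x. mass_fn u x * (norm (u x))\<^sup>2)"
    using mass_fn_deriv
    by (intro pw_derivI_real) (auto intro!: derivative_eq_intros simp: has_real_derivative_iff_has_vector_derivative[symmetric])
  have "2 * inner (u x) (v x) + mass_fn u x * (norm (u x))\<^sup>2 = 2 * inner (u x) (defect u v x)" for x
  proof -
    have "complex_of_real (mass_fn u x / 2) * u x = (mass_fn u x / 2) *\<^sub>R u x" by (simp add: scaleR_conv_of_real)
    then show ?thesis unfolding defect_def by (simp only: inner_add_right inner_scaleR_right power2_norm_eq_inner) simp
  qed
  with pw_deriv_add[OF pw_deriv_density M2]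
  have G: "pw_deriv G (\<lambda>x. 2 * inner (u x) (defect u v x))" unfolding G_def[abs_def] by simp
  have IG: "integrable lborel (\<lambda>x. 2 * inner (u x) (defect u v x))"
    using integrable_inner_L2[OF sobolev_pairD(2) defect_L2] by simp
  have "((\<lambda>y. norm (G x - G y)) \<longlongrightarrow> norm (G x - (0 + (l2sq u / 2)\<^sup>2 / 2))) at_top"
    unfolding G_def by (intro tendsto_intros density_tendsto mass_fn_tendsto) simp
  moreover have "norm (G x - G y) \<le> 2 * (sqrt (l2sq u) * sqrt (l2sq (defect u v)))" for y
    using pw_deriv_increment_le[OF G IG, of UNIV y x]
      integral_inner_le[OF sobolev_pairD(2) defect_L2] by (simp add: set_lebesgue_integral_def)
  ultimately have "norm (G x - (0 + (l2sq u / 2)\<^sup>2 / 2)) \<le> 2 * (sqrt (l2sq u) * sqrt (l2sq (defect u v)))"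
    by (intro tendsto_upperbound[OF _ always_eventually]) auto
  then show ?thesis by (simp add: G_def power_divide)
qed

text \<open>The sum of the values at x and -x has zero derivative because the density is even, and
  its limit at infinity is 0 thanks to the centring.\<close>

lemma mass_fn_odd:
  assumes even: "\<And>x. u (- x) = u x"
  shows "mass_fn u (- x) = - mass_fn u x"
proof -
  have "((\<lambda>x. mass_fn u x + mass_fn u (- x)) has_derivative (\<lambda>h. 0)) (at y)" for y
  proof -
    have "((mass_fn u \<circ> uminus) has_vector_derivative (- 1) *\<^sub>R (norm (u (- y)))\<^sup>2) (at y)"
      by (rule vector_diff_chain_at) (auto intro!: derivative_eq_intros mass_fn_deriv)
    from has_vector_derivative_add[OF mass_fn_deriv this] show ?thesis
      by (simp add: even o_def has_vector_derivative_def)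
  qed
  then have "\<exists>c. \<forall>y\<in>UNIV. mass_fn u y + mass_fn u (- y) = c"
    by (intro has_derivative_zero_constant) auto
  then obtain c where c: "\<And>y. mass_fn u y + mass_fn u (- y) = c" by auto
  have "((\<lambda>x. mass_fn u x + mass_fn u (- x)) \<longlongrightarrow> l2sq u / 2 + - (l2sq u / 2)) at_top"
    using mass_fn_tendsto by (intro tendsto_add) (simp_all add: filterlim_at_bot_mirror)
  then have "((\<lambda>x::real. c) \<longlongrightarrow> 0) at_top" by (simp add: c)
  then have "c = 0" by (simp add: tendsto_const_iff)
  then show ?thesis using c[of x] by simp
qed

end

section \<open>Stability of the soliton\<close>

text \<open>The centred mass function of the ground state: the antiderivative of
  \<open>(ground_state x)^2\<close> that vanishes at 0.\<close>

definition soliton_mass :: "real \<Rightarrow> real" where "soliton_mass x = tanh (x / 4) / 2"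

text \<open>The first integral of the profile, that is, the case of unit mass and zero defect in
  \<open>density_mass_bound\<close>.\<close>

lemma ground_state_power2: "(ground_state x)\<^sup>2 = 1 / 8 - (soliton_mass x)\<^sup>2 / 2"
proof -
  define c where "c = cosh (x / 4)"
  define q where "q = sinh (x / 4)"
  have cq: "c\<^sup>2 - q\<^sup>2 = 1" unfolding c_def q_def by (rule hyperbolic_pythagoras)
  have c: "c \<noteq> 0" by (simp add: c_def)
  have "1 / c\<^sup>2 = (c\<^sup>2 - q\<^sup>2) / c\<^sup>2" by (simp add: cq)
  also have "\<dots> = 1 - q\<^sup>2 / c\<^sup>2" using c by (simp add: diff_divide_distrib)
  finally show ?thesis
    by (simp add: ground_state_def soliton_mass_def tanh_def power_mult_distrib power_divide c_def q_def)
qed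

lemma soliton_mass_deriv: "(soliton_mass has_real_derivative (ground_state x)\<^sup>2) (at x)"
proof -
  have "(soliton_mass has_real_derivative (1 - (tanh (x / 4))\<^sup>2) * (1 / 4) / 2) (at x)"
    unfolding soliton_mass_def[abs_def] by (auto intro!: derivative_eq_intros)
  then show ?thesis by (simp add: ground_state_power2 soliton_mass_def power_divide field_simps)
qed

lemma soliton_mass_measurable [measurable]: "soliton_mass \<in> borel_measurable borel"
  using DERIV_isCont[OF soliton_mass_deriv] by (intro borel_measurable_continuous_onI continuous_at_imp_continuous_on) auto

text \<open>The logarithmic derivative of the profile is minus half its mass function, which says
  that its defect is 0.\<close>

lemma ground_state_deriv: "(ground_state has_real_derivative - (soliton_mass x / 2) * ground_state x) (at x)"
  unfolding ground_state_def[abs_def]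
  by (auto intro!: derivative_eq_intros simp: soliton_mass_def tanh_def power2_eq_square)

lemma ground_state_pos: "ground_state x > 0" and ground_state_even: "ground_state (- x) = ground_state x"
  and ground_state_0: "ground_state 0 = 1 / (2 * sqrt 2)"
  by (simp_all add: ground_state_def)

lemma soliton_mass_bound: "\<bar>soliton_mass x\<bar> \<le> 1 / 2"
  using tanh_real_bounds[of "x / 4"] by (auto simp: soliton_mass_def abs_le_iff)

lemma soliton_mass_tendsto: "(soliton_mass \<longlongrightarrow> 1 / 2) at_top" "(soliton_mass \<longlongrightarrow> - 1 / 2) at_bot"
proof -
  have "filterlim (\<lambda>x::real. x / 4) at_top at_top" "filterlim (\<lambda>x::real. x / 4) at_bot at_bot"
    using filterlim_tendsto_pos_mult_at_top[OF tendsto_const _ filterlim_ident, of "1/4 :: real"]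
      filterlim_tendsto_pos_mult_at_bot[OF tendsto_const _ filterlim_ident, of "1/4 :: real"] by simp_all
  from filterlim_compose[OF tanh_real_at_top this(1)] filterlim_compose[OF tanh_real_at_bot this(2)]
  show "(soliton_mass \<longlongrightarrow> 1 / 2) at_top" "(soliton_mass \<longlongrightarrow> - 1 / 2) at_bot"
    unfolding soliton_mass_def[abs_def]
    using tendsto_divide[OF _ tendsto_const, of "\<lambda>x. tanh (x / 4)" _ _ "2 :: real"] by fastforce+
qed

lemma ground_state_integral: "integrable lborel (\<lambda>x. (ground_state x)\<^sup>2)" "(LINT x|lborel. (ground_state x)\<^sup>2) = 1"
proof -
  have cont: "isCont (\<lambda>x. (ground_state x)\<^sup>2) x" for x
    by (intro continuous_intros DERIV_isCont[OF ground_state_deriv])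
  have "set_integrable lborel (einterval (-\<infinity>) \<infinity>) (\<lambda>x. (ground_state x)\<^sup>2)" 
    "(LBINT x=-\<infinity>..\<infinity>. (ground_state x)\<^sup>2) = 1 / 2 - (- 1 / 2)"
    by (rule interval_integral_FTC_nonneg[where F = soliton_mass];
        use soliton_mass_deriv cont soliton_mass_tendsto in \<open>simp add: ereal_tendsto_simps\<close>)+
  then show "integrable lborel (\<lambda>x. (ground_state x)\<^sup>2)" "(LINT x|lborel. (ground_state x)\<^sup>2) = 1"
    by (simp_all add: set_integrable_def interval_lebesgue_integral_def set_lebesgue_integral_def)
qed

definition soliton :: "real \<Rightarrow> real \<Rightarrow> complex" where
  "soliton \<alpha> x = exp (\<i> * complex_of_real \<alpha>) * complex_of_real (ground_state x)"

definition soliton' :: "real \<Rightarrow> real \<Rightarrow> complex" where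
  "soliton' \<alpha> x = complex_of_real (- (soliton_mass x / 2)) * soliton \<alpha> x"

lemma Gamma_orbit_eq: "Gamma_orbit = range soliton"
  by (auto simp: Gamma_orbit_def soliton_def[abs_def])

lemma norm_soliton: "norm (soliton \<alpha> x) = ground_state x"
  using ground_state_pos[of x] by (simp add: soliton_def norm_mult)

lemma sobolev_pair_soliton: "sobolev_pair (soliton \<alpha>) (soliton' \<alpha>)"
  and l2sq_soliton: "l2sq (soliton \<alpha>) = 1"
proof -
  have d: "(soliton \<alpha> has_vector_derivative soliton' \<alpha> x) (at x)" for x
  proof -
    have "((\<lambda>x. complex_of_real (ground_state x)) has_vector_derivative of_real (- (soliton_mass x / 2) * ground_state x)) (at x)"
      using ground_state_deriv[of x] by (intro has_vector_derivative_of_real) (simp add: has_real_derivative_iff_has_vector_derivative)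
    from has_vector_derivative_mult_right[OF this, of "exp (\<i> * complex_of_real \<alpha>)"]
    show ?thesis unfolding soliton_def[abs_def] soliton'_def by (simp add: algebra_simps)
  qed
  have pw: "pw_deriv (soliton \<alpha>) (soliton' \<alpha>)" by (rule pw_derivI[OF d])
  have [measurable]: "soliton \<alpha> \<in> borel_measurable borel"
    by (rule borel_measurable_continuous_onI[OF pw_deriv_continuous[OF pw]])
  have L: "soliton \<alpha> \<in> L2"
    by (simp add: L2_def norm_soliton ground_state_integral)
  have "soliton' \<alpha> \<in> L2"
    unfolding soliton'_def[abs_def]
  proof (rule L2_mult_bounded(1)[OF L])
    show "(\<lambda>x. complex_of_real (- (soliton_mass x / 2))) \<in> borel_measurable borel" by measurable
    show "norm (complex_of_real (- (soliton_mass x / 2))) \<le> 1" for x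
      using soliton_mass_bound[of x] by simp
  qed
  with pw L show "sobolev_pair (soliton \<alpha>) (soliton' \<alpha>)" by (simp add: sobolev_pair_def)
  show "l2sq (soliton \<alpha>) = 1" by (simp add: l2sq_def norm_soliton ground_state_integral)
qed

lemma sobolev_pair_diff:
  assumes "sobolev_pair u u'" "sobolev_pair v v'" shows "sobolev_pair (\<lambda>x. u x - v x) (\<lambda>x. u' x - v' x)"
  using assms by (auto simp: sobolev_pair_def intro: pw_deriv_diff)

text \<open>With \<open>d = mass_fn u - soliton_mass\<close>, the function \<open>d \<cdot> cosh (x / 4)\<close> solves a linear equation
  whose damping coefficient is half of \<open>mass_fn u\<close>.\<close>

lemma riccati_comparison:
  fixes M \<rho> :: "real \<Rightarrow> real"
  assumes M: "\<And>x. (M has_real_derivative \<rho> x) (at x)" and M0: "M 0 = 0" and Mpos: "\<And>x. x \<ge> 0 \<Longrightarrow> M x \<ge> 0"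
    and E: "\<And>x. \<bar>\<rho> x + (M x)\<^sup>2 / 2 - 1 / 8\<bar> \<le> \<kappa>" and x: "x \<ge> 0"
  shows "\<bar>M x - soliton_mass x\<bar> \<le> 4 * \<kappa>"
proof -
  define z where "z y = (M y - soliton_mass y) * cosh (y / 4)" for y
  define I where "I y = integral {0..y} M" for y
  define P where "P y = exp (I y / 2)" for y
  have contM: "continuous_on A M" for A using DERIV_isCont[OF M] by (simp add: continuous_at_imp_continuous_on)
  have I: "(I has_real_derivative M y) (at y within {0..x + 1})" if "0 \<le> y" "y \<le> x" for y
    unfolding I_def[abs_def] using that by (intro integral_has_real_derivative contM) auto
  \<comment> \<open>Write T for \<open>soliton_mass\<close> and E for the Riccati error. The
    difference of the two Riccati equations is (M - T)' = - (M + T) (M - T) / 2 + E; since cosh (y /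
    4) has logarithmic derivative T / 2, multiplying by it cancels the T in the damping.\<close>
  have z: "(z has_real_derivative - (M y / 2) * z y + (\<rho> y + (M y)\<^sup>2 / 2 - 1 / 8) * cosh (y / 4)) (at y)" for y
  proof -
    have "(z has_real_derivative (\<rho> y - (ground_state y)\<^sup>2) * cosh (y / 4) + (M y - soliton_mass y) * (sinh (y / 4) * (1 / 4))) (at y)"
      unfolding z_def[abs_def] by (auto intro!: derivative_eq_intros M soliton_mass_deriv)
    moreover have "sinh (y / 4) = 2 * soliton_mass y * cosh (y / 4)" by (simp add: soliton_mass_def tanh_def)
    ultimately show ?thesis unfolding ground_state_power2 z_def
      by (simp add: algebra_simps power2_eq_square add_divide_distrib diff_divide_distrib)
  qed
  have contz: "continuous_on A z" for A using DERIV_isCont[OF z] by (simp add: continuous_at_imp_continuous_on)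
  have key: "s * z x \<le> 4 * \<kappa> * sinh (x / 4)" if s: "\<bar>s\<bar> = 1" for s
  proof -
    \<comment> \<open>\<open>4 * \<kappa> * sinh (y / 4)\<close> is the antiderivative of the worst
      forcing \<open>\<kappa> * cosh (y / 4)\<close>, and \<open>P\<close> is the integrating factor
      of the damping. As \<open>M\<close> is nonnegative on the half line, the remaining damping
      term has the favourable sign and \<open>W\<close> increases. The sign \<open>s\<close> treats
      the upper and the lower bound together.\<close>
    define W where "W y = P y * (4 * \<kappa> * sinh (y / 4) - s * z y)" for y
    have "W 0 \<le> W x"
    proof (rule DERIV_nonneg_imp_increasing_open[OF x])
      fix y assume y: "0 < y" "y < x"
      have "at y within {0..x + 1} = at y" using y by (intro at_within_interior) auto
      with I[of y] y have Iy: "(I has_real_derivative M y) (at y)" by simp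
      let ?D = "P y * ((M y / 2) * (4 * \<kappa> * sinh (y / 4)) + (\<kappa> - s * (\<rho> y + (M y)\<^sup>2 / 2 - 1 / 8)) * cosh (y / 4))"
      have "(W has_real_derivative P y * (M y / 2) * (4 * \<kappa> * sinh (y / 4) - s * z y)
         + P y * (4 * \<kappa> * (cosh (y / 4) * (1 / 4)) - s * (- (M y / 2) * z y + (\<rho> y + (M y)\<^sup>2 / 2 - 1 / 8) * cosh (y / 4)))) (at y)"
        unfolding W_def[abs_def] P_def by (auto intro!: derivative_eq_intros Iy z)
      then have "(W has_real_derivative ?D) (at y)" by (simp add: algebra_simps)
      moreover have "?D \<ge> 0"
      proof -
        have k: "0 \<le> \<kappa>" using E[of 0] by linarith
        have "\<bar>s * (\<rho> y + (M y)\<^sup>2 / 2 - 1 / 8)\<bar> \<le> \<kappa>" using E[of y] s by (simp only: abs_mult mult_1)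
        then have "0 \<le> \<kappa> - s * (\<rho> y + (M y)\<^sup>2 / 2 - 1 / 8)" by linarith
        then show ?thesis using Mpos[of y] y k
          by (intro mult_nonneg_nonneg add_nonneg_nonneg) (auto simp: P_def)
      qed
      ultimately show "\<exists>D. DERIV W y :> D \<and> D \<ge> 0" by blast
    next
      have "continuous_on {0..x} I"
        unfolding I_def[abs_def] by (rule indefinite_integral_continuous_1) (intro integrable_continuous_interval contM)
      then show "continuous_on {0..x} W"
        unfolding W_def[abs_def] P_def by (intro continuous_intros contz) auto
    qed
    moreover have "W 0 = 0" by (simp add: W_def z_def M0 soliton_mass_def)
    ultimately have "0 \<le> W x" by linarith
    then have "0 \<le> P x * (4 * \<kappa> * sinh (x / 4) - s * z x)" unfolding W_def .
    then have "0 \<le> 4 * \<kappa> * sinh (x / 4) - s * z x"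
      by (simp add: P_def zero_le_mult_iff)
    then show ?thesis by simp
  qed
  have k: "0 \<le> \<kappa>" using E[of 0] by linarith
  have "\<bar>M x - soliton_mass x\<bar> * cosh (x / 4) = \<bar>z x\<bar>" by (simp add: z_def abs_mult)
  also have "\<dots> \<le> 4 * \<kappa> * sinh (x / 4)" using key[of 1] key[of "-1"] by simp
  also have "\<dots> \<le> 4 * \<kappa> * cosh (x / 4)" using k by (intro mult_left_mono) (auto simp: sinh_le_cosh_real)
  finally show ?thesis by simp
qed

text \<open>The weight \<open>2 (1 + exp (- x / 2))\<close> is the bounded positive solution of \<open>a' = soliton_mass \<cdot> a - 1\<close>.\<close>

lemma weighted_half_line_estimate:
  fixes w :: "real \<Rightarrow> complex"
  assumes w: "pw_deriv w w'" and X: "X \<ge> 0"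
    and eq: "\<And>x. x \<ge> 0 \<Longrightarrow> w' x = - complex_of_real (soliton_mass x / 2) * w x + g x"
    and G: "(\<lambda>x. (norm (g x))\<^sup>2) integrable_on {0..X}"
  shows "integral {0..X} (\<lambda>x. (norm (w x))\<^sup>2) \<le> 8 * (norm (w 0))\<^sup>2 + 64 * integral {0..X} (\<lambda>x. (norm (g x))\<^sup>2)"
proof -
  define a where "a x = 2 * (1 + exp (- x / 2))" for x :: real
  define F where "F x = a x * inner (w x) (w x)" for x
  define F' where "F' x = a x * (2 * inner (w x) (w' x)) + - exp (- x / 2) * inner (w x) (w x)" for x
  have "pw_deriv a (\<lambda>x. - exp (- x / 2))"
    unfolding a_def[abs_def] by (rule pw_derivI_real) (auto intro!: derivative_eq_intros)
  from pw_deriv_bilinear[OF bounded_bilinear_mult this pw_deriv_bilinear[OF bounded_bilinear_inner w w]]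
  have "pw_deriv F F'" unfolding F_def[abs_def] F'_def[abs_def] by (simp add: inner_commute)
  from pw_deriv_ftc[OF this X] have FTC: "(F' has_integral F X - F 0) {0..X}" .
  have Iw: "(\<lambda>x. (norm (w x))\<^sup>2) integrable_on {0..X}"
    by (intro integrable_continuous_interval continuous_intros pw_deriv_continuous[OF w])
  \<comment> \<open>The weight is at most 4 on the half line, with the value 4 at 0. Young's
    inequality 8 |w| |g| <= |w|^2 / 2 + 32 |g|^2 gives up half of the gained |w|^2; doubling yields
    the constants 8 and 64.\<close>
  have "F X - F 0 \<le> - (1/2) * integral {0..X} (\<lambda>x. (norm (w x))\<^sup>2) + 32 * integral {0..X} (\<lambda>x. (norm (g x))\<^sup>2)"
  proof (rule has_integral_le[OF FTC])
    show "((\<lambda>x. - (1/2) * (norm (w x))\<^sup>2 + 32 * (norm (g x))\<^sup>2) has_integral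
       - (1/2) * integral {0..X} (\<lambda>x. (norm (w x))\<^sup>2) + 32 * integral {0..X} (\<lambda>x. (norm (g x))\<^sup>2)) {0..X}"
      by (intro has_integral_add has_integral_mult_right integrable_integral Iw G)
    fix x assume "x \<in> {0..X}"
    then have x: "x \<ge> 0" by simp
    have aT: "a x * soliton_mass x + exp (- x / 2) = 1"
    proof -
      define q where "q = exp (- x / 2)"
      have t: "tanh (x / 4) = (1 - q) / (1 + q)" unfolding q_def by (simp add: tanh_real_altdef)
      have "q > 0" by (simp add: q_def)
      then show ?thesis unfolding a_def soliton_mass_def q_def[symmetric] t by (simp add: field_simps)
    qed
    have "inner (w x) (w' x) = - (soliton_mass x / 2) * (norm (w x))\<^sup>2 + inner (w x) (g x)"
    proof -
      have "w' x = (- (soliton_mass x / 2)) *\<^sub>R w x + g x" using eq[OF x] by (simp add: scaleR_conv_of_real)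
      then show ?thesis by (simp only: inner_add_right inner_scaleR_right power2_norm_eq_inner)
    qed
    note ww = this
    have "F' x = - (a x * soliton_mass x + exp (- x / 2)) * (norm (w x))\<^sup>2 + 2 * a x * inner (w x) (g x)"
      unfolding F'_def ww power2_norm_eq_inner by (simp add: algebra_simps)
    also have "\<dots> = - (norm (w x))\<^sup>2 + 2 * a x * inner (w x) (g x)" by (simp only: aT mult_minus1)
    also have "2 * a x * inner (w x) (g x) \<le> 2 * 4 * (norm (w x) * norm (g x))"
    proof -
      have "2 * a x * inner (w x) (g x) \<le> 2 * a x * (norm (w x) * norm (g x))"
        by (intro mult_left_mono norm_cauchy_schwarz) (auto simp: a_def)
      also have "\<dots> \<le> 2 * 4 * (norm (w x) * norm (g x))"
        using x by (intro mult_right_mono) (auto simp: a_def)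
      finally show ?thesis .
    qed
    also have "2 * 4 * (norm (w x) * norm (g x)) \<le> (1/2) * (norm (w x))\<^sup>2 + 32 * (norm (g x))\<^sup>2"
    proof -
      have "0 \<le> (norm (w x) - 8 * norm (g x))\<^sup>2 / 2" by simp
      then show ?thesis by (simp add: power2_eq_square algebra_simps)
    qed
    finally show "F' x \<le> - (1/2) * (norm (w x))\<^sup>2 + 32 * (norm (g x))\<^sup>2" by simp
  qed
  moreover have "F X \<ge> 0" by (simp add: F_def a_def add_nonneg_nonneg)
  moreover have "F 0 = 4 * (norm (w 0))\<^sup>2" by (simp add: F_def a_def power2_norm_eq_inner)
  ultimately show ?thesis by simp
qed

text \<open>The half-line estimate integrates outwards from the origin; evenness of \<open>w\<close>
  makes the left half equal to the right one, which doubles both constants. The estimate is uniform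
  over symmetric windows, so it passes to the whole line.\<close>

lemma l2sq_even_estimate:
  fixes w :: "real \<Rightarrow> complex"
  assumes w: "pw_deriv w w'" "w \<in> L2" and g: "g \<in> L2" and even: "\<And>x. w (- x) = w x"
    and eq: "\<And>x. w' x = - complex_of_real (soliton_mass x / 2) * w x + g x"
  shows "l2sq w \<le> 16 * (norm (w 0))\<^sup>2 + 128 * l2sq g"
proof (rule tendsto_upperbound)
  show "(\<lambda>n. LINT x:{- real n..real n}|lborel. (norm (w x))\<^sup>2) \<longlonglongrightarrow> l2sq w"
    unfolding l2sq_def by (rule tendsto_set_integral_whole[OF L2_integrable[OF w(2)]])
  have "(LINT x:{- real n..real n}|lborel. (norm (w x))\<^sup>2) \<le> 16 * (norm (w 0))\<^sup>2 + 128 * l2sq g" for n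
  proof -
    note SI = set_integrable_lborel[OF L2_integrable]
    have "(LINT x:{- real n..real n}|lborel. (norm (w x))\<^sup>2) = integral {- real n..real n} (\<lambda>x. (norm (w x))\<^sup>2)"
      by (rule set_borel_integral_eq_integral(2)) (use w in \<open>auto intro: SI\<close>)
    also have "\<dots> = integral {- real n..0} (\<lambda>x. (norm (w x))\<^sup>2) + integral {0..real n} (\<lambda>x. (norm (w x))\<^sup>2)"
      by (rule Henstock_Kurzweil_Integration.integral_combine[symmetric])
         (auto intro!: integrable_continuous_interval continuous_intros pw_deriv_continuous[OF w(1)])
    also have "integral {- real n..0} (\<lambda>x. (norm (w x))\<^sup>2) = integral {0..real n} (\<lambda>x. (norm (w x))\<^sup>2)"
      using Henstock_Kurzweil_Integration.integral_reflect_real[of "real n" 0 "\<lambda>x. (norm (w x))\<^sup>2"] by (simp add: even)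
    also have "integral {0..real n} (\<lambda>x. (norm (w x))\<^sup>2) \<le> 8 * (norm (w 0))\<^sup>2 + 64 * integral {0..real n} (\<lambda>x. (norm (g x))\<^sup>2)"
      by (rule weighted_half_line_estimate[OF w(1) _ eq]) (use set_borel_integral_eq_integral(1)[OF SI[OF g]] in auto)
    also have "integral {0..real n} (\<lambda>x. (norm (g x))\<^sup>2) = (LINT x:{0..real n}|lborel. (norm (g x))\<^sup>2)"
      by (rule set_borel_integral_eq_integral(2)[symmetric]) (use g in \<open>auto intro: SI\<close>)
    also have "\<dots> \<le> l2sq g"
      unfolding l2sq_def set_lebesgue_integral_def using SI[OF g, of "{0..real n}"] L2_integrable[OF g]
      by (intro integral_mono) (auto simp: set_integrable_def split: split_indicator)
    finally show ?thesis by simp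
  qed
  then show "\<forall>\<^sub>F n in sequentially. (LINT x:{- real n..real n}|lborel. (norm (w x))\<^sup>2) \<le> 16 * (norm (w 0))\<^sup>2 + 128 * l2sq g"
    by simp
qed simp

section \<open>Distance to the soliton orbit versus defect and mass, in both directions\<close>

lemma h1_norm_nonneg: "0 \<le> h1_norm f"
  unfolding h1_norm_def by (intro real_sqrt_ge_zero Bochner_Integration.integral_nonneg) simp

lemma h1_dist_le: "h1_dist f Gamma_orbit \<le> h1_norm (\<lambda>x. f x - soliton \<alpha> x)"
  unfolding h1_dist_def Gamma_orbit_eq
  by (rule cINF_lower) (auto intro!: bdd_belowI2[of _ 0] h1_norm_nonneg)

text \<open>Strictness produces an actual phase without any appeal to attainment of the
  infimum.\<close>

lemma h1_dist_less:
  assumes "h1_dist f Gamma_orbit < s"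
  obtains \<alpha> where "h1_norm (\<lambda>x. f x - soliton \<alpha> x) < s"
  using assms unfolding h1_dist_def Gamma_orbit_eq
  by (subst (asm) cINF_less_iff) (auto intro!: bdd_belowI2[of _ 0] h1_norm_nonneg)

lemma l2sq_diff_le:
  assumes "f \<in> L2" "g \<in> L2" shows "l2sq (\<lambda>x. f x - g x) \<le> 2 * l2sq f + 2 * l2sq g"
proof -
  have "l2sq (\<lambda>x. f x + (- 1) * g x) \<le> 2 * l2sq f + 2 * l2sq (\<lambda>x. (- 1) * g x)"
    by (intro l2sq_add_le assms L2_cmult)
  then show ?thesis by (simp add: l2sq_def)
qed

text \<open>The difference from a soliton solves a linear equation with the fixed coefficient
  \<open>soliton_mass\<close>. The mismatch between the value \<open>m\<close> of the mass function
  and that coefficient is moved into the source term.\<close>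

lemma soliton'_perturbation: 
  "v - soliton' \<alpha> x = - complex_of_real (soliton_mass x / 2) * (u - soliton \<alpha> x) +
     ((v + complex_of_real (m / 2) * u) - complex_of_real ((m - soliton_mass x) / 2) * u)"
  by (simp add: soliton'_def algebra_simps diff_divide_distrib)

text \<open>The Riccati error is at most 2 sqrt(m) e + |m^2 - 1| / 8, with m the mass and e the norm
  of the defect. The bound 16 on m gives sqrt(m) <= 4 and (m + 1) / 8 <= 3, hence the factors 8 and
  3; it is an a priori bound and asks for no closeness to the soliton.\<close>

theorem soliton_stability:
  assumes uv: "sobolev_pair u v" and even: "\<And>x. u (- x) = u x" and m: "l2sq u \<le> 16"
  shows "h1_dist u Gamma_orbit \<le> 225 * (8 * sqrt (l2sq (defect u v)) + 3 * \<bar>l2sq u - 1\<bar>)"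
proof -
  define e where "e = sqrt (l2sq (defect u v))"
  define \<kappa> where "\<kappa> = 8 * e + 3 * \<bar>l2sq u - 1\<bar>"
  have e: "0 \<le> e" "e\<^sup>2 = l2sq (defect u v)" by (simp_all add: e_def)
  have \<kappa>: "0 \<le> \<kappa>" "8 * e \<le> \<kappa>" using e by (auto simp: \<kappa>_def)
  note u = sobolev_pairD[OF uv]
  have E: "\<bar>(norm (u x))\<^sup>2 + (mass_fn u x)\<^sup>2 / 2 - 1 / 8\<bar> \<le> \<kappa>" for x
  proof -
    have "sqrt (l2sq u) \<le> sqrt (4\<^sup>2)" using m by (intro real_sqrt_le_mono) simp
    then have "sqrt (l2sq u) \<le> 4" by simp
    then have "2 * (sqrt (l2sq u) * e) \<le> 8 * e" using e mult_right_mono[of "sqrt (l2sq u)" 4 e] by linarith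
    moreover have "\<bar>(l2sq u)\<^sup>2 / 8 - 1 / 8\<bar> \<le> 3 * \<bar>l2sq u - 1\<bar>"
    proof -
      have "\<bar>(l2sq u)\<^sup>2 / 8 - 1 / 8\<bar> = \<bar>(l2sq u - 1) * ((l2sq u + 1) / 8)\<bar>"
        by (simp add: power2_eq_square algebra_simps diff_divide_distrib add_divide_distrib)
      also have "\<dots> = \<bar>l2sq u - 1\<bar> * ((l2sq u + 1) / 8)" by (simp add: abs_mult)
      also have "\<dots> \<le> \<bar>l2sq u - 1\<bar> * 3" using m by (intro mult_left_mono) auto
      finally show ?thesis by simp
    qed
    ultimately show ?thesis using density_mass_bound[OF uv, of x] by (simp add: \<kappa>_def e_def)
  qed
  have odd: "mass_fn u (- x) = - mass_fn u x" for x by (rule mass_fn_odd[OF uv even])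
  have M0: "mass_fn u 0 = 0" using odd[of 0] by simp
  have half: "\<bar>mass_fn u x - soliton_mass x\<bar> \<le> 4 * \<kappa>" if "x \<ge> 0" for x
  proof (rule riccati_comparison[where M = "mass_fn u" and \<rho> = "\<lambda>x. (norm (u x))\<^sup>2", OF _ M0 _ E that])
    show "(mass_fn u has_real_derivative (norm (u x))\<^sup>2) (at x)" for x
      using mass_fn_deriv[OF uv] by (simp add: has_real_derivative_iff_has_vector_derivative)
    show "0 \<le> mass_fn u x" if "0 \<le> x" for x using mass_fn_mono[OF uv that] M0 by simp
  qed
  have d: "\<bar>mass_fn u x - soliton_mass x\<bar> \<le> 4 * \<kappa>" for x
  proof (cases "x \<ge> 0")
    case False
    moreover have "soliton_mass (- x) = - soliton_mass x" by (simp add: soliton_mass_def)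
    ultimately show ?thesis using half[of "- x"] odd[of x] by (simp add: abs_minus_commute)
  qed (rule half)
  \<comment> \<open>With the phases aligned at the origin, the difference \<open>w\<close> at 0 is a
    difference of moduli, which the first integral controls.\<close>
  define \<alpha> where "\<alpha> = Arg (u 0)"
  define w where "w x = u x - soliton \<alpha> x" for x
  define w' where "w' x = v x - soliton' \<alpha> x" for x
  define g where "g x = defect u v x - complex_of_real ((mass_fn u x - soliton_mass x) / 2) * u x" for x
  have wp: "sobolev_pair w w'"
    unfolding w_def[abs_def] w'_def[abs_def] by (rule sobolev_pair_diff[OF uv sobolev_pair_soliton])
  note w = sobolev_pairD[OF wp]
  have eq: "w' x = - complex_of_real (soliton_mass x / 2) * w x + g x" for x
    unfolding w_def w'_def g_def defect_def by (rule soliton'_perturbation)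
  note mass_fn_measurable[OF uv, measurable]
  have b: "norm (complex_of_real ((mass_fn u x - soliton_mass x) / 2)) \<le> 2 * \<kappa>" for x
    using d[of x] by (simp only: norm_of_real) simp
  note du = L2_mult_bounded[OF u(2) _ b]
  have gL: "g \<in> L2" unfolding g_def[abs_def] by (intro L2_diff defect_L2[OF uv] du) measurable
  have "l2sq g \<le> 2 * l2sq (defect u v) + 2 * ((2 * \<kappa>)\<^sup>2 * l2sq u)"
    unfolding g_def[abs_def]
    by (intro order_trans[OF l2sq_diff_le] defect_L2[OF uv] du add_mono mult_left_mono order_refl) measurable
  also have "\<dots> \<le> 2 * \<kappa>\<^sup>2 + 2 * ((2 * \<kappa>)\<^sup>2 * 16)"
  proof (intro add_mono mult_left_mono m)
    show "l2sq (defect u v) \<le> \<kappa>\<^sup>2" unfolding e(2)[symmetric] using e \<kappa> by (intro power_mono) auto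
  qed auto
  finally have g: "l2sq g \<le> 130 * \<kappa>\<^sup>2" by (simp add: power_mult_distrib)
  \<comment> \<open>At the origin the mass function vanishes, so \<open>E\<close> compares the
    squared moduli directly. Dividing by the ground state value 1 / (2 sqrt 2) produces the factor
    8.\<close>
  have w0: "(norm (w 0))\<^sup>2 \<le> 8 * \<kappa>\<^sup>2"
  proof -
    have "u 0 = complex_of_real (norm (u 0)) * exp (\<i> * complex_of_real \<alpha>)"
      unfolding \<alpha>_def using Arg_eq[of "u 0"] by (cases "u 0 = 0") auto
    then have "w 0 = complex_of_real (norm (u 0) - ground_state 0) * exp (\<i> * complex_of_real \<alpha>)"
      unfolding w_def soliton_def by (metis (no_types, lifting) mult.commute of_real_diff right_diff_distrib')
    then have nw: "norm (w 0) = \<bar>norm (u 0) - ground_state 0\<bar>"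
      by (simp add: norm_mult flip: of_real_diff)
    have "(norm (w 0) * ground_state 0)\<^sup>2 \<le> (norm (w 0) * (norm (u 0) + ground_state 0))\<^sup>2"
      using ground_state_pos[of 0] by (intro power_mono mult_left_mono) auto
    also have "\<dots> = ((norm (u 0))\<^sup>2 - (ground_state 0)\<^sup>2)\<^sup>2"
    proof -
      have "(norm (u 0))\<^sup>2 - (ground_state 0)\<^sup>2 = (norm (u 0) - ground_state 0) * (norm (u 0) + ground_state 0)"
        by (simp add: power2_eq_square algebra_simps)
      then show ?thesis unfolding nw by (simp only: power_mult_distrib power2_abs)
    qed
    also have "\<dots> \<le> \<kappa>\<^sup>2"
      using E[of 0] \<kappa> by (intro abs_le_square_iff[THEN iffD1]) (simp add: M0 ground_state_power2 soliton_mass_def)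
    finally show ?thesis by (simp add: power_mult_distrib ground_state_0 power_divide)
  qed
  have weven: "w (- x) = w x" for x by (simp add: w_def even soliton_def ground_state_even)
  have "l2sq w \<le> 16 * (norm (w 0))\<^sup>2 + 128 * l2sq g"
    by (rule l2sq_even_estimate[OF w(1,2) gL weven eq])
  then have lw: "l2sq w \<le> 16768 * \<kappa>\<^sup>2" using w0 g by simp
  have bT: "norm (- complex_of_real (soliton_mass x / 2)) \<le> 1" for x
    using soliton_mass_bound[of x] by (simp only: norm_of_real norm_minus_cancel)
  note Tw = L2_mult_bounded[OF w(2) _ bT]
  have "l2sq w' = l2sq (\<lambda>x. - complex_of_real (soliton_mass x / 2) * w x + g x)" by (rule arg_cong[where f = l2sq]) (rule ext, rule eq)
  also have "\<dots> \<le> 2 * (1\<^sup>2 * l2sq w) + 2 * l2sq g"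
    by (intro order_trans[OF l2sq_add_le] gL Tw add_mono mult_left_mono order_refl) measurable
  \<comment> \<open>16 * 8 + 128 * 130 = 16768 bounds the part of \<open>w\<close>; adding 2 * 16768
    + 2 * 130 for \<open>w'\<close> gives 50564, rounded up to 225^2 = 50625.\<close>
  finally have "l2sq w + l2sq w' \<le> 50625 * \<kappa>\<^sup>2" using lw g zero_le_power2[of \<kappa>] by (simp only: one_power2 mult_1)
  then have "l2sq w + l2sq w' \<le> 225\<^sup>2 * \<kappa>\<^sup>2" by simp
  then have "sqrt (l2sq w + l2sq w') \<le> 225 * \<kappa>"
    using \<kappa> by (intro real_le_lsqrt) (auto simp: power_mult_distrib)
  then have "h1_norm w \<le> 225 * \<kappa>" using h1_norm_sobolev_pair[OF wp] by simp
  then show ?thesis using h1_dist_le[of u \<alpha>] by (simp add: w_def[abs_def] \<kappa>_def e_def)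
qed

text \<open>A soliton has zero defect, and on a set of bounded mass the defect depends
  Lipschitz-continuously on the function in H1, so its square is quadratic in the distance. This
  turns the hypothesis on the initial data into smallness of mass error and defect.\<close>

theorem defect_near_soliton:
  assumes uv: "sobolev_pair u v" and s: "s \<le> 2" and near: "h1_norm (\<lambda>x. u x - soliton \<alpha> x) \<le> s"
  shows "\<bar>l2sq u - 1\<bar> \<le> 4 * s" and "l2sq (defect u v) \<le> 49 * s\<^sup>2" and "l2sq v \<le> 2 + 2 * s\<^sup>2"
proof -
  define w where "w x = u x - soliton \<alpha> x" for x
  define w' where "w' x = v x - soliton' \<alpha> x" for x
  have wp: "sobolev_pair w w'"
    unfolding w_def[abs_def] w'_def[abs_def] by (rule sobolev_pair_diff[OF uv sobolev_pair_soliton])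
  note u = sobolev_pairD[OF uv] and w = sobolev_pairD[OF wp] and \<eta> = sobolev_pairD[OF sobolev_pair_soliton[of \<alpha>]]
  have s0: "0 \<le> s" using near h1_norm_nonneg order_trans by blast
  have "sqrt (l2sq w + l2sq w') \<le> s"
    using near h1_norm_sobolev_pair[OF wp] by (simp add: w_def[abs_def])
  then have "l2sq w + l2sq w' \<le> s\<^sup>2" by (simp add: sqrt_le_D)
  then have lw: "l2sq w \<le> s\<^sup>2" "l2sq w' \<le> s\<^sup>2" using l2sq_nonneg[of w] l2sq_nonneg[of w'] by linarith+
  have [measurable]: "u \<in> borel_measurable borel" "w \<in> borel_measurable borel" "soliton \<alpha> \<in> borel_measurable borel"
    using u w \<eta> by measurable
  note mass_fn_measurable[OF uv, measurable]
  have I\<eta>: "integrable lborel (\<lambda>x. (ground_state x)\<^sup>2)" by (rule ground_state_integral)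
  have Iu: "integrable lborel (\<lambda>x. (norm (u x))\<^sup>2)" by (rule L2_integrable[OF u(2)])
  have Id: "integrable lborel (\<lambda>x. (norm (u x))\<^sup>2 - (ground_state x)\<^sup>2)" using Iu I\<eta> by simp
  have \<theta>: "(LINT x|lborel. norm ((norm (u x))\<^sup>2 - (ground_state x)\<^sup>2)) \<le> 4 * s"
  proof -
    have "(LINT x|lborel. norm ((norm (u x))\<^sup>2 - (ground_state x)\<^sup>2))
        \<le> (LINT x|lborel. (norm (w x))\<^sup>2 + 2 * (norm (w x) * norm (soliton \<alpha> x)))"
    proof (rule integral_mono)
      show "integrable lborel (\<lambda>x. norm ((norm (u x))\<^sup>2 - (ground_state x)\<^sup>2))" by (rule integrable_norm[OF Id])
      show "integrable lborel (\<lambda>x. (norm (w x))\<^sup>2 + 2 * (norm (w x) * norm (soliton \<alpha> x)))"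
        using L2_integrable[OF w(2)] integrable_L2_mult[OF w(2) \<eta>(2), of "\<lambda>x. norm (w x) * norm (soliton \<alpha> x)" 1] by simp
      fix x
      have uw: "\<bar>norm (u x) - norm (soliton \<alpha> x)\<bar> \<le> norm (w x)" unfolding w_def by (rule norm_triangle_ineq3)
      have "norm ((norm (u x))\<^sup>2 - (ground_state x)\<^sup>2) = \<bar>norm (u x) - norm (soliton \<alpha> x)\<bar> * (norm (u x) + norm (soliton \<alpha> x))"
      proof -
        have "(norm (u x))\<^sup>2 - (ground_state x)\<^sup>2 = (norm (u x) - norm (soliton \<alpha> x)) * (norm (u x) + norm (soliton \<alpha> x))"
          unfolding norm_soliton by (simp add: power2_eq_square algebra_simps)
        then show ?thesis by (simp only: real_norm_def abs_mult abs_of_nonneg[OF add_nonneg_nonneg[OF norm_ge_zero norm_ge_zero]])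
      qed
      also have "\<dots> \<le> norm (w x) * (norm (w x) + 2 * norm (soliton \<alpha> x))"
        using uw by (intro mult_mono) auto
      finally show "norm ((norm (u x))\<^sup>2 - (ground_state x)\<^sup>2) \<le> (norm (w x))\<^sup>2 + 2 * (norm (w x) * norm (soliton \<alpha> x))"
        by (simp add: power2_eq_square algebra_simps)
    qed
    also have "\<dots> = l2sq w + 2 * (LINT x|lborel. norm (w x) * norm (soliton \<alpha> x))"
      using L2_integrable[OF w(2)] integrable_L2_mult[OF w(2) \<eta>(2), of "\<lambda>x. norm (w x) * norm (soliton \<alpha> x)" 1]
      by (simp add: l2sq_def)
    also have "\<dots> \<le> s\<^sup>2 + 2 * (s * 1)"
    proof -
      have "sqrt (l2sq w) \<le> s" using lw(1) s0 by (intro real_le_lsqrt) auto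
      then have "(LINT x|lborel. norm (w x) * norm (soliton \<alpha> x)) \<le> s * 1"
        using L2_cauchy_schwarz[OF w(2) \<eta>(2)] by (simp add: l2sq_soliton)
      then show ?thesis using lw(1) by simp
    qed
    also have "\<dots> \<le> 4 * s" using s s0 mult_right_mono[of s 2 s] by (simp add: power2_eq_square)
    finally show ?thesis .
  qed
  have "l2sq u - 1 = (LINT x|lborel. (norm (u x))\<^sup>2 - (ground_state x)\<^sup>2)"
    using Iu I\<eta> by (simp add: l2sq_def ground_state_integral)
  also have "\<bar>\<dots>\<bar> \<le> (LINT x|lborel. norm ((norm (u x))\<^sup>2 - (ground_state x)\<^sup>2))"
    using integral_norm_bound[of lborel "\<lambda>x. (norm (u x))\<^sup>2 - (ground_state x)\<^sup>2"] by simp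
  finally show m: "\<bar>l2sq u - 1\<bar> \<le> 4 * s" using \<theta> by simp
  define d where "d x = mass_fn u x - soliton_mass x" for x
  have "pw_deriv soliton_mass (\<lambda>x. (ground_state x)\<^sup>2)"
    by (rule pw_derivI_real[OF soliton_mass_deriv])
  from pw_deriv_diff[OF mass_fn_pw[OF uv] this]
  have dp: "pw_deriv d (\<lambda>x. (norm (u x))\<^sup>2 - (ground_state x)\<^sup>2)" unfolding d_def[abs_def] .
  \<comment> \<open>The derivative of \<open>d\<close> has integral norm at most 4 s, and its limit
    at minus infinity is half the mass error, at most 2 s in size.\<close>
  have d: "\<bar>d x\<bar> \<le> 6 * s" for x
  proof -
    have "((\<lambda>y. norm (d x - d y)) \<longlongrightarrow> norm (d x - (- (l2sq u / 2) - - 1 / 2))) at_bot"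
      unfolding d_def by (intro tendsto_intros mass_fn_tendsto[OF uv] soliton_mass_tendsto)
    moreover have "norm (d x - d y) \<le> 4 * s" for y
      using pw_deriv_increment_le[OF dp Id, of UNIV y x] \<theta> by (simp add: set_lebesgue_integral_def)
    ultimately have "norm (d x - (- (l2sq u / 2) - - 1 / 2)) \<le> 4 * s"
      by (intro tendsto_upperbound[OF _ always_eventually]) auto
    then show ?thesis using m by (simp add: abs_le_iff)
  qed
  \<comment> \<open>The mass is at most 1 + 4 * 2 = 9 and the mass function at most half of
    it.\<close>
  have b1: "norm (complex_of_real (mass_fn u x / 2)) \<le> 9 / 4" for x
    using mass_fn_bound[OF uv, of x] m s by (simp only: norm_of_real)
  have b2: "norm (complex_of_real (d x / 2)) \<le> 3 * s" for x
    using d[of x] by (simp only: norm_of_real)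
  note L1 = L2_mult_bounded[OF w(2) _ b1] and L2' = L2_mult_bounded[OF \<eta>(2) _ b2]
  have dm [measurable]: "d \<in> borel_measurable borel" unfolding d_def[abs_def] by measurable
  \<comment> \<open>The soliton has zero defect, so subtracting it leaves one term linear in the
    difference and one from the mismatch of the mass functions.\<close>
  have "defect u v x = (w' x + complex_of_real (mass_fn u x / 2) * w x) + complex_of_real (d x / 2) * soliton \<alpha> x" for x
    by (simp add: defect_def w'_def w_def d_def soliton'_def algebra_simps diff_divide_distrib)
  then have "l2sq (defect u v) = l2sq (\<lambda>x. (w' x + complex_of_real (mass_fn u x / 2) * w x) + complex_of_real (d x / 2) * soliton \<alpha> x)"
    by presburger
  also have "\<dots> \<le> 2 * (2 * l2sq w' + 2 * ((9 / 4)\<^sup>2 * l2sq w)) + 2 * ((3 * s)\<^sup>2 * l2sq (soliton \<alpha>))"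
  proof (intro order_trans[OF l2sq_add_le] add_mono mult_left_mono order_refl)
    show A: "(\<lambda>x. complex_of_real (mass_fn u x / 2) * w x) \<in> L2" by (rule L1) measurable
    then show "(\<lambda>x. w' x + complex_of_real (mass_fn u x / 2) * w x) \<in> L2" using w(3) by (rule L2_add[rotated])
    show "l2sq (\<lambda>x. complex_of_real (mass_fn u x / 2) * w x) \<le> (9 / 4)\<^sup>2 * l2sq w" by (rule L1) measurable
    show "(\<lambda>x. complex_of_real (d x / 2) * soliton \<alpha> x) \<in> L2" by (rule L2') measurable
    show "l2sq (\<lambda>x. complex_of_real (d x / 2) * soliton \<alpha> x) \<le> (3 * s)\<^sup>2 * l2sq (soliton \<alpha>)" by (rule L2') measurable
  qed (use w in auto)
  also have "\<dots> \<le> 2 * (2 * s\<^sup>2 + 2 * ((9 / 4)\<^sup>2 * s\<^sup>2)) + 2 * ((3 * s)\<^sup>2 * 1)"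
    using lw by (intro add_mono mult_left_mono) (auto simp: l2sq_soliton)
  \<comment> \<open>The coefficients add up to 4 + 20.25 + 18 = 42.25; 49 is taken as the next
    convenient square.\<close>
  also have "\<dots> \<le> 49 * s\<^sup>2" using s0 by (simp add: power_mult_distrib power_divide)
  finally show "l2sq (defect u v) \<le> 49 * s\<^sup>2" .
  have bT: "norm (complex_of_real (- (soliton_mass x / 2))) \<le> 1" for x
    using soliton_mass_bound[of x] by (simp only: norm_of_real abs_minus_cancel)
  have "l2sq (soliton' \<alpha>) \<le> 1\<^sup>2 * l2sq (soliton \<alpha>)"
    unfolding soliton'_def[abs_def] by (rule L2_mult_bounded(2)[OF \<eta>(2) _ bT]) measurable
  moreover have "l2sq v = l2sq (\<lambda>x. w' x + soliton' \<alpha> x)" by (simp add: w'_def)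
  ultimately show "l2sq v \<le> 2 + 2 * s\<^sup>2"
    using l2sq_add_le[OF w(3) \<eta>(3)] lw by (simp add: l2sq_soliton)
qed

section \<open>Piecewise linear interpolation\<close>

abbreviation cell :: "real \<Rightarrow> int \<Rightarrow> real set" where
  "cell h j \<equiv> {h * real_of_int j..h * (real_of_int j + 1)}"

lemma interp_cell:
  assumes h: "h > 0" and x: "h * real_of_int j \<le> x" "x \<le> h * (real_of_int j + 1)"
  shows "interp h \<psi> x = complex_of_real (1 - (x / h - j)) * \<psi> j + complex_of_real (x / h - j) * \<psi> (j + 1)"
proof -
  define s where "s = x / h - j"
  have s: "0 \<le> s" "s \<le> 1" using h x by (auto simp: s_def field_simps)
  have xs: "x / h = s + j" by (simp add: s_def)
  have hs: "hat s = 1 - s" "hat (s - 1) = s" using s by (auto simp: hat_def)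
  have "interp h \<psi> x = (\<Sum>\<^sub>\<infinity>k\<in>{j, j + 1}. \<psi> k * complex_of_real (hat (x / h - real_of_int k)))"
    unfolding interp_def
  proof (rule infsum_cong_neutral)
    fix k assume "k \<in> UNIV - {j, j + 1}"
    then have "k \<le> j - 1 \<or> k \<ge> j + 2" by auto
    then have "1 \<le> \<bar>s + j - k\<bar>" using s by auto
    then show "\<psi> k * complex_of_real (hat (x / h - real_of_int k)) = 0" by (simp add: hat_def xs)
  qed auto
  also have "\<dots> = \<psi> j * complex_of_real (hat s) + \<psi> (j + 1) * complex_of_real (hat (s - 1))"
    by (simp add: xs)
  finally show ?thesis unfolding hs by (simp add: s_def mult.commute)
qed

text \<open>The floor selects the cell closed on the left, so at a node the value is the slope to
  its right; the nodes are the exceptional set in \<open>pw_deriv\<close>.\<close>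

definition interp' :: "real \<Rightarrow> (int \<Rightarrow> complex) \<Rightarrow> real \<Rightarrow> complex" where
  "interp' h \<psi> x = (\<psi> (\<lfloor>x / h\<rfloor> + 1) - \<psi> \<lfloor>x / h\<rfloor>) / complex_of_real h"

lemma floor_cell_unique:
  fixes x h :: real assumes "h > 0" "h * real_of_int j \<le> x" "x < h * (real_of_int j + 1)"
  shows "\<lfloor>x / h\<rfloor> = j"
  using assms by (intro floor_unique) (auto simp: field_simps)

lemma interp'_cell:
  assumes "h > 0" "h * real_of_int j \<le> x" "x < h * (real_of_int j + 1)"
  shows "interp' h \<psi> x = (\<psi> (j + 1) - \<psi> j) / complex_of_real h"
  by (simp add: interp'_def floor_cell_unique[OF assms])

lemma floor_cell:
  fixes x h :: real assumes "h > 0"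
  shows "h * real_of_int \<lfloor>x / h\<rfloor> \<le> x" "x < h * (real_of_int \<lfloor>x / h\<rfloor> + 1)"
proof -
  have "real_of_int \<lfloor>x / h\<rfloor> \<le> x / h" "x / h < real_of_int \<lfloor>x / h\<rfloor> + 1" by linarith+
  then show "h * real_of_int \<lfloor>x / h\<rfloor> \<le> x" "x < h * (real_of_int \<lfloor>x / h\<rfloor> + 1)"
    by (simp_all only: pos_le_divide_eq[OF assms] pos_divide_less_eq[OF assms] mult.commute[of h])
qed

lemma continuous_on_interp_cell:
  assumes h: "h > 0" shows "continuous_on (cell h j) (interp h \<psi>)"
  by (rule continuous_on_eq[where f = "\<lambda>x. complex_of_real (1 - (x / h - j)) * \<psi> j + complex_of_real (x / h - j) * \<psi> (j + 1)"])
     (use h in \<open>auto intro!: continuous_intros simp: interp_cell\<close>)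

lemma pw_deriv_interp:
  assumes h: "h > 0" shows "pw_deriv (interp h \<psi>) (interp' h \<psi>)"
  unfolding pw_deriv_def
proof (intro conjI exI[of _ "range (\<lambda>j. h * real_of_int j)"] allI impI)
  have "isCont (interp h \<psi>) x" for x
  proof -
    define j where "j = \<lfloor>x / h\<rfloor>"
    have x: "h * real_of_int j \<le> x" "x < h * (real_of_int j + 1)" unfolding j_def by (rule floor_cell[OF h])+
    \<comment> \<open>Two adjacent cells form a neighbourhood of \<open>x\<close> even when
      \<open>x\<close> is their common node.\<close>
    have "continuous_on (cell h (j - 1) \<union> cell h j) (interp h \<psi>)"
      by (intro continuous_on_closed_Un continuous_on_interp_cell h) auto
    moreover have "x \<in> interior (cell h (j - 1) \<union> cell h j)"
    proof (rule interiorI[of "{h * (real_of_int j - 1)<..<h * (real_of_int j + 1)}"])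
      show "x \<in> {h * (real_of_int j - 1)<..<h * (real_of_int j + 1)}"
        using x less_le_trans[OF mult_strict_left_mono[of "real_of_int j - 1" "real_of_int j" h] x(1)] h by auto
    qed (use h in auto)
    ultimately show ?thesis by (rule continuous_on_interior)
  qed
  then show "continuous_on UNIV (interp h \<psi>)" by (simp add: continuous_at_imp_continuous_on)
next
  fix a b :: real
  have "range (\<lambda>j. h * real_of_int j) \<inter> {a..b} \<subseteq> (\<lambda>j. h * real_of_int j) ` {\<lfloor>a / h\<rfloor>..\<lceil>b / h\<rceil>}"
  proof
    fix y assume "y \<in> range (\<lambda>j. h * real_of_int j) \<inter> {a..b}"
    then obtain j where y: "y = h * real_of_int j" "a \<le> y" "y \<le> b" by auto
    have "a / h \<le> real_of_int j" "real_of_int j \<le> b / h" using y h by (auto simp: field_simps)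
    then have "\<lfloor>a / h\<rfloor> \<le> j" "j \<le> \<lceil>b / h\<rceil>" by linarith+
    then show "y \<in> (\<lambda>j. h * real_of_int j) ` {\<lfloor>a / h\<rfloor>..\<lceil>b / h\<rceil>}" using y(1) by auto
  qed
  then show "finite (range (\<lambda>j. h * real_of_int j) \<inter> {a..b})" by (rule finite_subset) simp
next
  fix x assume "x \<notin> range (\<lambda>j. h * real_of_int j)"
  define j where "j = \<lfloor>x / h\<rfloor>"
  have x: "h * real_of_int j \<le> x" "x < h * (real_of_int j + 1)" unfolding j_def by (rule floor_cell[OF h])+
  with \<open>x \<notin> _\<close> have x': "x \<in> {h * real_of_int j<..<h * (real_of_int j + 1)}" by (auto simp: less_le)
  have "((\<lambda>x. (1 - (x / h - j)) *\<^sub>R \<psi> j + (x / h - j) *\<^sub>R \<psi> (j + 1)) has_vector_derivative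
      (- (1 / h)) *\<^sub>R \<psi> j + (1 / h) *\<^sub>R \<psi> (j + 1)) (at x)"
    using h by (auto intro!: derivative_eq_intros has_vector_derivative_add has_vector_derivative_scaleR simp: field_simps)
  moreover have "(- (1 / h)) *\<^sub>R \<psi> j + (1 / h) *\<^sub>R \<psi> (j + 1) = interp' h \<psi> x"
    using interp'_cell[OF h x] by (simp add: scaleR_conv_of_real diff_divide_distrib)
  ultimately have "((\<lambda>x. (1 - (x / h - j)) *\<^sub>R \<psi> j + (x / h - j) *\<^sub>R \<psi> (j + 1)) has_vector_derivative interp' h \<psi> x) (at x)"
    by simp
  then show "(interp h \<psi> has_vector_derivative interp' h \<psi> x) (at x)"
    by (rule has_vector_derivative_transform_within_open[OF _ _ x'])
       (use interp_cell[OF h, of j] in \<open>auto simp: scaleR_conv_of_real\<close>)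
qed

lemma interp_node: "h > 0 \<Longrightarrow> interp h \<psi> (h * real_of_int j) = \<psi> j"
  using interp_cell[of h j "h * real_of_int j" \<psi>] by simp

lemma interp_even:
  assumes "\<And>j. \<psi> (- j) = \<psi> j" shows "interp h \<psi> (- x) = interp h \<psi> x"
proof -
  have "bij_betw uminus (UNIV :: int set) UNIV" by (rule bij_betw_byWitness[where f' = uminus]) auto
  from infsum_reindex_bij_betw[OF this, of "\<lambda>j. \<psi> j * complex_of_real (hat (- x / h - real_of_int j))"]
  have "interp h \<psi> (- x) = (\<Sum>\<^sub>\<infinity>j\<in>UNIV. \<psi> (- j) * complex_of_real (hat (- x / h - real_of_int (- j))))"
    by (simp add: interp_def)
  also have "\<dots> = interp h \<psi> x"
    unfolding interp_def
  proof (rule infsum_cong)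
    fix j
    have "hat (- x / h - real_of_int (- j)) = hat (x / h - real_of_int j)"
      by (simp add: hat_def abs_minus_commute)
    then show "\<psi> (- j) * complex_of_real (hat (- x / h - real_of_int (- j))) = \<psi> j * complex_of_real (hat (x / h - real_of_int j))"
      by (simp only: assms)
  qed
  finally show ?thesis .
qed

section \<open>Exact mass, kinetic and quartic integrals of interpolants\<close>

lemma interp'_measurable [measurable]: "interp' h \<psi> \<in> borel_measurable borel"
proof -
  have "(\<lambda>x. \<lfloor>x / h\<rfloor>) \<in> measurable borel (count_space UNIV)" by measurable
  then show ?thesis unfolding interp'_def[abs_def]
    by (rule measurable_compose[where g = "\<lambda>j. (\<psi> (j + 1) - \<psi> j) / complex_of_real h"]) simp
qed

text \<open>Half-open cells partition the line, while the closed cells carry the continuous formulas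
  \<open>g j\<close> and their integrals; the two differ by null sets. Nonnegativity of
  \<open>f\<close> allows the exchange of sum and integral by Tonelli, so integrability is a
  conclusion.\<close>

lemma integral_over_cells:
  fixes f :: "real \<Rightarrow> real"
  assumes h: "h > 0" and [measurable]: "f \<in> borel_measurable borel" and pos: "\<And>x. 0 \<le> f x"
    and g: "\<And>j x. h * real_of_int j \<le> x \<Longrightarrow> x < h * (real_of_int j + 1) \<Longrightarrow> f x = g j x"
    and cont: "\<And>j. continuous_on (cell h j) (g j)"
    and int: "\<And>j. (g j has_integral c j) (cell h j)"
    and summ: "c summable_on UNIV"
  shows "integrable lborel f" and "integral\<^sup>L lborel f = (\<Sum>\<^sub>\<infinity>j. c j)"
proof -
  let ?C = "\<lambda>j. {h * real_of_int j..<h * (real_of_int j + 1)}"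
  have SK: "set_integrable lborel (cell h j) (g j)" for j by (rule borel_integrable_atLeastAtMost'[OF cont])
  have intK: "(LINT x:cell h j|lborel. g j x) = c j" for j
    using set_borel_integral_eq_integral(2)[OF SK] integral_unique[OF int] by simp
  have cell: "(\<integral>\<^sup>+x. ennreal (f x) * indicator (?C j) x \<partial>lborel) = ennreal (c j)" for j
  proof -
    have I: "integrable lborel (\<lambda>x. indicator (cell h j) x *\<^sub>R g j x)" using SK unfolding set_integrable_def .
    have AE: "AE x in lborel. indicator (cell h j) x *\<^sub>R g j x = f x * indicator (?C j) x"
      using AE_lborel_singleton[of "h * (real_of_int j + 1)"]
      by eventually_elim (auto simp: indicator_def g)
    have "(\<integral>\<^sup>+x. ennreal (f x) * indicator (?C j) x \<partial>lborel) = (\<integral>\<^sup>+x. ennreal (indicator (cell h j) x *\<^sub>R g j x) \<partial>lborel)"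
      by (rule nn_integral_cong_AE) (use AE in eventually_elim, auto simp: indicator_def)
    also have "\<dots> = ennreal (LINT x|lborel. indicator (cell h j) x *\<^sub>R g j x)"
    proof (rule nn_integral_eq_integral[OF I])
      show "AE x in lborel. 0 \<le> indicator (cell h j) x *\<^sub>R g j x"
        using AE by eventually_elim (simp add: pos)
    qed
    finally show ?thesis using intK by (simp add: set_lebesgue_integral_def)
  qed
  \<comment> \<open>\<open>g j\<close> agrees with \<open>f\<close> only on the half-open cell; its
    sign at the right endpoint follows by continuity.\<close>
  have cpos: "0 \<le> c j" for j
  proof (rule has_integral_nonneg[OF int])
    have "0 \<le> g j x" if "x \<in> cell h j" for x
    proof (rule continuous_ge_on_closure[of "?C j" "g j" x 0])
      have "h * real_of_int j < h * (real_of_int j + 1)" using h by simp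
      then show "continuous_on (closure (?C j)) (g j)" "x \<in> closure (?C j)" using cont that by simp_all
      show "0 \<le> g j y" if "y \<in> ?C j" for y using that pos[of y] g[of j y] by simp
    qed
    then show "\<And>x. x \<in> cell h j \<Longrightarrow> 0 \<le> g j x" .
  qed
  have "(\<integral>\<^sup>+x. ennreal (f x) \<partial>lborel) = (\<integral>\<^sup>+x. \<integral>\<^sup>+j. ennreal (f x) * indicator (?C j) x \<partial>count_space UNIV \<partial>lborel)"
  proof (rule nn_integral_cong)
    fix x
    have "indicator (?C j) x = (indicator {\<lfloor>x / h\<rfloor>} j :: ennreal)" for j
    proof (cases "j = \<lfloor>x / h\<rfloor>")
      case True then show ?thesis using floor_cell[OF h, of x] by simp
    next
      case False
      then have "x \<notin> ?C j" using floor_cell_unique[OF h, of j x] by auto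
      then show ?thesis using False by simp
    qed
    then show "ennreal (f x) = (\<integral>\<^sup>+j. ennreal (f x) * indicator (?C j) x \<partial>count_space UNIV)"
      by (simp add: nn_integral_cmult_indicator one_ennreal_def[symmetric])
  qed
  also have "\<dots> = (\<integral>\<^sup>+j. \<integral>\<^sup>+x. ennreal (f x) * indicator (?C j) x \<partial>lborel \<partial>count_space UNIV)"
    by (rule nn_integral_count_space_nn_integral) auto
  also have "\<dots> = (\<integral>\<^sup>+j. ennreal (c j) \<partial>count_space UNIV)" by (simp add: cell)
  also have "\<dots> = ennreal (infsetsum c UNIV)"
    using summ cpos by (intro nn_integral_conv_infsetsum) (auto simp: abs_summable_equivalent[symmetric])
  also have "infsetsum c UNIV = (\<Sum>\<^sub>\<infinity>j. c j)"
    using summ cpos by (intro infsetsum_infsum) (auto simp: abs_summable_equivalent[symmetric])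
  finally have nn: "(\<integral>\<^sup>+x. ennreal (f x) \<partial>lborel) = ennreal (\<Sum>\<^sub>\<infinity>j. c j)" .
  show I: "integrable lborel f"
    by (rule integrableI_nonneg) (auto simp: nn pos)
  have "0 \<le> (\<Sum>\<^sub>\<infinity>j. c j)" by (rule infsum_nonneg) (rule cpos)
  then show "integral\<^sup>L lborel f = (\<Sum>\<^sub>\<infinity>j. c j)"
    using nn_integral_eq_integral[OF I] nn pos Bochner_Integration.integral_nonneg[of lborel f] by simp
qed

text \<open>Degree four is what the fourth power of the modulus needs on a cell. The mass integrand
  uses the same formula with zero cubic and quartic coefficients, which explains the vanishing terms
  kept there.\<close>

lemma has_integral_cell_poly:
  fixes h :: real
  assumes h: "h > 0"
  shows "((\<lambda>x. c0 + c1 * (x / h - j) + c2 * (x / h - j)\<^sup>2 + c3 * (x / h - j) ^ 3 + c4 * (x / h - j) ^ 4)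
    has_integral h * (c0 + c1 / 2 + c2 / 3 + c3 / 4 + c4 / 5)) {h * j..h * (j + 1)}"
proof -
  define q where "q s = c0 + c1 * s + c2 * s\<^sup>2 + c3 * s ^ 3 + c4 * s ^ 4" for s
  define Q where "Q s = c0 * s + c1 / 2 * s\<^sup>2 + c2 / 3 * s ^ 3 + c3 / 4 * s ^ 4 + c4 / 5 * s ^ 5" for s
  have le: "h * j \<le> h * (j + 1)" using h by (intro mult_left_mono) auto
  have "((\<lambda>x. q (x / h - j)) has_integral h * Q (h * (j + 1) / h - j) - h * Q (h * j / h - j)) {h * j..h * (j + 1)}"
  proof (rule fundamental_theorem_of_calculus[OF le])
    fix x
    have Q: "(Q has_real_derivative q s) (at s)" for s
      unfolding Q_def[abs_def] q_def by (auto intro!: derivative_eq_intros)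
    have "((\<lambda>x. x / h - j) has_real_derivative 1 / h) (at x within {h * j..h * (j + 1)})"
      using h by (auto intro!: derivative_eq_intros)
    from DERIV_cmult[OF DERIV_chain2[OF Q this], of h] h
    show "((\<lambda>x. h * Q (x / h - j)) has_vector_derivative q (x / h - j)) (at x within {h * j..h * (j + 1)})"
      by (simp add: has_real_derivative_iff_has_vector_derivative)
  qed
  then show ?thesis using h by (simp add: Q_def q_def)
qed

abbreviation ipl :: "real \<Rightarrow> even_l2 \<Rightarrow> real \<Rightarrow> complex" where "ipl h x \<equiv> interp h (site x)"
abbreviation ipl' :: "real \<Rightarrow> even_l2 \<Rightarrow> real \<Rightarrow> complex" where "ipl' h x \<equiv> interp' h (site x)"

lemma norm_segment_power2:
  fixes a b :: complex
  shows "(norm (complex_of_real (1 - s) * a + complex_of_real s * b))\<^sup>2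
    = (norm a)\<^sup>2 + ((norm b)\<^sup>2 - (norm a)\<^sup>2 - (norm (b - a))\<^sup>2) * s + (norm (b - a))\<^sup>2 * s\<^sup>2"
  unfolding cmod_power2 by (simp add: power2_eq_square algebra_simps)

lemma has_sum_site: "((\<lambda>j. (norm (site x (j + a)))\<^sup>2) has_sum (norm x)\<^sup>2) UNIV"
  using summable_shift[OF summable_site[of x], of a] infsum_shift[of "\<lambda>j. (norm (site x j))\<^sup>2" a]
  by (simp add: has_sum_iff norm_even_l2_power2)

lemma has_sum_dirichlet: "((\<lambda>j. (norm (site x (j + 1) - site x j))\<^sup>2) has_sum dirichlet x) UNIV"
  using summable_dirichlet by (simp add: dirichlet_def)

lemma continuous_ipl: "h > 0 \<Longrightarrow> continuous_on A (ipl h x)"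
  by (rule pw_deriv_continuous[OF pw_deriv_interp])

lemma ipl_measurable: "h > 0 \<Longrightarrow> ipl h x \<in> borel_measurable borel"
  by (rule borel_measurable_continuous_onI[OF continuous_ipl])

lemma density_ipl_cell:
  assumes "h > 0" "h * real_of_int j \<le> t" "t < h * (real_of_int j + 1)"
  shows "(norm (ipl h x t))\<^sup>2 = (norm (site x j))\<^sup>2
    + ((norm (site x (j + 1)))\<^sup>2 - (norm (site x j))\<^sup>2 - (norm (site x (j + 1) - site x j))\<^sup>2) * (t / h - j)
    + (norm (site x (j + 1) - site x j))\<^sup>2 * (t / h - j)\<^sup>2"
proof -
  have "ipl h x t = complex_of_real (1 - (t / h - j)) * site x j + complex_of_real (t / h - j) * site x (j + 1)"
    by (rule interp_cell) (use assms in auto)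
  then show ?thesis by (simp only: norm_segment_power2)
qed

text \<open>On a cell the density is quadratic, and its integral is the trapezoid value minus h/6
  times the squared increment. The interpolant thus has less mass than the lattice state, by h^2/6
  times its kinetic energy.\<close>

lemma ipl_mass:
  assumes h: "h > 0"
  shows "integrable lborel (\<lambda>t. (norm (ipl h x t))\<^sup>2)" and "l2sq (ipl h x) = h * ((norm x)\<^sup>2 - dirichlet x / 6)"
proof -
  define p D where "p j = (norm (site x j))\<^sup>2" and "D j = (norm (site x (j + 1) - site x j))\<^sup>2" for j
  define c where "c j = h * (p j + (p (j + 1) - p j - D j) / 2 + D j / 3 + 0 / 4 + 0 / 5)" for j
  have [measurable]: "ipl h x \<in> borel_measurable borel" by (rule ipl_measurable[OF h])
  have "((\<lambda>j. h * ((1 / 2) * (norm (site x (j + 0)))\<^sup>2 + (1 / 2) * (norm (site x (j + 1)))\<^sup>2 + (- (1 / 6)) * (norm (site x (j + 1) - site x j))\<^sup>2))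
     has_sum h * ((1 / 2) * (norm x)\<^sup>2 + (1 / 2) * (norm x)\<^sup>2 + (- (1 / 6)) * dirichlet x)) UNIV"
    by (intro has_sum_cmult_right has_sum_add has_sum_site has_sum_dirichlet)
  moreover have "c = (\<lambda>j. h * ((1 / 2) * (norm (site x (j + 0)))\<^sup>2 + (1 / 2) * (norm (site x (j + 1)))\<^sup>2 + (- (1 / 6)) * (norm (site x (j + 1) - site x j))\<^sup>2))"
    by (rule ext) (simp add: c_def p_def D_def field_simps)
  ultimately have c: "(c has_sum h * ((norm x)\<^sup>2 - dirichlet x / 6)) UNIV" by simp
  define g where "g j t = p j + (p (j + 1) - p j - D j) * (t / h - j) + D j * (t / h - j)\<^sup>2
    + 0 * (t / h - j) ^ 3 + 0 * (t / h - j) ^ 4" for j :: int and t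
  have g: "h * real_of_int j \<le> t \<Longrightarrow> t < h * (real_of_int j + 1) \<Longrightarrow> (norm (ipl h x t))\<^sup>2 = g j t" for j t
    using density_ipl_cell[OF h] by (simp add: p_def D_def g_def)
  have cont: "continuous_on (cell h j) (g j)" for j
    unfolding g_def[abs_def] using h by (intro continuous_intros) auto
  have int: "(g j has_integral c j) (cell h j)" for j
    unfolding g_def[abs_def] c_def by (rule has_integral_cell_poly[OF h])
  note I = integral_over_cells[OF h _ _ g cont int has_sum_imp_summable[OF c]]
  show "integrable lborel (\<lambda>t. (norm (ipl h x t))\<^sup>2)" by (rule I(1)) auto
  have "integral\<^sup>L lborel (\<lambda>t. (norm (ipl h x t))\<^sup>2) = (\<Sum>\<^sub>\<infinity>j. c j)" by (rule I(2)) auto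
  then show "l2sq (ipl h x) = h * ((norm x)\<^sup>2 - dirichlet x / 6)"
    using infsumI[OF c] by (simp add: l2sq_def)
qed

text \<open>The slope is constant on each cell, so the lattice kinetic energy is reproduced without
  error.\<close>

lemma ipl_kinetic:
  assumes h: "h > 0"
  shows "integrable lborel (\<lambda>t. (norm (ipl' h x t))\<^sup>2)" and "l2sq (ipl' h x) = dirichlet x / h"
proof -
  define D where "D j = (norm (site x (j + 1) - site x j))\<^sup>2" for j
  define c where "c j = (1 / h) * D j" for j
  have c: "(c has_sum (1 / h) * dirichlet x) UNIV"
    unfolding c_def[abs_def] D_def by (intro has_sum_cmult_right has_sum_dirichlet)
  note cells = integral_over_cells[OF h, where f = "\<lambda>t. (norm (ipl' h x t))\<^sup>2" and c = c and g = "\<lambda>j t. D j / h\<^sup>2"]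
  have g: "h * real_of_int j \<le> t \<Longrightarrow> t < h * (real_of_int j + 1) \<Longrightarrow> (norm (ipl' h x t))\<^sup>2 = D j / h\<^sup>2" for j t
    using interp'_cell[OF h] h by (simp add: D_def norm_divide power_divide)
  have int: "((\<lambda>t. D j / h\<^sup>2) has_integral c j) (cell h j)" for j
  proof -
    have "h * real_of_int j \<le> h * (real_of_int j + 1)" using h by (intro mult_left_mono) auto
    then show ?thesis
      using has_integral_const_real[of "D j / h\<^sup>2" "h * real_of_int j" "h * (real_of_int j + 1)"] h
      by (simp add: c_def power2_eq_square algebra_simps)
  qed
  note I = cells[OF _ _ g continuous_on_const int has_sum_imp_summable[OF c]]
  show "integrable lborel (\<lambda>t. (norm (ipl' h x t))\<^sup>2)" by (rule I(1)) auto
  have "integral\<^sup>L lborel (\<lambda>t. (norm (ipl' h x t))\<^sup>2) = (\<Sum>\<^sub>\<infinity>j. c j)" by (rule I(2)) auto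
  then show "l2sq (ipl' h x) = dirichlet x / h"
    using infsumI[OF c] by (simp add: l2sq_def)
qed

lemma sobolev_pair_ipl: "h > 0 \<Longrightarrow> sobolev_pair (ipl h x) (ipl' h x)"
  using ipl_mass(1)[of h x] ipl_kinetic(1)[of h x] ipl_measurable[of h x]
  by (auto simp: sobolev_pair_def L2_def intro: pw_deriv_interp)

text \<open>The long sum is the integral over [0, 1] of the square of p + (q - p - D) s + D s^2, the
  density along the segment from \<open>a\<close> to \<open>b\<close>; the trapezoid value is
  subtracted. The difference is controlled by \<open>D\<close> because (p - q)^2 and D^2 are both at
  most 2 D (p + q).\<close>

lemma quartic_trapezoid_error:
  fixes a b :: complex
  defines "p \<equiv> (norm a)\<^sup>2" and "q \<equiv> (norm b)\<^sup>2" and "D \<equiv> (norm (b - a))\<^sup>2"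
  shows "\<bar>p\<^sup>2 + 2 * p * (q - p - D) / 2 + ((q - p - D)\<^sup>2 + 2 * p * D) / 3 + 2 * (q - p - D) * D / 4 + D\<^sup>2 / 5
      - (p\<^sup>2 + q\<^sup>2) / 2\<bar> \<le> D * (p + q) / 2"
proof -
  have eq: "p\<^sup>2 + 2 * p * (q - p - D) / 2 + ((q - p - D)\<^sup>2 + 2 * p * D) / 3 + 2 * (q - p - D) * D / 4 + D\<^sup>2 / 5
      - (p\<^sup>2 + q\<^sup>2) / 2 = - (p - q)\<^sup>2 / 6 - D * (p + q) / 6 + D\<^sup>2 / 30"
    by (simp add: power2_eq_square field_simps)
  have pq: "0 \<le> p" "0 \<le> q" "0 \<le> D" by (auto simp: p_def q_def D_def)
  have D: "D \<le> 2 * (p + q)"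
    using power2_norm_add_le[of b "- a"] by (simp add: p_def q_def D_def)
  have "(p - q)\<^sup>2 \<le> 2 * (D * (p + q))"
  proof -
    have "p - q = (norm a - norm b) * (norm a + norm b)" by (simp add: p_def q_def power2_eq_square algebra_simps)
    then have "(p - q)\<^sup>2 = \<bar>norm a - norm b\<bar>\<^sup>2 * (norm a + norm b)\<^sup>2" by (simp add: power_mult_distrib)
    also have "\<dots> \<le> D * (2 * (p + q))"
    proof (rule mult_mono)
      show "\<bar>norm a - norm b\<bar>\<^sup>2 \<le> D"
        unfolding D_def using norm_triangle_ineq3[of a b] by (intro power_mono) (auto simp: norm_minus_commute)
      show "(norm a + norm b)\<^sup>2 \<le> 2 * (p + q)"
        using sum_squares_bound[of "norm a" "norm b"] by (simp add: p_def q_def power2_sum)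
    qed (use pq in auto)
    finally show ?thesis by (simp add: algebra_simps)
  qed
  moreover have "D\<^sup>2 \<le> 2 * (D * (p + q))"
    using mult_left_mono[OF D pq(3)] by (simp add: power2_eq_square algebra_simps)
  moreover have "0 \<le> D * (p + q)" using pq by simp
  moreover have "0 \<le> (p - q)\<^sup>2" "0 \<le> D\<^sup>2" by simp_all
  moreover have "\<bar>- X / 6 - Y / 6 + Z / 30\<bar> \<le> Y / 2"
    if "X \<le> 2 * Y" "Z \<le> 2 * Y" "0 \<le> Y" "0 \<le> X" "0 \<le> Z" for X Y Z :: real
    using that by linarith
  ultimately show ?thesis unfolding eq by blast
qed

text \<open>The trapezoid values of all cells reassemble to the lattice sum, so only the errors of
  the cells remain. Since \<open>dirichlet x\<close> is h times the kinetic energy, the bound is of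
  order h^2.\<close>

lemma ipl_quartic:
  assumes h: "h > 0" and B: "\<And>j. (norm (site x j))\<^sup>2 \<le> B"
  shows "\<bar>(LINT t|lborel. (norm (ipl h x t)) ^ 4) - h * (norm (sqabs x))\<^sup>2\<bar> \<le> h * (B * dirichlet x)"
proof -
  define p D where "p j = (norm (site x j))\<^sup>2" and "D j = (norm (site x (j + 1) - site x j))\<^sup>2" for j
  define k where "k j = (p j)\<^sup>2 + 2 * p j * (p (j + 1) - p j - D j) / 2 + ((p (j + 1) - p j - D j)\<^sup>2 + 2 * p j * D j) / 3
     + 2 * (p (j + 1) - p j - D j) * D j / 4 + (D j)\<^sup>2 / 5" for j
  define r where "r j = k j - ((p j)\<^sup>2 + (p (j + 1))\<^sup>2) / 2" for j
  have [measurable]: "ipl h x \<in> borel_measurable borel" by (rule ipl_measurable[OF h])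
  have r: "\<bar>r j\<bar> \<le> B * D j" for j
  proof -
    have "\<bar>r j\<bar> \<le> D j * (p j + p (j + 1)) / 2"
      unfolding r_def k_def p_def D_def by (rule quartic_trapezoid_error)
    also have "\<dots> \<le> D j * (B + B) / 2"
      using B by (intro divide_right_mono mult_left_mono add_mono) (auto simp: p_def D_def)
    finally show ?thesis by (simp add: mult.commute)
  qed
  have BD: "((\<lambda>j. B * D j) has_sum B * dirichlet x) UNIV"
    unfolding D_def by (intro has_sum_cmult_right has_sum_dirichlet)
  have rs: "r summable_on UNIV"
    by (rule abs_summable_summable, rule summable_on_comparison_test[OF has_sum_imp_summable[OF BD]]) (use r in auto)
  have rb: "\<bar>\<Sum>\<^sub>\<infinity>j. r j\<bar> \<le> B * dirichlet x"
  proof -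
    have "(\<Sum>\<^sub>\<infinity>j. r j) \<le> (\<Sum>\<^sub>\<infinity>j. B * D j)"
      using r by (intro infsum_mono rs has_sum_imp_summable[OF BD]) (simp add: abs_le_iff)
    moreover have "(\<Sum>\<^sub>\<infinity>j. - r j) \<le> (\<Sum>\<^sub>\<infinity>j. B * D j)"
      using r rs by (intro infsum_mono has_sum_imp_summable[OF BD]) (auto simp: abs_le_iff summable_on_uminus)
    ultimately show ?thesis using infsumI[OF BD] by (simp add: infsum_uminus abs_le_iff)
  qed
  have psq: "((\<lambda>j. (p (j + a))\<^sup>2) has_sum (norm (sqabs x))\<^sup>2) UNIV" for a
    using has_sum_site[of "sqabs x" a] by (simp add: p_def norm_power)
  have "((\<lambda>j. h * ((1 / 2) * (p (j + 0))\<^sup>2 + (1 / 2) * (p (j + 1))\<^sup>2 + r j)) has_sum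
     h * ((1 / 2) * (norm (sqabs x))\<^sup>2 + (1 / 2) * (norm (sqabs x))\<^sup>2 + (\<Sum>\<^sub>\<infinity>j. r j))) UNIV"
    using rs by (intro has_sum_cmult_right has_sum_add psq) simp
  moreover have "(\<lambda>j. h * k j) = (\<lambda>j. h * ((1 / 2) * (p (j + 0))\<^sup>2 + (1 / 2) * (p (j + 1))\<^sup>2 + r j))"
    by (rule ext) (simp add: r_def add_divide_distrib)
  ultimately have c: "((\<lambda>j. h * k j) has_sum h * ((norm (sqabs x))\<^sup>2 + (\<Sum>\<^sub>\<infinity>j. r j))) UNIV" by simp
  define g where "g j t = (p j)\<^sup>2 + (2 * p j * (p (j + 1) - p j - D j)) * (t / h - j)
     + ((p (j + 1) - p j - D j)\<^sup>2 + 2 * p j * D j) * (t / h - j)\<^sup>2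
     + (2 * (p (j + 1) - p j - D j) * D j) * (t / h - j) ^ 3 + (D j)\<^sup>2 * (t / h - j) ^ 4" for j :: int and t :: real
  have g: "(norm (ipl h x t)) ^ 4 = g j t" if "h * real_of_int j \<le> t" "t < h * (real_of_int j + 1)" for j t
  proof -
    have "(norm (ipl h x t)) ^ 4 = ((norm (ipl h x t))\<^sup>2)\<^sup>2" by (simp flip: power_mult)
    also have "\<dots> = (p j + (p (j + 1) - p j - D j) * (t / h - j) + D j * (t / h - j)\<^sup>2)\<^sup>2"
      unfolding density_ipl_cell[OF h that] p_def D_def ..
    also have "(p j + b * s + d * s\<^sup>2)\<^sup>2 = (p j)\<^sup>2 + (2 * p j * b) * s + (b\<^sup>2 + 2 * p j * d) * s\<^sup>2 + (2 * b * d) * s ^ 3 + d\<^sup>2 * s ^ 4" for b s d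
      by (simp add: power2_eq_square power3_eq_cube power4_eq_xxxx algebra_simps)
    finally show ?thesis by (simp only: g_def)
  qed
  have cont: "continuous_on (cell h j) (g j)" for j
    unfolding g_def[abs_def] using h by (intro continuous_intros) auto
  have int: "(g j has_integral h * k j) (cell h j)" for j
    unfolding g_def[abs_def] k_def by (rule has_integral_cell_poly[OF h])
  have "(LINT t|lborel. (norm (ipl h x t)) ^ 4) = (\<Sum>\<^sub>\<infinity>j. h * k j)"
    by (rule integral_over_cells(2)[OF h _ _ g cont int has_sum_imp_summable[OF c]]) auto
  then have "(LINT t|lborel. (norm (ipl h x t)) ^ 4) - h * (norm (sqabs x))\<^sup>2 = h * (\<Sum>\<^sub>\<infinity>j. r j)"
    using infsumI[OF c] by (simp add: algebra_simps)
  then show ?thesis using rb h by (simp add: abs_mult mult_left_mono)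
qed

text \<open>The interpolant takes the lattice values at the nodes, so Agmon's inequality on the line
  bounds the sites with a constant independent of h.\<close>

lemma site_power2_le:
  assumes "h > 0" shows "(norm (site x j))\<^sup>2 \<le> 2 * (sqrt (l2sq (ipl h x)) * sqrt (l2sq (ipl' h x)))"
  using density_le[OF sobolev_pair_ipl[OF assms], of x "h * real_of_int j"] assms by (simp add: interp_node)

lemma norm_sqabs_power2_le:
  assumes "\<And>j. (norm (site x j))\<^sup>2 \<le> B"
  shows "(norm (sqabs x))\<^sup>2 \<le> B * (norm x)\<^sup>2"
proof (rule has_sum_mono)
  show "((\<lambda>j. (norm (site (sqabs x) (j + 0)))\<^sup>2) has_sum (norm (sqabs x))\<^sup>2) UNIV" by (rule has_sum_site)
  show "((\<lambda>j. B * (norm (site x (j + 0)))\<^sup>2) has_sum B * (norm x)\<^sup>2) UNIV"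
    by (intro has_sum_cmult_right has_sum_site)
  fix j
  have "(norm (site (sqabs x) (j + 0)))\<^sup>2 = (norm (site x j))\<^sup>2 * (norm (site x j))\<^sup>2"
    by (simp add: norm_mult power2_eq_square)
  also have "\<dots> \<le> B * (norm (site x (j + 0)))\<^sup>2" unfolding add_0_right by (intro mult_right_mono assms) simp
  finally show "(norm (site (sqabs x) (j + 0)))\<^sup>2 \<le> B * (norm (site x (j + 0)))\<^sup>2" .
qed

section \<open>Orbital stability\<close>

text \<open>The bounds 11 and 1400 are those met in \<open>lattice_stability\<close>. From 11 * 1400
  <= 125^2 every squared site is at most 250, and 250 * 1400 = 350000.\<close>

lemma ipl_uniform_bounds:
  assumes h: "0 < h" and m: "l2sq (ipl h x) \<le> 11" and K: "l2sq (ipl' h x) \<le> 1400"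
  shows "\<bar>(LINT t|lborel. (norm (ipl h x t)) ^ 4) - h * (norm (sqabs x))\<^sup>2\<bar> \<le> 350000 * h\<^sup>2"
proof -
  have "sqrt (l2sq (ipl h x)) * sqrt (l2sq (ipl' h x)) = sqrt (l2sq (ipl h x) * l2sq (ipl' h x))"
    by (simp add: real_sqrt_mult)
  also have "\<dots> \<le> sqrt (11 * 1400)"
    using m K by (intro real_sqrt_le_mono mult_mono) auto
  also have "\<dots> \<le> sqrt (125\<^sup>2)" by (intro real_sqrt_le_mono) simp
  finally have B: "(norm (site x j))\<^sup>2 \<le> 250" for j
    using site_power2_le[OF h, of x j] by simp
  have "h * (250 * dirichlet x) = 250 * h\<^sup>2 * l2sq (ipl' h x)"
    using h by (simp add: ipl_kinetic power2_eq_square)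
  also have "\<dots> \<le> 250 * h\<^sup>2 * 1400" using K by (intro mult_left_mono) auto
  finally show ?thesis using ipl_quartic[OF h B] by simp
qed

text \<open>A static comparison of two lattice states with equal conserved quantities. The defect
  identity is applied to both interpolants, and all discrepancies between lattice and interpolant
  are bounded by multiples of h^2.\<close>

theorem lattice_stability:
  assumes h: "0 < h" "h \<le> 1" and \<delta>: "0 < \<delta>" "\<delta> < 1"
    and init: "h1_dist (ipl h x0) Gamma_orbit \<le> \<delta>"
    and N: "norm x = norm x0" and E: "nls_energy (1 / h\<^sup>2) x = nls_energy (1 / h\<^sup>2) x0"
  shows "h1_dist (ipl h x) Gamma_orbit \<le> 1223550 * (\<delta> + h)"
proof -
  \<comment> \<open>The infimum in \<open>h1_dist\<close> need not be attained; doubling gives the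
    strict inequality that selects a phase.\<close>
  define s where "s = 2 * \<delta>"
  have s: "0 < s" "s < 2" using \<delta> by (auto simp: s_def)
  obtain \<alpha> where "h1_norm (\<lambda>t. ipl h x0 t - soliton \<alpha> t) < s"
    using h1_dist_less[of "ipl h x0" s] init \<delta> by (auto simp: s_def)
  then have near: "h1_norm (\<lambda>t. ipl h x0 t - soliton \<alpha> t) \<le> s" by simp
  note P = sobolev_pair_ipl[OF h(1)]
  define m0 m where "m0 = l2sq (ipl h x0)" and "m = l2sq (ipl h x)"
  define K0 K where "K0 = l2sq (ipl' h x0)" and "K = l2sq (ipl' h x)"
  define A0 A where "A0 = (LINT t|lborel. (norm (ipl h x0 t)) ^ 4)" and "A = (LINT t|lborel. (norm (ipl h x t)) ^ 4)"
  define Q0 Q where "Q0 = h * (norm (sqabs x0))\<^sup>2" and "Q = h * (norm (sqabs x))\<^sup>2"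
  define N2 where "N2 = h * (norm x0)\<^sup>2"
  have nn: "0 \<le> m0" "0 \<le> m" "0 \<le> K0" "0 \<le> K" "0 \<le> Q0" "0 \<le> Q"
    using h by (auto simp: m0_def m_def K0_def K_def Q0_def Q_def)
  have s2: "s\<^sup>2 \<le> 4" using s power_mono[of s 2 2] by simp
  \<comment> \<open>The kinetic bound is 2 + 2 s^2 with s^2 <= 4.\<close>
  have m0: "\<bar>m0 - 1\<bar> \<le> 4 * s" and e0: "l2sq (defect (ipl h x0) (ipl' h x0)) \<le> 49 * s\<^sup>2" and K0: "K0 \<le> 10"
    using defect_near_soliton[OF P _ near] s s2 by (auto simp: m0_def K0_def)
  have h2: "0 < h\<^sup>2" "h\<^sup>2 \<le> h" "h\<^sup>2 \<le> 1" using h by (auto simp: power2_eq_square mult_le_one mult_left_le)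
  have mass: "m0 = N2 - h\<^sup>2 * K0 / 6" "m = N2 - h\<^sup>2 * K / 6"
    using h(1) by (simp_all add: m0_def m_def N2_def K0_def K_def ipl_mass ipl_kinetic N power2_eq_square algebra_simps)
  have hK0: "h\<^sup>2 * K0 \<le> 10" using mult_mono[OF h2(3) K0] nn by simp
  have hK: "0 \<le> h\<^sup>2 * K" "0 \<le> h\<^sup>2 * K0" using nn h2 by simp_all
  have m0_9: "m0 \<le> 9" using m0 s by linarith
  \<comment> \<open>9 + 10 / 6 is below 11.\<close>
  have N2: "N2 \<le> 11" "0 \<le> N2" "m \<le> N2" using mass hK0 hK m0_9 nn by linarith+
  have en: "K - Q / 2 = K0 - Q0 / 2"
  proof -
    have "h * nls_energy (1 / h\<^sup>2) y = l2sq (ipl' h y) - h * (norm (sqabs y))\<^sup>2 / 2" for y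
      using h by (simp add: nls_energy_def ipl_kinetic power2_eq_square right_diff_distrib)
    then show ?thesis unfolding K_def K0_def Q_def Q0_def using E by metis
  qed
  have K: "K \<le> 1400"
  proof -
    (* Q grows only like the square root of K, so conservation of K - Q / 2 bounds K *)
    have "(norm (site x j))\<^sup>2 \<le> 2 * (sqrt m * sqrt K)" for j
      using site_power2_le[OF h(1), of x j] by (simp add: m_def K_def)
    from norm_sqabs_power2_le[OF this] have "h * (norm (sqabs x))\<^sup>2 \<le> h * (2 * (sqrt m * sqrt K) * (norm x)\<^sup>2)"
      using h by (intro mult_left_mono) auto
    then have "Q \<le> 2 * (sqrt m * sqrt K) * N2" by (simp add: Q_def N2_def N algebra_simps)
    also have "\<dots> \<le> 2 * (sqrt 11 * sqrt K) * 11"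
      using nn N2 by (intro mult_mono mult_left_mono) (auto intro!: mult_right_mono)
    finally have "Q / 2 \<le> (11 * sqrt 11) * sqrt K" by simp
    \<comment> \<open>The mean inequality spends half of \<open>K\<close>; with
      \<open>K0 <= 10\<close> the conserved energy leaves K <= 20 + 1331 = 1351.\<close>
    also have "\<dots> \<le> ((11 * sqrt 11)\<^sup>2 + (sqrt K)\<^sup>2) / 2"
      using sum_squares_bound[of "11 * sqrt 11" "sqrt K"] by simp
    also have "\<dots> = (1331 + K) / 2" using nn by (simp add: power_mult_distrib)
    finally show ?thesis using en K0 nn by simp
  qed
  have A0: "\<bar>A0 - Q0\<bar> \<le> 350000 * h\<^sup>2" unfolding A0_def Q0_def
    by (rule ipl_uniform_bounds[OF h(1)]) (use m0_9 K0 in \<open>auto simp: m0_def K0_def\<close>)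
  have A: "\<bar>A - Q\<bar> \<le> 350000 * h\<^sup>2" unfolding A_def Q_def
    by (rule ipl_uniform_bounds[OF h(1)]) (use N2 K in \<open>auto simp: m_def K_def\<close>)
  \<comment> \<open>The mass of the interpolant is not conserved, so the comparison passes through
    the conserved \<open>N2\<close>: it dominates \<open>m\<close> and exceeds \<open>m0\<close> by
    at most 10 h^2 / 6. Together with the factor 3 * 11^2 this gives 605.\<close>
  have cube: "m ^ 3 \<le> m0 ^ 3 + 605 * h\<^sup>2"
  proof -
    have m0N: "m0 \<le> N2" using mass(1) hK by linarith
    have "N2 ^ 3 - m0 ^ 3 = (N2 - m0) * (N2\<^sup>2 + N2 * m0 + m0\<^sup>2)"
      by (simp add: power2_eq_square power3_eq_cube algebra_simps)
    also have "\<dots> \<le> (h\<^sup>2 * 10 / 6) * (11\<^sup>2 + 11 * 11 + 11\<^sup>2)"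
    proof (intro mult_mono add_mono power_mono)
      show "N2 - m0 \<le> h\<^sup>2 * 10 / 6" using mass(1) mult_left_mono[OF K0, of "h\<^sup>2"] h2 by simp
    qed (use N2 nn m0N in auto)
    finally have "N2 ^ 3 \<le> m0 ^ 3 + 605 * h\<^sup>2" by simp
    moreover have "m ^ 3 \<le> N2 ^ 3" using N2 nn by (intro power_mono) auto
    ultimately show ?thesis by simp
  qed
  have "l2sq (defect (ipl h x) (ipl' h x)) = K - A / 2 + m ^ 3 / 48"
    using l2sq_defect[OF P, of x] by (simp add: K_def A_def m_def)
  also have "\<dots> \<le> K0 - A0 / 2 + m0 ^ 3 / 48 + 350464 * h\<^sup>2"
    using en A A0 cube h2(1) by (simp add: abs_le_iff)
  also have "\<dots> = l2sq (defect (ipl h x0) (ipl' h x0)) + 350464 * h\<^sup>2"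
    using l2sq_defect[OF P, of x0] by (simp add: K0_def A0_def m0_def)
  \<comment> \<open>350464 = 592^2 is a square just above 350000 + 605 / 48, so the cross term of
    the binomial can be discarded.\<close>
  also have "\<dots> \<le> (7 * s + 592 * h)\<^sup>2"
    using e0 mult_pos_pos[OF s(1) h(1)] by (simp add: power2_sum power_mult_distrib)
  finally have "sqrt (l2sq (defect (ipl h x) (ipl' h x))) \<le> 7 * s + 592 * h"
    using s h by (intro real_le_lsqrt) auto
  \<comment> \<open>The two masses differ by h^2/6 times a difference of kinetic energies, at most
    1400 h^2 / 6 < 234 h^2.\<close>
  moreover have "\<bar>m - 1\<bar> \<le> 4 * s + 234 * h"
  proof -
    have "\<bar>m - m0\<bar> \<le> h\<^sup>2 * 1400 / 6"
      using mass mult_left_mono[OF K zero_le_power2[of h]] mult_left_mono[OF K0 zero_le_power2[of h]] h2 hK by linarith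
    then show ?thesis using m0 h2(2) by linarith
  qed
  \<comment> \<open>The coefficient of h is 225 * (8 * 592 + 3 * 234) = 1223550; that of
    \<open>\<delta>\<close> is only 225 * 136.\<close>
  ultimately have "225 * (8 * sqrt (l2sq (defect (ipl h x) (ipl' h x))) + 3 * \<bar>m - 1\<bar>) \<le> 1223550 * (\<delta> + h)"
    using \<delta> by (simp add: s_def)
  moreover have "h1_dist (ipl h x) Gamma_orbit \<le> 225 * (8 * sqrt (l2sq (defect (ipl h x) (ipl' h x))) + 3 * \<bar>m - 1\<bar>)"
    unfolding m_def by (rule soliton_stability[OF P interp_even]) (use N2 in \<open>auto simp: m_def\<close>)
  ultimately show ?thesis by linarith
qed

section \<open>Identification of \<open>V h\<close> and its dynamics with
  \<open>even_l2\<close>\<close>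

lemma V_iff: "h > 0 \<Longrightarrow> \<psi> \<in> V h \<longleftrightarrow> (\<exists>x. \<psi> = site x)"
proof
  assume "h > 0"
  show "\<psi> \<in> V h \<Longrightarrow> \<exists>x. \<psi> = site x"
    using mk_even_l2_inverse[of \<psi>] by (auto simp: V_def intro!: exI[of _ "mk_even_l2 \<psi>"])
  assume "\<exists>x. \<psi> = site x"
  then obtain x where x: "\<psi> = site x" by blast
  have "(\<lambda>j. (norm (site x (j + 1) - site x j))\<^sup>2 / h\<^sup>2) summable_on UNIV"
    using summable_on_cmult_left[OF summable_dirichlet[of x], of "1 / h\<^sup>2"] by simp
  then show "\<psi> \<in> V h" by (simp add: V_def x summable_site)
qed

lemma V_norm_site: "h > 0 \<Longrightarrow> V_norm h (site x) = sqrt (2 / h * dirichlet x + h * (norm x)\<^sup>2)"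
proof -
  assume "h > 0"
  have "(\<Sum>\<^sub>\<infinity>j\<in>UNIV. (norm (site x (j + 1) - site x j))\<^sup>2 / h\<^sup>2) = dirichlet x * (1 / h\<^sup>2)"
    unfolding dirichlet_def by (subst infsum_cmult_left'[symmetric]) simp
  then show ?thesis unfolding V_norm_def norm_even_l2_power2
    using \<open>h > 0\<close> by (simp add: power2_eq_square[of h])
qed

text \<open>At fixed h the norm of \<open>V h\<close> and the norm of \<open>even_l2\<close> are
  equivalent. The constants degenerate as h tends to 0, which is harmless because only the topology
  is transferred.\<close>

lemma V_norm_tendsto_iff:
  assumes h: "h > 0"
  shows "((\<lambda>\<tau>. V_norm h (\<lambda>j. site (y \<tau>) j - site (y t) j)) \<longlongrightarrow> 0) F \<longleftrightarrow> (y \<longlongrightarrow> y t) F"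
proof -
  have eq: "(\<lambda>j. site (y \<tau>) j - site (y t) j) = site (y \<tau> - y t)" for \<tau> by auto
  have lower: "norm x \<le> (1 / sqrt h) * V_norm h (site x)" for x
  proof -
    have "norm x = (1 / sqrt h) * sqrt (h * (norm x)\<^sup>2)" using h by (simp add: real_sqrt_mult)
    also have "\<dots> \<le> (1 / sqrt h) * V_norm h (site x)"
      unfolding V_norm_site[OF h] using h dirichlet_nonneg[of x]
      by (intro mult_left_mono real_sqrt_le_mono) auto
    finally show ?thesis .
  qed
  have upper: "V_norm h (site x) \<le> sqrt (8 / h + h) * norm x" for x
  proof -
    have "2 / h * dirichlet x + h * (norm x)\<^sup>2 \<le> 2 / h * (4 * (norm x)\<^sup>2) + h * (norm x)\<^sup>2"
      using h dirichlet_le[of x] by (intro add_right_mono mult_left_mono) auto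
    also have "\<dots> = (8 / h + h) * (norm x)\<^sup>2" by (simp add: algebra_simps)
    finally have "V_norm h (site x) \<le> sqrt ((8 / h + h) * (norm x)\<^sup>2)"
      unfolding V_norm_site[OF h] by (rule real_sqrt_le_mono)
    then show ?thesis by (simp add: real_sqrt_mult)
  qed
  have V0: "0 \<le> V_norm h (site x)" for x
    unfolding V_norm_site[OF h] using h dirichlet_nonneg[of x] by simp
  show ?thesis unfolding eq
  proof
    assume "((\<lambda>\<tau>. V_norm h (site (y \<tau> - y t))) \<longlongrightarrow> 0) F"
    from tendsto_mult_right_zero[OF this, of "1 / sqrt h"]
    have "((\<lambda>\<tau>. norm (y \<tau> - y t)) \<longlongrightarrow> 0) F"
      by (rule Lim_null_comparison[OF always_eventually[OF allI], rotated]) (simp only: real_norm_def abs_norm_cancel lower)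
    then show "(y \<longlongrightarrow> y t) F" by (simp add: tendsto_norm_zero_iff LIM_zero_iff)
  next
    assume "(y \<longlongrightarrow> y t) F"
    then have "((\<lambda>\<tau>. norm (y \<tau> - y t)) \<longlongrightarrow> 0) F" by (simp add: tendsto_norm_zero_iff LIM_zero_iff)
    from tendsto_mult_right_zero[OF this, of "sqrt (8 / h + h)"]
    show "((\<lambda>\<tau>. V_norm h (site (y \<tau> - y t))) \<longlongrightarrow> 0) F"
      by (rule Lim_null_comparison[OF always_eventually[OF allI], rotated]) (simp only: real_norm_def abs_of_nonneg[OF V0] upper)
  qed
qed

lemma nls_field_iff:
  assumes "h > 0"
  shows "\<i> * D = - (1 / complex_of_real h ^ 2) * (site x (l + 1) + site x (l - 1) - 2 * site x l)
      - complex_of_real ((norm (site x l))\<^sup>2) * site x l \<longleftrightarrow> D = site (nls_field (1 / h\<^sup>2) x) l"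
proof -
  define R where "R = (1 / complex_of_real h ^ 2) * (site x (l + 1) + site x (l - 1) - 2 * site x l)
      + complex_of_real ((norm (site x l))\<^sup>2) * site x l"
  have "site (nls_field (1 / h\<^sup>2) x) l = \<i> * R"
    by (simp add: nls_field_def nls_grad_def R_def scaleR_conv_of_real)
  moreover have "\<i> * D = - R \<longleftrightarrow> D = \<i> * R"
  proof
    assume "\<i> * D = - R"
    then have "(- \<i>) * (\<i> * D) = (- \<i>) * (- R)" by (rule arg_cong)
    then show "D = \<i> * R" by (simp add: mult.assoc[symmetric])
  qed (simp add: mult.assoc[symmetric])
  ultimately show ?thesis by (simp add: R_def)
qed

text \<open>Agreement is claimed for nonnegative times only, since \<open>dnls_solution\<close>
  leaves negative times unconstrained. The passage from sitewise derivatives to a derivative in norm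
  is \<open>flow_line_sitewise\<close>; the way back evaluates the bounded linear map
  \<open>site\<close>.\<close>

lemma dnls_solution_iff:
  assumes h: "h > 0"
  shows "dnls_solution h (site x0) \<psi> \<longleftrightarrow>
    (\<exists>y. flow_line (1 / h\<^sup>2) y \<and> y 0 = x0 \<and> (\<forall>t\<ge>0. \<psi> t = site (y t)))"
proof
  assume sol: "dnls_solution h (site x0) \<psi>"
  then have "\<forall>t\<ge>0. \<exists>x. \<psi> t = site x" by (simp add: dnls_solution_def V_iff[OF h])
  then obtain y where y: "\<And>t. t \<ge> 0 \<Longrightarrow> \<psi> t = site (y t)" by metis
  have "flow_line (1 / h\<^sup>2) y"
  proof (rule flow_line_sitewise)
    have "(y \<longlongrightarrow> y t) (at t within {0..})" if t: "t \<ge> 0" for t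
    proof -
      have "((\<lambda>\<tau>. V_norm h (\<lambda>j. \<psi> \<tau> j - \<psi> t j)) \<longlongrightarrow> 0) (at t within {0..})"
        using sol t by (simp add: dnls_solution_def)
      then have "((\<lambda>\<tau>. V_norm h (\<lambda>j. site (y \<tau>) j - site (y t) j)) \<longlongrightarrow> 0) (at t within {0..})"
        by (rule Lim_transform_eventually) (auto simp: eventually_at_filter y t)
      then show ?thesis by (simp add: V_norm_tendsto_iff[OF h])
    qed
    then show "continuous_on {0..} y" by (simp add: continuous_on_def)
    fix t :: real and l :: int assume t: "t \<ge> 0"
    obtain D where D: "((\<lambda>\<tau>. \<psi> \<tau> l) has_vector_derivative D) (at t within {0..})"
      "\<i> * D = - (1 / complex_of_real h ^ 2) * (\<psi> t (l + 1) + \<psi> t (l - 1) - 2 * \<psi> t l)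
        - complex_of_real ((norm (\<psi> t l))\<^sup>2) * \<psi> t l"
      using sol t unfolding dnls_solution_def by blast
    have "D = site (nls_field (1 / h\<^sup>2) (y t)) l"
      using D(2) unfolding y[OF t] nls_field_iff[OF h] .
    with D(1) show "((\<lambda>\<tau>. site (y \<tau>) l) has_vector_derivative site (nls_field (1 / h\<^sup>2) (y t)) l) (at t within {0..})"
      using has_vector_derivative_transform[of t "{0..}" "\<lambda>\<tau>. site (y \<tau>) l" "\<lambda>\<tau>. \<psi> \<tau> l"] t y by simp
  qed
  moreover have "y 0 = x0" using sol y[of 0] by (simp add: dnls_solution_def site_inject)
  ultimately show "\<exists>y. flow_line (1 / h\<^sup>2) y \<and> y 0 = x0 \<and> (\<forall>t\<ge>0. \<psi> t = site (y t))"
    using y by blast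
next
  assume "\<exists>y. flow_line (1 / h\<^sup>2) y \<and> y 0 = x0 \<and> (\<forall>t\<ge>0. \<psi> t = site (y t))"
  then obtain y where y: "flow_line (1 / h\<^sup>2) y" "y 0 = x0" "\<And>t. t \<ge> 0 \<Longrightarrow> \<psi> t = site (y t)" by blast
  have der: "(y has_vector_derivative nls_field (1 / h\<^sup>2) (y t)) (at t within {0..})" if "t \<ge> 0" for t
    using y(1) that by (simp add: flow_line_def)
  show "dnls_solution h (site x0) \<psi>"
    unfolding dnls_solution_def
  proof (intro conjI allI impI)
    show "\<psi> 0 = site x0" using y by simp
    fix t :: real assume t: "t \<ge> 0"
    show "\<psi> t \<in> V h" using y(3)[OF t] V_iff[OF h] by blast
    have "(y \<longlongrightarrow> y t) (at t within {0..})"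
      using has_vector_derivative_continuous[OF der[OF t]] by (simp add: continuous_within)
    then have "((\<lambda>\<tau>. V_norm h (\<lambda>j. site (y \<tau>) j - site (y t) j)) \<longlongrightarrow> 0) (at t within {0..})"
      by (simp add: V_norm_tendsto_iff[OF h])
    then show "((\<lambda>\<tau>. V_norm h (\<lambda>j. \<psi> \<tau> j - \<psi> t j)) \<longlongrightarrow> 0) (at t within {0..})"
      by (rule Lim_transform_eventually) (auto simp: eventually_at_filter y(3) t)
    fix l
    have "((\<lambda>\<tau>. site (y \<tau>) l) has_vector_derivative site (nls_field (1 / h\<^sup>2) (y t)) l) (at t within {0..})"
      by (rule bounded_linear.has_vector_derivative[OF bounded_linear_site der[OF t]])
    then have "((\<lambda>\<tau>. \<psi> \<tau> l) has_vector_derivative site (nls_field (1 / h\<^sup>2) (y t)) l) (at t within {0..})"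
      using has_vector_derivative_transform[of t "{0..}" "\<lambda>\<tau>. \<psi> \<tau> l" "\<lambda>\<tau>. site (y \<tau>) l"] t y(3) by simp
    then show "\<exists>D. ((\<lambda>\<tau>. \<psi> \<tau> l) has_vector_derivative D) (at t within {0..})
          \<and> \<i> * D = - (1 / complex_of_real h ^ 2) * (\<psi> t (l + 1) + \<psi> t (l - 1) - 2 * \<psi> t l)
                    - complex_of_real ((norm (\<psi> t l))\<^sup>2) * \<psi> t l"
      unfolding y(3)[OF t] nls_field_iff[OF h] by blast
  qed
qed

text \<open>Both thresholds can be 1: \<open>\<delta> < 1\<close> keeps the doubled distance below
  2, as \<open>defect_near_soliton\<close> requires, and \<open>h <= 1\<close> gives h^2 <= h, which
  turns the discretisation errors in the mass into terms linear in h.\<close>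

theorem theorem2p1:
  "\<exists>\<delta>0::real. \<exists>h0::real. \<exists>C::real. \<delta>0 > 0 \<and> h0 > 0 \<and>
     (\<forall>\<delta> h. 0 < \<delta> \<and> \<delta> < \<delta>0 \<and> 0 < h \<and> h \<le> h0 \<longrightarrow>
       (\<forall>\<psi>0 \<in> V h. h1_dist (interp h \<psi>0) Gamma_orbit \<le> \<delta> \<longrightarrow>
         (\<exists>\<psi>. dnls_solution h \<psi>0 \<psi> \<and>
              (\<forall>\<phi>. dnls_solution h \<psi>0 \<phi> \<longrightarrow> (\<forall>t\<ge>0. \<phi> t = \<psi> t)) \<and>
              (\<forall>t\<ge>0. h1_dist (interp h (\<psi> t)) Gamma_orbit \<le> C * (\<delta> + h)))))"
proof (rule exI[of _ 1], rule exI[of _ 1], rule exI[of _ 1223550], intro conjI allI impI ballI)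
  fix \<delta> h :: real and \<psi>0
  assume "0 < \<delta> \<and> \<delta> < 1 \<and> 0 < h \<and> h \<le> 1"
    and "\<psi>0 \<in> V h" and init: "h1_dist (interp h \<psi>0) Gamma_orbit \<le> \<delta>"
  then have \<delta>: "0 < \<delta>" "\<delta> < 1" and h: "0 < h" "h \<le> 1" by auto
  obtain x0 where x0: "\<psi>0 = site x0" using \<open>\<psi>0 \<in> V h\<close> V_iff[OF h(1)] by blast
  obtain y where y: "flow_line (1 / h\<^sup>2) y" "y 0 = x0" using flow_line_exists by blast
  show "\<exists>\<psi>. dnls_solution h \<psi>0 \<psi> \<and>
      (\<forall>\<phi>. dnls_solution h \<psi>0 \<phi> \<longrightarrow> (\<forall>t\<ge>0. \<phi> t = \<psi> t)) \<and>
      (\<forall>t\<ge>0. h1_dist (interp h (\<psi> t)) Gamma_orbit \<le> 1223550 * (\<delta> + h))"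
  proof (intro exI[of _ "\<lambda>t. site (y t)"] conjI allI impI)
    show "dnls_solution h \<psi>0 (\<lambda>t. site (y t))"
      unfolding x0 dnls_solution_iff[OF h(1)] using y by blast
    fix t :: real assume t: "t \<ge> 0"
    show "\<phi> t = site (y t)" if "dnls_solution h \<psi>0 \<phi>" for \<phi>
      using that flow_line_unique[OF _ y(1) _ t] y(2) t unfolding x0 dnls_solution_iff[OF h(1)] by metis
    show "h1_dist (interp h (site (y t))) Gamma_orbit \<le> 1223550 * (\<delta> + h)"
      using lattice_stability[OF h \<delta> init[unfolded x0]] flow_line_norm[OF y(1) t] flow_line_energy[OF y(1) t] y(2)
      by simp
  qed
qed simp_all

end
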